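(* Let $a\in\mathbb{R}$ with $a\ge 2$. Polynomial identity testing for skew arithmetic circuits (over $\mathbb{Z}$) is logspace-reducible to the compressed word problem for the group $G_a$.
   Context: $G_a=\langle g_a,h\rangle\le \mathsf{GL}_2(\mathbb{R})$ where $g_a=\begin{pmatrix} a&0\\0&1\end{pmatrix}$ and $h=\begin{pmatrix}1&1\\0&1\end{pmatrix}$. The compressed word problem for $G_a$: given a straight-line program (a finite acyclic set of variables with a start variable, each variable's right-hand side being either a letter of $\{g_a,g_a^{-1},h,h^{-1}\}$ or a concatenation of two earlier variables), decide whether the derived word evaluates to the identity matrix. An arithmetic circuit is a finite set of gates with an output gate, where each gate's right-hand side is a variable $x_i$, a constant in $\{-1,0,1\}$, or $B+C$ or $B\cdot C$ for gates $B,C$, acyclically; each gate evaluates to a polynomial in $\mathbb{Z}[x_1,\dots,x_m]$ and the circuit's value is that of its output gate. It is skew if for every multiplication gate with right-hand side $B\cdot C$, one of $B,C$ is an input gate (labelled by a variable or constant). Polynomial identity testing for skew circuits: given a skew arithmetic circuit, decide whether it evaluates to the zero polynomial. *)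

theory Defs
  imports
    "HOL-Analysis.Analysis"
    "HOL-Algebra.Generated_Groups"
    "HOL-Library.Poly_Mapping"
begin

section \<open>Logspace transducers\<close>

text \<open>
  A deterministic Turing machine with a read-only input tape holding the input word between two
  end markers, finitely many one-sided work tapes and a write-only, one-way output tape.  States are
  \<^term>\<open>{..<states M}\<close> with initial state 0, work symbols are \<^term>\<open>{..<work_symbols M}\<close> with
  blank symbol 0.  The transition function maps the state, the scanned input symbol and the scanned
  work symbols to \<^term>\<open>None\<close> (halt), or to the next state, the move of the input head, a written
  symbol and a move for each work tape, and an optional output bit.
\<close>

datatype input_symbol = Left_End | Right_End | Bit bool

datatype move = Move_Left | Stay | Move_Right

record transducer =
  states :: nat
  work_symbols :: nat
  work_tapes :: nat
  transition :: "nat \<Rightarrow> input_symbol \<Rightarrow> nat list \<Rightarrow>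
    (nat \<times> move \<times> (nat \<times> move) list \<times> bool option) option"

definition wf_transducer :: "transducer \<Rightarrow> bool" where
  "wf_transducer M \<longleftrightarrow>
     0 < states M \<and> 0 < work_symbols M \<and>
     (\<forall>q s xs q' d as z.
        q < states M \<longrightarrow> length xs = work_tapes M \<longrightarrow> set xs \<subseteq> {..<work_symbols M} \<longrightarrow>
        transition M q s xs = Some (q', d, as, z) \<longrightarrow>
        q' < states M \<and> length as = work_tapes M \<and> fst ` set as \<subseteq> {..<work_symbols M})"

text \<open>A work tape is represented by its contents and the position of its head.\<close>

record config =
  state :: nat
  input_head :: nat
  tapes :: "((nat \<Rightarrow> nat) \<times> nat) list"
  written :: "bool list"

fun move_head :: "move \<Rightarrow> nat \<Rightarrow> nat" where
  "move_head Move_Left p = p - 1"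
| "move_head Stay p = p"
| "move_head Move_Right p = p + 1"

definition read_input :: "bool list \<Rightarrow> nat \<Rightarrow> input_symbol" where
  "read_input w p =
     (if p = 0 then Left_End else if p \<le> length w then Bit (w ! (p - 1)) else Right_End)"

fun update_tape :: "(nat \<Rightarrow> nat) \<times> nat \<Rightarrow> nat \<times> move \<Rightarrow> (nat \<Rightarrow> nat) \<times> nat" where
  "update_tape (t, p) (x, d) = (t(p := x), move_head d p)"

definition init_config :: "transducer \<Rightarrow> config" where
  "init_config M =
     \<lparr>state = 0, input_head = 0, tapes = replicate (work_tapes M) (\<lambda>_. 0, 0), written = []\<rparr>"

text \<open>The input head cannot leave the area delimited by the end markers.\<close>

definition step :: "transducer \<Rightarrow> bool list \<Rightarrow> config \<Rightarrow> config option" where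
  "step M w c =
     (case transition M (state c) (read_input w (input_head c)) (map (\<lambda>(t, p). t p) (tapes c)) of
        None \<Rightarrow> None
      | Some (q, d, as, z) \<Rightarrow> Some
          \<lparr>state = q,
           input_head = min (length w + 1) (move_head d (input_head c)),
           tapes = map2 update_tape (tapes c) as,
           written = written c @ (case z of None \<Rightarrow> [] | Some b \<Rightarrow> [b])\<rparr>)"

definition reachable :: "transducer \<Rightarrow> bool list \<Rightarrow> config \<Rightarrow> bool" where
  "reachable M w c \<longleftrightarrow> (\<lambda>c c'. step M w c = Some c')\<^sup>*\<^sup>* (init_config M) c"

definition transducer_computes :: "transducer \<Rightarrow> (bool list \<Rightarrow> bool list) \<Rightarrow> bool" where
  "transducer_computes M f \<longleftrightarrow>
     (\<forall>w. \<exists>c. reachable M w c \<and> step M w c = None \<and> written c = f w)"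

text \<open>The summand 2 only avoids degenerate values of the logarithm for words of length 0 and 1.\<close>

definition runs_in_logspace :: "transducer \<Rightarrow> bool" where
  "runs_in_logspace M \<longleftrightarrow>
     (\<exists>C::real. \<forall>w c. reachable M w c \<longrightarrow>
        (\<forall>(t, p) \<in> set (tapes c). real p \<le> C * log 2 (real (length w + 2))))"

definition logspace_computable :: "(bool list \<Rightarrow> bool list) \<Rightarrow> bool" where
  "logspace_computable f \<longleftrightarrow>
     (\<exists>M. wf_transducer M \<and> runs_in_logspace M \<and> transducer_computes M f)"


section \<open>Decision problems and logspace many-one reductions\<close>

text \<open>
  A decision problem consists of the set of (encodings of) its instances and the subset of
  positive instances.  Reductions map instances to instances; nothing is required of the output
  on words that encode no instance.
\<close>

record decision_problem =
  instances :: "bool list set"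
  yes_instances :: "bool list set"

definition logspace_reducible :: "decision_problem \<Rightarrow> decision_problem \<Rightarrow> bool" where
  "logspace_reducible P Q \<longleftrightarrow>
     (\<exists>f. logspace_computable f \<and>
        (\<forall>w \<in> instances P.
           f w \<in> instances Q \<and> (w \<in> yes_instances P \<longleftrightarrow> f w \<in> yes_instances Q)))"

text \<open>
  Circuits and straight-line programs are serialised as lists of natural numbers.  These numbers
  are only tags and names (of gates and variables), never values of arithmetic, so writing them
  in unary makes the encoding at most quadratic in the number of names used.
\<close>

definition encode_nats :: "nat list \<Rightarrow> bool list" where
  "encode_nats ns = concat (map (\<lambda>n. replicate n True @ [False]) ns)"


section \<open>Skew arithmetic circuits\<close>

text \<open>Integer polynomials in the variables \<open>x\<^sub>0, x\<^sub>1, \<dots>\<close>\<close>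

type_synonym int_mpoly = "(nat \<Rightarrow>\<^sub>0 nat) \<Rightarrow>\<^sub>0 int"

definition mpoly_var :: "nat \<Rightarrow> int_mpoly" where
  "mpoly_var i = Poly_Mapping.single (Poly_Mapping.single i 1) 1"

text \<open>Gates are named by their positions in the list of right-hand sides.\<close>

datatype gate = Var nat | Const int | Add nat nat | Mul nat nat

datatype circuit = Circuit (gates: "gate list") (output_gate: nat)

fun gate_refs :: "gate \<Rightarrow> nat set" where
  "gate_refs (Var i) = {}"
| "gate_refs (Const c) = {}"
| "gate_refs (Add B C) = {B, C}"
| "gate_refs (Mul B C) = {B, C}"

fun is_input_gate :: "gate \<Rightarrow> bool" where
  "is_input_gate (Var i) = True"
| "is_input_gate (Const c) = True"
| "is_input_gate (Add B C) = False"
| "is_input_gate (Mul B C) = False"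

definition arithmetic_circuit :: "circuit \<Rightarrow> bool" where
  "arithmetic_circuit K \<longleftrightarrow>
     output_gate K < length (gates K) \<and>
     (\<forall>g \<in> set (gates K). gate_refs g \<subseteq> {..<length (gates K)}) \<and>
     (\<forall>c. Const c \<in> set (gates K) \<longrightarrow> c \<in> {-1, 0, 1}) \<and>
     acyclic {(B, A). A < length (gates K) \<and> B \<in> gate_refs (gates K ! A)}"

definition skew :: "circuit \<Rightarrow> bool" where
  "skew K \<longleftrightarrow>
     (\<forall>B C. Mul B C \<in> set (gates K) \<longrightarrow>
        is_input_gate (gates K ! B) \<or> is_input_gate (gates K ! C))"

inductive gate_value :: "circuit \<Rightarrow> nat \<Rightarrow> int_mpoly \<Rightarrow> bool" for K where
  "A < length (gates K) \<Longrightarrow> gates K ! A = Var i \<Longrightarrow> gate_value K A (mpoly_var i)"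
| "A < length (gates K) \<Longrightarrow> gates K ! A = Const c \<Longrightarrow> gate_value K A (of_int c)"
| "A < length (gates K) \<Longrightarrow> gates K ! A = Add B C \<Longrightarrow>
     gate_value K B p \<Longrightarrow> gate_value K C q \<Longrightarrow> gate_value K A (p + q)"
| "A < length (gates K) \<Longrightarrow> gates K ! A = Mul B C \<Longrightarrow>
     gate_value K B p \<Longrightarrow> gate_value K C q \<Longrightarrow> gate_value K A (p * q)"

definition circuit_value :: "circuit \<Rightarrow> int_mpoly" where
  "circuit_value K = (THE p. gate_value K (output_gate K) p)"

lemma gate_value_unique: "gate_value K A p \<Longrightarrow> gate_value K A q \<Longrightarrow> p = q"
proof (induction arbitrary: q rule: gate_value.induct)
  case (1 A i) from 1(3) show ?case using 1(1,2) by cases auto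
next
  case (2 A c) from 2(3) show ?case using 2(1,2) by cases auto
next
  case (3 A B C p p') from 3(7) show ?case using 3(2,5,6) by cases auto
next
  case (4 A B C p p') from 4(7) show ?case using 4(2,5,6) by cases auto
qed

lemma gate_value_exists:
  assumes "arithmetic_circuit K" "A < length (gates K)"
  shows "\<exists>p. gate_value K A p"
proof -
  let ?R = "{(B, A). A < length (gates K) \<and> B \<in> gate_refs (gates K ! A)}"
  have lt: "B < length (gates K)" if "(B, A) \<in> ?R" for A B
    using assms(1) that nth_mem[of A "gates K"] unfolding arithmetic_circuit_def by blast
  have "finite ?R"
    by (rule finite_subset[of _ "{..<length (gates K)} \<times> {..<length (gates K)}"]) (use lt in auto)
  then have "wf ?R"
    using assms(1) by (auto simp: arithmetic_circuit_def intro: finite_acyclic_wf)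
  then show ?thesis using assms(2)
  proof (induction A rule: wf_induct_rule)
    case (less A)
    show ?case
    proof (cases "gates K ! A")
      case (Add B C)
      then have "(B, A) \<in> ?R" "(C, A) \<in> ?R" using less.prems by auto
      then show ?thesis using less Add lt gate_value.intros(3) by meson
    next
      case (Mul B C)
      then have "(B, A) \<in> ?R" "(C, A) \<in> ?R" using less.prems by auto
      then show ?thesis using less Mul lt gate_value.intros(4) by meson
    qed (use less.prems gate_value.intros in blast)+
  qed
qed

lemma gate_value_circuit_value:
  "arithmetic_circuit K \<Longrightarrow> gate_value K (output_gate K) (circuit_value K)"
  unfolding circuit_value_def
  by (rule theI') (use gate_value_exists gate_value_unique in \<open>auto simp: arithmetic_circuit_def\<close>)

fun encode_gate :: "gate \<Rightarrow> nat list" where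
  "encode_gate (Var i) = [0, i]"
| "encode_gate (Const c) = [1, nat (c + 1)]"
| "encode_gate (Add B C) = [2, B, C]"
| "encode_gate (Mul B C) = [3, B, C]"

definition encode_circuit :: "circuit \<Rightarrow> bool list" where
  "encode_circuit K = encode_nats (output_gate K # concat (map encode_gate (gates K)))"

definition skew_PIT :: decision_problem where
  "skew_PIT =
     \<lparr>instances = {encode_circuit K | K. arithmetic_circuit K \<and> skew K},
      yes_instances =
        {encode_circuit K | K. arithmetic_circuit K \<and> skew K \<and> circuit_value K = 0}\<rparr>"


section \<open>The compressed word problem for the group generated by two matrices\<close>

definition GL2 :: "(real^2^2) monoid" where
  "GL2 = \<lparr>carrier = {A. invertible A}, monoid.mult = (**), one = mat 1\<rparr>"

definition g_mat :: "real \<Rightarrow> real^2^2" where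
  "g_mat a = vector [vector [a, 0], vector [0, 1]]"

definition h_mat :: "real^2^2" where
  "h_mat = vector [vector [1, 1], vector [0, 1]]"

definition G_group :: "real \<Rightarrow> (real^2^2) monoid" where
  "G_group a = subgroup_generated GL2 {g_mat a, h_mat}"

datatype letter = G | G_inv | H | H_inv

fun letter_value :: "real \<Rightarrow> letter \<Rightarrow> real^2^2" where
  "letter_value a G = g_mat a"
| "letter_value a G_inv = inv\<^bsub>G_group a\<^esub> (g_mat a)"
| "letter_value a H = h_mat"
| "letter_value a H_inv = inv\<^bsub>G_group a\<^esub> h_mat"

definition word_value :: "real \<Rightarrow> letter list \<Rightarrow> real^2^2" where
  "word_value a w = foldr (\<lambda>l A. letter_value a l \<otimes>\<^bsub>G_group a\<^esub> A) w \<one>\<^bsub>G_group a\<^esub>"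

datatype slp_rhs = Letter letter | Concat nat nat

datatype slp = SLP (rules: "slp_rhs list") (start_var: nat)

fun slp_refs :: "slp_rhs \<Rightarrow> nat set" where
  "slp_refs (Letter l) = {}"
| "slp_refs (Concat B C) = {B, C}"

definition straight_line_program :: "slp \<Rightarrow> bool" where
  "straight_line_program S \<longleftrightarrow>
     start_var S < length (rules S) \<and>
     (\<forall>r \<in> set (rules S). slp_refs r \<subseteq> {..<length (rules S)}) \<and>
     acyclic {(B, A). A < length (rules S) \<and> B \<in> slp_refs (rules S ! A)}"

inductive derives :: "slp \<Rightarrow> nat \<Rightarrow> letter list \<Rightarrow> bool" for S where
  "A < length (rules S) \<Longrightarrow> rules S ! A = Letter l \<Longrightarrow> derives S A [l]"
| "A < length (rules S) \<Longrightarrow> rules S ! A = Concat B C \<Longrightarrow>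
     derives S B u \<Longrightarrow> derives S C v \<Longrightarrow> derives S A (u @ v)"

definition derived_word :: "slp \<Rightarrow> letter list" where
  "derived_word S = (THE w. derives S (start_var S) w)"

lemma derives_unique: "derives S A u \<Longrightarrow> derives S A v \<Longrightarrow> u = v"
proof (induction arbitrary: v rule: derives.induct)
  case (1 A l) from 1(3) show ?case using 1(1,2) by cases auto
next
  case (2 A B C p p') from 2(7) show ?case using 2(2,5,6) by cases auto
qed

lemma derives_exists:
  assumes "straight_line_program S" "A < length (rules S)"
  shows "\<exists>w. derives S A w"
proof -
  let ?R = "{(B, A). A < length (rules S) \<and> B \<in> slp_refs (rules S ! A)}"
  have lt: "B < length (rules S)" if "(B, A) \<in> ?R" for A B
    using assms(1) that nth_mem[of A "rules S"] unfolding straight_line_program_def by blast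
  have "finite ?R"
    by (rule finite_subset[of _ "{..<length (rules S)} \<times> {..<length (rules S)}"]) (use lt in auto)
  then have "wf ?R"
    using assms(1) by (auto simp: straight_line_program_def intro: finite_acyclic_wf)
  then show ?thesis using assms(2)
  proof (induction A rule: wf_induct_rule)
    case (less A)
    show ?case
    proof (cases "rules S ! A")
      case (Concat B C)
      then have "(B, A) \<in> ?R" "(C, A) \<in> ?R" using less.prems by auto
      then show ?thesis using less Concat lt derives.intros(2) by meson
    qed (use less.prems derives.intros in blast)+
  qed
qed

lemma derives_derived_word:
  "straight_line_program S \<Longrightarrow> derives S (start_var S) (derived_word S)"
  unfolding derived_word_def
  by (rule theI') (use derives_exists derives_unique in \<open>auto simp: straight_line_program_def\<close>)

fun letter_code :: "letter \<Rightarrow> nat" where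
  "letter_code G = 0"
| "letter_code G_inv = 1"
| "letter_code H = 2"
| "letter_code H_inv = 3"

fun encode_rhs :: "slp_rhs \<Rightarrow> nat list" where
  "encode_rhs (Letter l) = [0, letter_code l]"
| "encode_rhs (Concat B C) = [1, B, C]"

definition encode_slp :: "slp \<Rightarrow> bool list" where
  "encode_slp S = encode_nats (start_var S # concat (map encode_rhs (rules S)))"

definition compressed_word_problem :: "real \<Rightarrow> decision_problem" where
  "compressed_word_problem a =
     \<lparr>instances = {encode_slp S | S. straight_line_program S},
      yes_instances =
        {encode_slp S | S. straight_line_program S \<and>
           word_value a (derived_word S) = \<one>\<^bsub>G_group a\<^esub>}\<rparr>"

end

theory Submission
  imports Defs
begin

text \<open>
  Every gate with value \<open>p\<close> becomes a variable deriving a word with value \<open>[[1, p], [0, 1]]\<close>, together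
  with a variable for the inverse.  Addition of gates is concatenation, multiplication by \<open>-1\<close>
  exchanges the two variables, and multiplication by an input \<open>x\<^sub>i\<close>, replaced by a power
  \<open>a\<^sup>e\<close>, is conjugation by \<open>g\<^sup>e\<close>.  In a skew circuit these are the only operations.  The powers
  \<open>g\<^sup>e\<close> with \<open>e = 2\<^sup>k\<close> are obtained by iterated squaring.  With \<open>N\<close> the length of the encoded circuit
  and \<open>e = 2 ^ ((i + 1) * N)\<close> for \<open>x\<^sub>i\<close>, different monomials turn into powers of \<open>a\<close> whose exponents
  differ by at least \<open>2 ^ N\<close>, whereas the absolute values of the coefficients add up to less than \<open>2 ^ N\<close>;
  as \<open>a \<ge> 2\<close>, the leading term of a nonzero polynomial cannot be cancelled.

  The rules for a gate depend only on the gate and, for a multiplication, on its two arguments, so a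
  transducer that finds a gate by reading the input from the start needs a fixed number of
  polynomially bounded counters, which it keeps in binary.
\<close>

section \<open>A structured language for transducers\<close>

text \<open>Concatenation adds upper right entries and conjugation by \<open>g\<close> multiplies
  them by powers of \<open>a\<close>; neither multiplies two arbitrary entries, so only skew
  products can be translated. Skewness also keeps the numbers small: a gate at most doubles the sum
  of absolute coefficients and raises each exponent by at most one, whereas repeated squaring in a
  general circuit goes far beyond \<open>2 ^ N\<close>. The exponent of \<open>a\<close> has
  \<open>i + 1\<close> and not \<open>i\<close> in it so that every weight becomes a multiple of
  \<open>2 ^ N\<close>; this creates the gaps. The word length serves as \<open>N\<close> because it
  exceeds both the number of gates and all variable indices, and a transducer obtains it by one scan
  of the input. Two obstacles shape the rest. A transducer has to halt in logarithmic space on every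
  word, also on words that encode no circuit; hence decoding is total and the number of rules
  depends on \<open>N\<close> alone. Gates may be listed in any order; hence acyclicity of the
  program is not read off from a numbering but follows once every variable is seen to derive a
  word.\<close>

datatype 'r com =
    Skip
  | Act "('r \<Rightarrow> nat) \<Rightarrow> move \<times> ('r \<Rightarrow> nat \<times> move) \<times> bool option"
  | Seq "'r com" "'r com" (infixr ";;" 60)
  | Cond "input_symbol \<Rightarrow> ('r \<Rightarrow> nat) \<Rightarrow> bool" "'r com" "'r com"
  | While "input_symbol \<Rightarrow> ('r \<Rightarrow> nat) \<Rightarrow> bool" "'r com"

type_synonym 'r store = "nat \<times> ('r \<Rightarrow> (nat \<Rightarrow> nat) \<times> nat) \<times> bool list"

definition scan :: "('r \<Rightarrow> (nat \<Rightarrow> nat) \<times> nat) \<Rightarrow> 'r \<Rightarrow> nat" where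
  "scan \<tau> r = fst (\<tau> r) (snd (\<tau> r))"

fun act_result ::
  "bool list \<Rightarrow> move \<times> ('r \<Rightarrow> nat \<times> move) \<times> bool option \<Rightarrow> 'r store \<Rightarrow> 'r store" where
  "act_result w (d, \<alpha>, z) (p, \<tau>, out) =
     (min (length w + 1) (move_head d p), \<lambda>r. update_tape (\<tau> r) (\<alpha> r),
      out @ (case z of None \<Rightarrow> [] | Some b \<Rightarrow> [b]))"

fun heads_le :: "nat \<Rightarrow> 'r store \<Rightarrow> bool" where
  "heads_le B (p, \<tau>, out) \<longleftrightarrow> (\<forall>r. snd (\<tau> r) \<le> B)"

fun holds :: "bool list \<Rightarrow> (input_symbol \<Rightarrow> ('r \<Rightarrow> nat) \<Rightarrow> bool) \<Rightarrow> 'r store \<Rightarrow> bool" where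
  "holds w b (p, \<tau>, out) \<longleftrightarrow> b (read_input w p) (scan \<tau>)"

text \<open>A derivation certifies two things at once: the command terminates, and no action leaves
  a work head beyond \<open>B\<close>. Both are required, since a transducer has to halt on every
  word.\<close>

inductive exec :: "bool list \<Rightarrow> nat \<Rightarrow> 'r com \<Rightarrow> 'r store \<Rightarrow> 'r store \<Rightarrow> bool" for w B where
  exec_Skip: "exec w B Skip s s"
| exec_Act: "s' = act_result w (f (scan (fst (snd s)))) s \<Longrightarrow> heads_le B s' \<Longrightarrow> exec w B (Act f) s s'"
| exec_Seq: "exec w B c s s' \<Longrightarrow> exec w B d s' s'' \<Longrightarrow> exec w B (c ;; d) s s''"
| exec_Cond: "exec w B (if holds w b s then c else d) s s' \<Longrightarrow> exec w B (Cond b c d) s s'"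
| exec_While_stop: "\<not> holds w b s \<Longrightarrow> exec w B (While b c) s s"
| exec_While_step: "holds w b s \<Longrightarrow> exec w B c s s' \<Longrightarrow> exec w B (While b c) s' s''
    \<Longrightarrow> exec w B (While b c) s s''"

fun wf_com :: "nat \<Rightarrow> 'r com \<Rightarrow> bool" where
  "wf_com k Skip = True"
| "wf_com k (Act f) = (\<forall>x r. (\<forall>r. x r < k) \<longrightarrow> fst (fst (snd (f x)) r) < k)"
| "wf_com k (c ;; d) = (wf_com k c \<and> wf_com k d)"
| "wf_com k (Cond b c d) = (wf_com k c \<and> wf_com k d)"
| "wf_com k (While b c) = wf_com k c"

section \<open>Compilation of commands into jump code\<close>

datatype 'r instr =
    Do "('r \<Rightarrow> nat) \<Rightarrow> move \<times> ('r \<Rightarrow> nat \<times> move) \<times> bool option"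
  | Branch "input_symbol \<Rightarrow> ('r \<Rightarrow> nat) \<Rightarrow> bool" nat nat

fun com_size :: "'r com \<Rightarrow> nat" where
  "com_size Skip = 0"
| "com_size (Act f) = 1"
| "com_size (c ;; d) = com_size c + com_size d"
| "com_size (Cond b c d) = com_size c + com_size d + 2"
| "com_size (While b c) = com_size c + 2"

text \<open>\<open>q\<close> is the absolute address of the first instruction, so jump targets are
  absolute as well. An unconditional jump is a \<open>Branch\<close> with two equal targets. Control
  always leaves a command at the address directly behind its code, which makes sequencing plain
  concatenation.\<close>

fun compile :: "'r com \<Rightarrow> nat \<Rightarrow> 'r instr list" where
  "compile Skip q = []"
| "compile (Act f) q = [Do f]"
| "compile (c ;; d) q = compile c q @ compile d (q + com_size c)"
| "compile (Cond b c d) q =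
     (let e = q + com_size c + com_size d + 2 in
      Branch b (q + 1) (q + com_size c + 2) # compile c (q + 1) @
      Branch b e e # compile d (q + com_size c + 2))"
| "compile (While b c) q =
     Branch b (q + 1) (q + com_size c + 2) # compile c (q + 1) @ [Branch b q q]"

lemma length_compile [simp]: "length (compile c q) = com_size c"
  by (induction c arbitrary: q) (auto simp: Let_def)

fun wf_instr :: "nat \<Rightarrow> nat \<Rightarrow> 'r instr \<Rightarrow> bool" where
  "wf_instr k e (Do f) = (\<forall>x r. (\<forall>r. x r < k) \<longrightarrow> fst (fst (snd (f x)) r) < k)"
| "wf_instr k e (Branch b i j) = (i \<le> e \<and> j \<le> e)"

lemma wf_instr_compile:
  "wf_com k c \<Longrightarrow> q + com_size c \<le> e \<Longrightarrow> i \<in> set (compile c q) \<Longrightarrow> wf_instr k e i"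
proof (induction c arbitrary: q)
  case (Seq c d)
  from Seq.IH(1)[of q] Seq.IH(2)[of "q + com_size c"] Seq.prems show ?case by auto
next
  case (Cond b c d)
  from Cond.IH(1)[of "q + 1"] Cond.IH(2)[of "q + com_size c + 2"] Cond.prems show ?case
    by (auto simp: Let_def)
next
  case (While b c)
  from While.IH[of "q + 1"] While.prems show ?case by auto
qed auto

definition lookup_tapes :: "'r list \<Rightarrow> nat list \<Rightarrow> 'r \<Rightarrow> nat" where
  "lookup_tapes rs xs = the \<circ> map_of (zip rs xs)"

definition instr_transition :: "'r list \<Rightarrow> 'r instr list \<Rightarrow> nat \<Rightarrow> input_symbol \<Rightarrow> nat list \<Rightarrow>
    (nat \<times> move \<times> (nat \<times> move) list \<times> bool option) option" where
  "instr_transition rs is q s xs =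
     (if q < length is then
        (case is ! q of
           Do f \<Rightarrow> (case f (lookup_tapes rs xs) of (d, \<alpha>, z) \<Rightarrow> Some (q + 1, d, map \<alpha> rs, z))
         | Branch b i j \<Rightarrow>
             Some (if b s (lookup_tapes rs xs) then i else j, Stay, map (\<lambda>x. (x, Stay)) xs, None))
      else None)"

text \<open>States are code addresses. The one additional state is the address behind the code,
  where no transition is defined; it is the halting state.\<close>

definition com_transducer :: "'r list \<Rightarrow> nat \<Rightarrow> 'r com \<Rightarrow> transducer" where
  "com_transducer rs k c =
     \<lparr>states = com_size c + 1, work_symbols = k, work_tapes = length rs,
      transition = instr_transition rs (compile c 0)\<rparr>"

lemma lookup_tapes_map: "set rs = UNIV \<Longrightarrow> lookup_tapes rs (map x rs) = x"
  by (auto simp: lookup_tapes_def fun_eq_iff map_of_zip_map)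

lemma lookup_tapes_less:
  assumes "set rs = UNIV" "length xs = length rs" "set xs \<subseteq> {..<k}"
  shows "lookup_tapes rs xs r < k"
proof -
  have "r \<in> set (map fst (zip rs xs))" using assms by simp
  then obtain v where v: "map_of (zip rs xs) r = Some v"
    by (metis weak_map_of_SomeI in_set_zipE fst_conv map_of_eq_None_iff option.exhaust set_map)
  then have "v \<in> set xs" by (meson map_of_SomeD set_zip_rightD)
  with v assms(3) show ?thesis by (auto simp: lookup_tapes_def)
qed

lemma wf_com_transducer:
  assumes "set rs = UNIV" "wf_com k c" "0 < k"
  shows "wf_transducer (com_transducer rs k c)"
proof -
  have "q' < com_size c + 1 \<and> length as = length rs \<and> fst ` set as \<subseteq> {..<k}"
    if xs: "length xs = length rs" "set xs \<subseteq> {..<k}"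
      and t: "instr_transition rs (compile c 0) q s xs = Some (q', d, as, z)" for q s xs q' d as z
  proof -
    have q: "q < com_size c" using t by (auto simp: instr_transition_def split: if_splits)
    then have wf: "wf_instr k (com_size c) (compile c 0 ! q)"
      using wf_instr_compile[OF assms(2), of 0 "com_size c"] by simp
    show ?thesis
    proof (cases "compile c 0 ! q")
      case (Do f)
      obtain d' \<alpha> z' where f: "f (lookup_tapes rs xs) = (d', \<alpha>, z')" by (metis prod_cases3)
      have "\<forall>r. fst (\<alpha> r) < k"
        using wf Do f lookup_tapes_less[OF assms(1) xs] by (metis wf_instr.simps(1) fst_conv snd_conv)
      with t q Do f show ?thesis by (auto simp: instr_transition_def) (metis fst_conv)
    next
      case (Branch b i j)
      with t q xs wf show ?thesis by (auto simp: instr_transition_def split: if_splits)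
    qed
  qed
  then show ?thesis using assms(3)
    unfolding wf_transducer_def com_transducer_def by simp
qed

fun store_config :: "'r list \<Rightarrow> nat \<Rightarrow> 'r store \<Rightarrow> config" where
  "store_config rs q (p, \<tau>, out) =
     \<lparr>state = q, input_head = p, tapes = map \<tau> rs, written = out\<rparr>"

lemma scan_tapes: "map (\<lambda>(t, p). t p) (map \<tau> rs) = map (scan \<tau>) rs"
  by (auto simp: scan_def case_prod_beta)

lemma map2_map_map: "map2 h (map f xs) (map g xs) = map (\<lambda>x. h (f x) (g x)) xs"
  by (induction xs) auto

lemma step_Do:
  assumes "set rs = UNIV" "q < com_size c" "compile c 0 ! q = Do f"
  shows "step (com_transducer rs k c) w (store_config rs q s) =
    Some (store_config rs (q + 1) (act_result w (f (scan (fst (snd s)))) s))"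
proof -
  obtain p \<tau> out where s: "s = (p, \<tau>, out)" by (metis prod_cases3)
  obtain d \<alpha> z where f: "f (scan \<tau>) = (d, \<alpha>, z)" by (metis prod_cases3)
  show ?thesis
    using assms s f unfolding step_def com_transducer_def
    by (simp add: scan_tapes lookup_tapes_map instr_transition_def map2_map_map del: map_map)
qed

lemma update_tape_Stay: "update_tape t (fst t (snd t), Stay) = t"
  by (cases t) simp

lemma step_Branch:
  assumes "set rs = UNIV" "q < com_size c" "compile c 0 ! q = Branch b i j" "fst s \<le> length w + 1"
  shows "step (com_transducer rs k c) w (store_config rs q s) =
    Some (store_config rs (if holds w b s then i else j) s)"
proof -
  obtain p \<tau> out where s: "s = (p, \<tau>, out)" by (metis prod_cases3)
  have "map2 update_tape (map \<tau> rs) (map (\<lambda>x. (x, Stay)) (map (scan \<tau>) rs)) = map \<tau> rs"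
    by (simp add: map2_map_map scan_def update_tape_Stay o_def)
  then show ?thesis
    using assms s unfolding step_def com_transducer_def
    by (simp add: scan_tapes lookup_tapes_map instr_transition_def del: map_map)
qed

section \<open>Simulation of commands by transducers within a space bound\<close>

definition bstep :: "transducer \<Rightarrow> bool list \<Rightarrow> nat \<Rightarrow> config \<Rightarrow> config \<Rightarrow> bool" where
  "bstep M w B c c' \<longleftrightarrow> step M w c = Some c' \<and> (\<forall>(t, p) \<in> set (tapes c'). p \<le> B)"

lemma store_config_bound: "heads_le B s \<Longrightarrow> \<forall>(t, p) \<in> set (tapes (store_config rs q s)). p \<le> B"
  by (cases s) (auto, metis snd_conv)

lemma act_result_head: "fst (act_result w x s) \<le> length w + 1"
  by (cases x; cases s) auto

definition code_at :: "'a list \<Rightarrow> nat \<Rightarrow> 'a list \<Rightarrow> bool" where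
  "code_at is q js \<longleftrightarrow> q + length js \<le> length is \<and> (\<forall>i < length js. is ! (q + i) = js ! i)"

lemma code_at_Cons: "code_at is q (j # js) \<longleftrightarrow> q < length is \<and> is ! q = j \<and> code_at is (q + 1) js"
  unfolding code_at_def by (auto simp: All_less_Suc2)

lemma code_at_append:
  "code_at is q (js @ ks) \<longleftrightarrow> code_at is q js \<and> code_at is (q + length js) ks"
proof (induction js arbitrary: q)
  case Nil
  show ?case by (auto simp: code_at_def)
next
  case (Cons j js)
  then show ?case by (simp add: code_at_Cons)
qed

text \<open>Induction on the derivation with the surrounding program \<open>c0\<close> fixed: a
  subcommand consults only its own segment of the code, so its address \<open>q\<close> may vary.
  The position of the input head is carried along because a branch leaves it unchanged only if
  clamping at the right end marker has no effect.\<close>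

lemma exec_compile:
  assumes "exec w B c s s'" "set rs = UNIV" "code_at (compile c0 0) q (compile c q)"
    "heads_le B s" "fst s \<le> length w + 1"
  shows "(bstep (com_transducer rs k c0) w B)\<^sup>*\<^sup>*
      (store_config rs q s) (store_config rs (q + com_size c) s')
    \<and> heads_le B s' \<and> fst s' \<le> length w + 1"
  using assms(1,3-)
proof (induction arbitrary: q rule: exec.induct)
  case (exec_Skip s)
  then show ?case by simp
next
  case (exec_Act s' f s)
  then show ?case
    using step_Do[OF assms(2), of q c0 f k w s] store_config_bound[of B s' rs "q + 1"]
      act_result_head[of w "f (scan (fst (snd s)))" s]
    by (auto simp: code_at_Cons bstep_def)
next
  case (exec_Seq c s s' d s'')
  from exec_Seq.prems(1) have 1: "code_at (compile c0 0) q (compile c q)"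
    and 2: "code_at (compile c0 0) (q + com_size c) (compile d (q + com_size c))"
    by (simp_all add: code_at_append)
  from exec_Seq.IH(1)[OF 1 exec_Seq.prems(2,3)] exec_Seq.IH(2)[OF 2]
  show ?case by (auto simp: add.assoc)
next
  case (exec_Cond b s c d s')
  let ?M = "com_transducer rs k c0"
  let ?e = "q + com_size c + com_size d + 2"
  from exec_Cond.prems(1) have lt: "q < com_size c0" "q + com_size c + 1 < com_size c0"
    and at: "compile c0 0 ! q = Branch b (q + 1) (q + com_size c + 2)"
      "compile c0 0 ! (q + com_size c + 1) = Branch b ?e ?e"
    and 1: "code_at (compile c0 0) (q + 1) (compile c (q + 1))"
    and 2: "code_at (compile c0 0) (q + com_size c + 2) (compile d (q + com_size c + 2))"
    by (simp_all add: code_at_append code_at_Cons Let_def)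
  note first = step_Branch[OF assms(2) lt(1) at(1) exec_Cond.prems(3), of k]
  show ?case
  proof (cases "holds w b s")
    case True
    from True first have s1: "bstep ?M w B (store_config rs q s) (store_config rs (q + 1) s)"
      using store_config_bound[OF exec_Cond.prems(2)] by (simp add: bstep_def)
    from True 1 exec_Cond.IH[of "q + 1"] exec_Cond.prems
    have r: "(bstep ?M w B)\<^sup>*\<^sup>* (store_config rs (q + 1) s) (store_config rs (q + 1 + com_size c) s')"
      and ok: "heads_le B s'" "fst s' \<le> length w + 1" by auto
    have s2: "bstep ?M w B (store_config rs (q + com_size c + 1) s') (store_config rs ?e s')"
      using step_Branch[OF assms(2) lt(2) at(2) ok(2), of k] store_config_bound[OF ok(1)]
      by (simp add: bstep_def)
    from s1 r s2 have "(bstep ?M w B)\<^sup>*\<^sup>* (store_config rs q s) (store_config rs ?e s')"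
      by (simp add: add.commute add.left_commute converse_rtranclp_into_rtranclp rtranclp.rtrancl_into_rtrancl)
    with ok show ?thesis by (simp add: add.commute add.left_commute)
  next
    case False
    from False first have s1: "bstep ?M w B (store_config rs q s) (store_config rs (q + com_size c + 2) s)"
      using store_config_bound[OF exec_Cond.prems(2)] by (simp add: bstep_def)
    from False 2 exec_Cond.IH[of "q + com_size c + 2"] exec_Cond.prems
    have r: "(bstep ?M w B)\<^sup>*\<^sup>* (store_config rs (q + com_size c + 2) s)
        (store_config rs (q + com_size c + 2 + com_size d) s')"
      and ok: "heads_le B s'" "fst s' \<le> length w + 1" by auto
    from s1 r have "(bstep ?M w B)\<^sup>*\<^sup>* (store_config rs q s) (store_config rs ?e s')"
      by (simp add: add.commute add.left_commute converse_rtranclp_into_rtranclp)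
    with ok show ?thesis by (simp add: add.commute add.left_commute)
  qed
next
  case (exec_While_stop b s c)
  let ?M = "com_transducer rs k c0"
  from exec_While_stop.prems(1) have lt: "q < com_size c0"
    and at: "compile c0 0 ! q = Branch b (q + 1) (q + com_size c + 2)"
    by (simp_all add: code_at_append code_at_Cons)
  have "bstep ?M w B (store_config rs q s) (store_config rs (q + com_size c + 2) s)"
    using step_Branch[OF assms(2) lt at exec_While_stop.prems(3), of k]
      store_config_bound[OF exec_While_stop.prems(2)] exec_While_stop.hyps
    by (simp add: bstep_def)
  then show ?case using exec_While_stop.prems by (simp add: add.commute add.left_commute)
next
  case (exec_While_step b s c s' s'')
  let ?M = "com_transducer rs k c0"
  from exec_While_step.prems(1) have lt: "q < com_size c0" "q + com_size c + 1 < com_size c0"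
    and at: "compile c0 0 ! q = Branch b (q + 1) (q + com_size c + 2)"
      "compile c0 0 ! (q + com_size c + 1) = Branch b q q"
    and 1: "code_at (compile c0 0) (q + 1) (compile c (q + 1))"
    by (simp_all add: code_at_append code_at_Cons)
  have s1: "bstep ?M w B (store_config rs q s) (store_config rs (q + 1) s)"
    using step_Branch[OF assms(2) lt(1) at(1) exec_While_step.prems(3), of k]
      store_config_bound[OF exec_While_step.prems(2)] exec_While_step.hyps
    by (simp add: bstep_def)
  from exec_While_step.IH(1)[OF 1 exec_While_step.prems(2,3)]
  have r: "(bstep ?M w B)\<^sup>*\<^sup>* (store_config rs (q + 1) s) (store_config rs (q + 1 + com_size c) s')"
    and ok: "heads_le B s'" "fst s' \<le> length w + 1" by auto
  have s2: "bstep ?M w B (store_config rs (q + com_size c + 1) s') (store_config rs q s')"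
    using step_Branch[OF assms(2) lt(2) at(2) ok(2), of k] store_config_bound[OF ok(1)]
    by (simp add: bstep_def)
  from s1 r s2 have "(bstep ?M w B)\<^sup>*\<^sup>* (store_config rs q s) (store_config rs q s')"
    by (simp add: add.commute add.left_commute converse_rtranclp_into_rtranclp rtranclp.rtrancl_into_rtrancl)
  with exec_While_step.IH(2)[OF exec_While_step.prems(1) ok] show ?case by auto
qed

text \<open>In a deterministic system a halting run passes through everything reachable from its
  start. An invariant of this single run therefore holds at all reachable configurations, which is
  how one derivation bounds the space of the machine on a given word.\<close>

lemma deterministic_path:
  assumes "R\<^sup>*\<^sup>* x z" "\<And>x y. R x y \<Longrightarrow> f x = Some y \<and> P y" "f z = None" "P x"
    "(\<lambda>x y. f x = Some y)\<^sup>*\<^sup>* x y"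
  shows "P y"
  using assms(1,4,5)
proof (induction rule: converse_rtranclp_induct)
  case base
  from base(2) assms(3) have "y = z" by (auto elim: converse_rtranclpE)
  with base show ?case by simp
next
  case (step x x')
  from step.hyps(1) assms(2) have x': "f x = Some x'" "P x'" by auto
  from step.prems(2) show ?case
  proof (cases rule: converse_rtranclpE)
    case base
    with step.prems show ?thesis by simp
  next
    case (step y')
    with x' have "(\<lambda>x y. f x = Some y)\<^sup>*\<^sup>* x' y" by simp
    with \<open>\<lbrakk>P x'; (\<lambda>x y. f x = Some y)\<^sup>*\<^sup>* x' y\<rbrakk> \<Longrightarrow> P y\<close> x' show ?thesis by simp
  qed
qed

text \<open>The interface between commands and machines: from here on only derivations of
  \<open>exec\<close> with a logarithmic \<open>B\<close> have to be supplied, and states and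
  transitions no longer occur.\<close>

lemma logspace_computable_com:
  fixes c :: "'r com" and B :: "bool list \<Rightarrow> nat" and C :: real
  assumes rs: "set rs = (UNIV :: 'r set)" and wf: "wf_com k c" "0 < k"
    and run: "\<And>w. \<exists>p \<tau>. exec w (B w) c (0, \<lambda>_. (\<lambda>_. 0, 0), []) (p, \<tau>, f w)"
    and B: "\<And>w. real (B w) \<le> C * log 2 (real (length w + 2))"
  shows "logspace_computable f"
proof -
  let ?M = "com_transducer rs k c"
  have main: "\<exists>c1. (bstep ?M w (B w))\<^sup>*\<^sup>* (init_config ?M) c1 \<and> step ?M w c1 = None \<and> written c1 = f w" for w
  proof -
    obtain p \<tau> where e: "exec w (B w) c (0, \<lambda>_. (\<lambda>_. 0, 0), []) (p, \<tau>, f w)" using run by blast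
    have "(bstep ?M w (B w))\<^sup>*\<^sup>* (store_config rs 0 (0, \<lambda>_. (\<lambda>_. 0, 0), []))
       (store_config rs (com_size c) (p, \<tau>, f w))"
      using exec_compile[OF e rs, of c 0 k] by (auto simp: code_at_def)
    moreover have "store_config rs 0 (0, \<lambda>_. (\<lambda>_. 0, 0), []) = init_config ?M"
      by (simp add: init_config_def com_transducer_def map_replicate_const)
    moreover have "step ?M w (store_config rs (com_size c) (p, \<tau>, f w)) = None"
      by (simp add: step_def com_transducer_def instr_transition_def)
    ultimately show ?thesis by fastforce
  qed
  have "transducer_computes ?M f"
    unfolding transducer_computes_def
  proof
    fix w
    obtain c1 where c1: "(bstep ?M w (B w))\<^sup>*\<^sup>* (init_config ?M) c1" "step ?M w c1 = None" "written c1 = f w"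
      using main by blast
    have "reachable ?M w c1"
      unfolding reachable_def by (rule mono_rtranclp[rule_format, OF _ c1(1)]) (simp add: bstep_def)
    with c1 show "\<exists>c. reachable ?M w c \<and> step ?M w c = None \<and> written c = f w" by blast
  qed
  moreover have "runs_in_logspace ?M"
    unfolding runs_in_logspace_def
  proof (intro exI[of _ C] allI impI)
    fix w c2 assume r: "reachable ?M w c2"
    obtain c1 where c1: "(bstep ?M w (B w))\<^sup>*\<^sup>* (init_config ?M) c1" "step ?M w c1 = None"
      using main by blast
    have "\<forall>(t, p) \<in> set (tapes c2). p \<le> B w"
      by (rule deterministic_path[OF c1(1) _ c1(2) _ r[unfolded reachable_def]])
        (auto simp: bstep_def init_config_def)
    then show "\<forall>(t, p) \<in> set (tapes c2). real p \<le> C * log 2 (real (length w + 2))"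
      using B[of w] by (fastforce intro: order_trans)
  qed
  ultimately show ?thesis
    using wf_com_transducer[OF rs wf] unfolding logspace_computable_def by blast
qed

section \<open>Registers in binary on the work tapes\<close>

text \<open>
  A number is stored little-endian in canonical binary: symbol 3 marks cell 0, symbols 1 and 2 are
  the digits 0 and 1, and 0 is blank.  Between commands every head rests on cell 1.
\<close>

fun bits :: "nat \<Rightarrow> nat list" where
  "bits n = (if n = 0 then [] else (n mod 2 + 1) # bits (n div 2))"

declare bits.simps [simp del]

fun bits_inc :: "nat list \<Rightarrow> nat list" where
  "bits_inc [] = [2]"
| "bits_inc (x # xs) = (if x = 2 then 1 # bits_inc xs else 2 # xs)"

lemma bits_0 [simp]: "bits 0 = []"
  by (simp add: bits.simps)

lemma bits_pos: "0 < n \<Longrightarrow> bits n = (n mod 2 + 1) # bits (n div 2)"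
  by (simp add: bits.simps)

lemma bits_Suc: "bits (Suc n) = bits_inc (bits n)"
proof (induction n rule: less_induct)
  case (less n)
  consider "n = 0" | "n > 0" "even n" | "odd n" by auto
  then show ?case
  proof cases
    case 1
    then show ?thesis by (simp add: bits.simps)
  next
    case 2
    then show ?thesis by (subst (1 2) bits.simps) (auto simp: mod2_eq_if)
  next
    case 3
    then have "bits (Suc (n div 2)) = bits_inc (bits (n div 2))" by (intro less) (auto elim: oddE)
    moreover have "Suc n div 2 = Suc (n div 2)" using 3 by (auto elim: oddE)
    ultimately show ?thesis using 3 by (subst (1 2) bits.simps) (auto simp: mod2_eq_if odd_pos)
  qed
qed

lemma set_bits: "set (bits n) \<subseteq> {1, 2}"
proof (induction n rule: less_induct)
  case (less n)
  show ?case
  proof (cases "n = 0")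
    case False
    with less[of "n div 2"] show ?thesis by (subst bits.simps) auto
  qed simp
qed

text \<open>Since there are no leading zeros, equal tape contents and equal numbers are the same
  thing; this is what makes a cell by cell comparison of registers correct.\<close>

lemma bits_inject: "bits m = bits n \<longleftrightarrow> m = n"
proof
  show "bits m = bits n \<Longrightarrow> m = n"
  proof (induction m arbitrary: n rule: less_induct)
    case (less m)
    show ?case
    proof (cases "m = 0 \<or> n = 0")
      case True
      then show ?thesis using less.prems by (cases "m = 0"; cases "n = 0") (simp_all add: bits_pos)
    next
      case False
      with less.prems have "m mod 2 = n mod 2" "bits (m div 2) = bits (n div 2)"
        by (simp_all add: bits_pos)
      moreover have "m div 2 < m" using False by simp
      ultimately have "m div 2 = n div 2" "m mod 2 = n mod 2" using less.IH by blast+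
      then show ?thesis by (metis div_mult_mod_eq)
    qed
  qed
qed simp

lemma length_bits: "n > 0 \<Longrightarrow> 2 ^ length (bits n) \<le> 2 * n"
proof (induction n rule: less_induct)
  case (less n)
  show ?case
  proof (cases "n = 1")
    case True
    then show ?thesis by (simp add: bits.simps)
  next
    case False
    with less.prems have "2 ^ length (bits (n div 2)) \<le> 2 * (n div 2)" by (intro less.IH) auto
    with less.prems show ?thesis by (subst bits.simps) auto
  qed
qed

definition cells :: "nat list \<Rightarrow> nat \<Rightarrow> nat" where
  "cells xs i = (if i = 0 then 3 else if i \<le> length xs then xs ! (i - 1) else 0)"

lemma cells_0 [simp]: "cells xs 0 = 3"
  by (simp add: cells_def)

lemma cells_middle [simp]: "cells (ys @ x # xs) (Suc (length ys)) = x"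
  by (simp add: cells_def)

lemma cells_end [simp]: "cells xs (Suc (length xs)) = 0"
  by (simp add: cells_def)

lemma cells_nth: "i < length xs \<Longrightarrow> cells xs (Suc i) = xs ! i"
  by (simp add: cells_def)

lemma cells_beyond: "length xs \<le> i \<Longrightarrow> cells xs (Suc i) = 0"
  by (simp add: cells_def)

lemma cells_update: "(cells (ys @ x # xs))(Suc (length ys) := z) = cells (ys @ z # xs)"
  by (auto simp: cells_def fun_eq_iff nth_append nth_Cons split: nat.splits)

lemma cells_extend: "(cells xs)(Suc (length xs) := z) = cells (xs @ [z])"
  by (auto simp: cells_def fun_eq_iff nth_append)

lemma cells_truncate: "(cells (take (Suc k) xs))(Suc k := 0) = cells (take k xs)"
  by (auto simp: cells_def fun_eq_iff)

lemma nth_bits: "i < length (bits n) \<Longrightarrow> bits n ! i = 1 \<or> bits n ! i = 2"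
  using set_bits[of n] nth_mem[of i "bits n"] by blast

lemma cells_bits_less:
  assumes "0 < i"
  shows "cells (bits n) i < 3"
proof (cases "i \<le> length (bits n)")
  case True
  with assms have "i - 1 < length (bits n)" by simp
  from nth_bits[OF this] True assms show ?thesis by (auto simp: cells_def)
qed (simp add: cells_def)

section \<open>Commands on registers\<close>

definition on_tapes :: "'r set \<Rightarrow> (nat \<Rightarrow> nat \<times> move) \<Rightarrow> 'r com" where
  "on_tapes S h = Act (\<lambda>x. (Stay, \<lambda>r. if r \<in> S then h (x r) else (x r, Stay), None))"

definition move_input :: "move \<Rightarrow> 'r com" where
  "move_input d = Act (\<lambda>x. (d, \<lambda>r. (x r, Stay), None))"

definition emit_bit :: "bool \<Rightarrow> 'r com" where
  "emit_bit b = Act (\<lambda>x. (Stay, \<lambda>r. (x r, Stay), Some b))"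

text \<open>All heads of \<open>S\<close> are meant to stand at the same position, so it suffices to
  watch tape \<open>r\<close>: the markers in cell 0 are reached simultaneously. The last move
  restores the resting position.\<close>

definition return_heads :: "'r set \<Rightarrow> 'r \<Rightarrow> 'r com" where
  "return_heads S r =
     While (\<lambda>_ x. x r \<noteq> 3) (on_tapes S (\<lambda>x. (x, Move_Left))) ;; on_tapes S (\<lambda>x. (x, Move_Right))"

text \<open>The loop turns the low-order digits 1 (symbol 2) into digits 0 (symbol 1). The write of
  symbol 2 behind it serves both ways of stopping: it replaces a digit 0, or it adds a new leading
  digit on a blank cell.\<close>

definition increment :: "'r \<Rightarrow> 'r com" where
  "increment r =
     (While (\<lambda>_ x. x r = 2) (on_tapes {r} (\<lambda>_. (1, Move_Right))) ;;
      on_tapes {r} (\<lambda>_. (2, Stay))) ;; return_heads {r} r"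

text \<open>The digits are blanked and not set to the digit 0, because the canonical form of 0 is
  the empty list.\<close>

definition reset :: "'r \<Rightarrow> 'r com" where
  "reset r =
     While (\<lambda>_ x. x r \<noteq> 0) (on_tapes {r} (\<lambda>x. (x, Move_Right))) ;;
     While (\<lambda>_ x. x r \<noteq> 3) (on_tapes {r} (\<lambda>_. (0, Move_Left))) ;;
     on_tapes {r} (\<lambda>x. (x, Move_Right))"

definition walk :: "'r \<Rightarrow> 'r \<Rightarrow> 'r com" where
  "walk r s = While (\<lambda>_ x. x r = x s \<and> x r \<noteq> 0) (on_tapes {r, s} (\<lambda>x. (x, Move_Right)))"

definition if_eq :: "'r \<Rightarrow> 'r \<Rightarrow> 'r com \<Rightarrow> 'r com \<Rightarrow> 'r com" where
  "if_eq r s c d =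
     walk r s ;; Cond (\<lambda>_ x. x r = x s) (return_heads {r, s} r ;; c) (return_heads {r, s} r ;; d)"

text \<open>A loop condition sees only the scanned symbols, so the comparing walk must be finished
  before each test: once ahead of the loop and again at the end of the body. The test is made with
  the heads still displaced, and the body starts by bringing them back.\<close>

definition while_neq :: "'r \<Rightarrow> 'r \<Rightarrow> 'r com \<Rightarrow> 'r com" where
  "while_neq r s c =
     walk r s ;; (While (\<lambda>_ x. x r \<noteq> x s) ((return_heads {r, s} r ;; c) ;; walk r s) ;;
     return_heads {r, s} r)"

definition while_input :: "(input_symbol \<Rightarrow> bool) \<Rightarrow> 'r com \<Rightarrow> 'r com" where
  "while_input f c = While (\<lambda>s _. f s) c"

definition init_tapes :: "'r com" where
  "init_tapes = Act (\<lambda>x. (Stay, \<lambda>r. (3, Move_Right), None))"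

lemma wf_com_registers [simp]:
  "wf_com 4 (on_tapes S h) \<longleftrightarrow> (\<forall>x<4. S = {} \<or> fst (h x) < 4)"
  "wf_com 4 (move_input d)"
  "wf_com 4 (emit_bit b)"
  "wf_com 4 init_tapes"
proof -
  show "wf_com 4 (on_tapes S h) \<longleftrightarrow> (\<forall>x<4. S = {} \<or> fst (h x) < 4)"
  proof
    assume wf: "wf_com 4 (on_tapes S h)"
    have "fst (h x) < 4" if "x < 4" "q \<in> S" for x q
      using wf[unfolded on_tapes_def wf_com.simps, rule_format, of "\<lambda>_. x" q] that by simp
    then show "\<forall>x<4. S = {} \<or> fst (h x) < 4" by blast
  qed (auto simp: on_tapes_def)
qed (auto simp: move_input_def emit_bit_def init_tapes_def)

lemma wf_com_register_commands [simp]: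
  "wf_com 4 (return_heads S r)"
  "wf_com 4 (increment r)"
  "wf_com 4 (reset r)"
  "wf_com 4 (walk r s)"
  "wf_com 4 (if_eq r s c d) \<longleftrightarrow> wf_com 4 c \<and> wf_com 4 d"
  "wf_com 4 (while_neq r s c) \<longleftrightarrow> wf_com 4 c"
  "wf_com 4 (while_input f c) \<longleftrightarrow> wf_com 4 c"
  by (auto simp: return_heads_def increment_def reset_def walk_def if_eq_def while_neq_def while_input_def)

section \<open>Execution of register commands\<close>

definition heads_at :: "('r \<Rightarrow> nat) \<Rightarrow> 'r set \<Rightarrow> nat \<Rightarrow> 'r \<Rightarrow> (nat \<Rightarrow> nat) \<times> nat" where
  "heads_at \<rho> S k = (\<lambda>q. (cells (bits (\<rho> q)), if q \<in> S then k else 1))"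

abbreviation reg_tapes :: "('r \<Rightarrow> nat) \<Rightarrow> 'r \<Rightarrow> (nat \<Rightarrow> nat) \<times> nat" where
  "reg_tapes \<rho> \<equiv> heads_at \<rho> {} 1"

lemma heads_at_1: "heads_at \<rho> S 1 = reg_tapes \<rho>"
  by (auto simp: heads_at_def)

inductive_cases exec_SeqE: "exec w B (c ;; d) s s''"

text \<open>\<open>V\<close> bounds the numbers in the registers and \<open>B\<close> the head
  positions. The inequality is strict because the digits occupy the cells 1 to
  \<open>length (bits v)\<close> and the heads also visit the first blank cell behind them.\<close>

locale register_machine =
  fixes w :: "bool list" and B V :: nat
  assumes length_bits_less: "v \<le> V \<Longrightarrow> length (bits v) < B"
begin

lemma B_pos: "0 < B"
  using length_bits_less[of 0] by simp

lemma exec_on_tapes: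
  assumes "p \<le> length w + 1"
    and "\<tau>' = (\<lambda>r. if r \<in> S then update_tape (\<tau> r) (h (fst (\<tau> r) (snd (\<tau> r)))) else \<tau> r)"
    and "\<And>r. snd (\<tau>' r) \<le> B"
  shows "exec w B (on_tapes S h) (p, \<tau>, out) (p, \<tau>', out)"
  unfolding on_tapes_def
proof (rule exec_Act)
  have "\<tau>' = (\<lambda>r. update_tape (\<tau> r) (if r \<in> S then h (scan \<tau> r) else (scan \<tau> r, Stay)))"
    by (simp add: assms(2) scan_def update_tape_Stay fun_eq_iff)
  then show "(p, \<tau>', out) = act_result w (Stay, \<lambda>r. if r \<in> S then h (scan (fst (snd (p, \<tau>, out))) r)
      else (scan (fst (snd (p, \<tau>, out))) r, Stay), None) (p, \<tau>, out)"
    unfolding fst_conv snd_conv using assms(1) by simp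
  show "heads_le B (p, \<tau>', out)" using assms(3) by simp
qed

lemma exec_return_heads:
  assumes "p \<le> length w + 1" "r \<in> S" "k \<le> B"
  shows "exec w B (return_heads S r) (p, heads_at \<rho> S k, out) (p, reg_tapes \<rho>, out)"
proof -
  have "exec w B (While (\<lambda>_ x. x r \<noteq> 3) (on_tapes S (\<lambda>x. (x, Move_Left))))
      (p, heads_at \<rho> S k, out) (p, heads_at \<rho> S 0, out)"
    using assms(3)
  proof (induction k)
    case 0
    show ?case by (rule exec_While_stop) (simp add: heads_at_def scan_def assms(2))
  next
    case (Suc k)
    have "exec w B (on_tapes S (\<lambda>x. (x, Move_Left)))
        (p, heads_at \<rho> S (Suc k), out) (p, heads_at \<rho> S k, out)"
      using Suc.prems B_pos assms(1) by (intro exec_on_tapes) (auto simp: heads_at_def fun_eq_iff)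
    moreover have "holds w (\<lambda>_ x. x r \<noteq> 3) (p, heads_at \<rho> S (Suc k), out)"
      using cells_bits_less[of "Suc k" "\<rho> r"] assms(2) by (auto simp: heads_at_def scan_def)
    ultimately show ?case using Suc by (auto intro: exec_While_step)
  qed
  moreover have "exec w B (on_tapes S (\<lambda>x. (x, Move_Right)))
      (p, heads_at \<rho> S 0, out) (p, reg_tapes \<rho>, out)"
    using B_pos assms(1) by (intro exec_on_tapes) (auto simp: heads_at_def fun_eq_iff)
  ultimately show ?thesis unfolding return_heads_def by (rule exec_Seq)
qed

lemma exec_on_tape:
  assumes "p \<le> length w + 1" "\<forall>q. snd (\<tau> q) \<le> B"
    and h: "h (t i) = (z, d)" and "t(i := z) = t'" "move_head d i = j" "j \<le> B"
  shows "exec w B (on_tapes {r} h) (p, \<tau>(r := (t, i)), out) (p, \<tau>(r := (t', j)), out)"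
proof (rule exec_on_tapes)
  show "\<tau>(r := (t', j)) =
      (\<lambda>q. if q \<in> {r} then update_tape ((\<tau>(r := (t, i))) q) (h (fst ((\<tau>(r := (t, i))) q) (snd ((\<tau>(r := (t, i))) q))))
        else (\<tau>(r := (t, i))) q)"
    by (rule ext) (use assms in simp)
qed (use assms in auto)

text \<open>\<open>ys\<close> collects the digits that the carry has already passed; the head stands
  directly behind them. The final position \<open>k\<close> is left open, since the head is returned
  afterwards in any case.\<close>

lemma exec_carry:
  fixes \<tau> :: "'r \<Rightarrow> (nat \<Rightarrow> nat) \<times> nat"
  assumes p: "p \<le> length w + 1" and heads: "\<forall>q. snd (\<tau> q) \<le> B"
    and len: "length (ys @ bits_inc xs) \<le> B"
  shows "\<exists>k \<le> B. exec w B
     (While (\<lambda>_ x. x r = 2) (on_tapes {r} (\<lambda>_. (1, Move_Right))) ;; on_tapes {r} (\<lambda>_. (2, Stay)))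
     (p, \<tau>(r := (cells (ys @ xs), Suc (length ys))), out)
     (p, \<tau>(r := (cells (ys @ bits_inc xs), k)), out)"
  using len
proof (induction xs arbitrary: ys)
  let ?W = "While (\<lambda>_ x. x r = 2) (on_tapes {r} (\<lambda>_. (1, Move_Right)))"
  have stop: "exec w B (?W ;; on_tapes {r} (\<lambda>_. (2, Stay))) (p, \<tau>(r := (cells zs, Suc (length ys))), out)
      (p, \<tau>(r := (cells zs', Suc (length ys))), out)"
    if "(cells zs)(Suc (length ys) := 2) = cells zs'" "Suc (length ys) \<le> B"
      "cells zs (Suc (length ys)) \<noteq> 2" for ys zs zs'
  proof (rule exec_Seq)
    show "exec w B ?W (p, \<tau>(r := (cells zs, Suc (length ys))), out) (p, \<tau>(r := (cells zs, Suc (length ys))), out)"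
      by (rule exec_While_stop) (use that(3) in \<open>simp add: scan_def\<close>)
    show "exec w B (on_tapes {r} (\<lambda>_. (2, Stay))) (p, \<tau>(r := (cells zs, Suc (length ys))), out)
      (p, \<tau>(r := (cells zs', Suc (length ys))), out)"
      by (rule exec_on_tape[OF p heads _ that(1), where d = Stay]) (use that(2) in simp_all)
  qed
  {
    case Nil
    have "exec w B (?W ;; on_tapes {r} (\<lambda>_. (2, Stay))) (p, \<tau>(r := (cells ys, Suc (length ys))), out)
      (p, \<tau>(r := (cells (ys @ [2]), Suc (length ys))), out)"
      by (rule stop) (use Nil in \<open>simp_all add: cells_extend\<close>)
    moreover have "Suc (length ys) \<le> B" using Nil by simp
    ultimately show ?case unfolding bits_inc.simps append_Nil2 by blast
  next
    case (Cons x xs)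
    show ?case
    proof (cases "x = 2")
      case True
      have eq: "(ys @ [1]) @ bits_inc xs = ys @ bits_inc (x # xs)" using True by simp
      then have "length ((ys @ [1]) @ bits_inc xs) \<le> B" using Cons.prems by simp
      from Cons.IH[OF this] obtain k where k: "k \<le> B"
        "exec w B (?W ;; on_tapes {r} (\<lambda>_. (2, Stay)))
         (p, \<tau>(r := (cells ((ys @ [1]) @ xs), Suc (length (ys @ [1])))), out)
         (p, \<tau>(r := (cells (ys @ bits_inc (x # xs)), k)), out)" unfolding eq by blast
      from k(2) obtain s where
        s: "exec w B ?W (p, \<tau>(r := (cells ((ys @ [1]) @ xs), Suc (length (ys @ [1])))), out) s"
        and s': "exec w B (on_tapes {r} (\<lambda>_. (2, Stay))) s
          (p, \<tau>(r := (cells (ys @ bits_inc (x # xs)), k)), out)"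
        by (rule exec_SeqE)
      \<comment> \<open>The carry still produces at least one digit, so the cell to which the head
        moves next lies within the bound.\<close>
      have "0 < length (bits_inc xs)" by (cases xs) auto
      moreover have "length ys + 1 + length (bits_inc xs) \<le> B" using Cons.prems True by simp
      ultimately have "Suc (Suc (length ys)) \<le> B" by linarith
      then have move: "exec w B (on_tapes {r} (\<lambda>_. (1, Move_Right)))
          (p, \<tau>(r := (cells (ys @ x # xs), Suc (length ys))), out)
          (p, \<tau>(r := (cells ((ys @ [1]) @ xs), Suc (length (ys @ [1])))), out)"
        by (intro exec_on_tape[OF p heads, where z = 1 and d = Move_Right]) (simp_all add: cells_update)
      have "exec w B ?W (p, \<tau>(r := (cells (ys @ x # xs), Suc (length ys))), out) s"
        by (rule exec_While_step[OF _ move s]) (simp add: scan_def True)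
      from exec_Seq[OF this s'] k(1) show ?thesis by blast
    next
      case False
      then have inc: "bits_inc (x # xs) = 2 # xs" by simp
      have len: "Suc (length ys) \<le> B" using Cons.prems unfolding inc by simp
      have "exec w B (?W ;; on_tapes {r} (\<lambda>_. (2, Stay))) (p, \<tau>(r := (cells (ys @ x # xs), Suc (length ys))), out)
        (p, \<tau>(r := (cells (ys @ 2 # xs), Suc (length ys))), out)"
        by (rule stop[OF cells_update len]) (use False in simp)
      with len show ?thesis unfolding inc by blast
    qed
  }
qed

lemma exec_increment:
  assumes "p \<le> length w + 1" "\<rho> r < V"
  shows "exec w B (increment r) (p, reg_tapes \<rho>, out) (p, reg_tapes (\<rho>(r := Suc (\<rho> r))), out)"
proof -
  have "length ([] @ bits_inc (bits (\<rho> r))) \<le> B"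
    using length_bits_less[of "Suc (\<rho> r)"] assms(2) by (simp add: bits_Suc)
  moreover have "\<forall>q. snd (reg_tapes \<rho> q) \<le> B" using B_pos by (simp add: heads_at_def)
  moreover have start: "(reg_tapes \<rho>)(r := (cells ([] @ bits (\<rho> r)), Suc (length ([] :: nat list)))) = reg_tapes \<rho>"
    by (rule ext) (simp add: heads_at_def)
  moreover have stop: "(reg_tapes \<rho>)(r := (cells ([] @ bits_inc (bits (\<rho> r))), k)) =
      heads_at (\<rho>(r := Suc (\<rho> r))) {r} k" for k
    by (rule ext) (simp add: heads_at_def bits_Suc)
  ultimately obtain k where k: "k \<le> B" "exec w B
     (While (\<lambda>_ x. x r = 2) (on_tapes {r} (\<lambda>_. (1, Move_Right))) ;; on_tapes {r} (\<lambda>_. (2, Stay)))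
     (p, reg_tapes \<rho>, out) (p, heads_at (\<rho>(r := Suc (\<rho> r))) {r} k, out)"
    using exec_carry[OF assms(1), of "reg_tapes \<rho>" "[]" "bits (\<rho> r)" r out]
    unfolding start stop by blast
  have "exec w B (return_heads {r} r) (p, heads_at (\<rho>(r := Suc (\<rho> r))) {r} k, out)
      (p, reg_tapes (\<rho>(r := Suc (\<rho> r))), out)"
    by (rule exec_return_heads) (use k assms in auto)
  with k(2) show ?thesis unfolding increment_def by (rule exec_Seq)
qed

lemma exec_reset:
  assumes "p \<le> length w + 1" "\<rho> r \<le> V"
  shows "exec w B (reset r) (p, reg_tapes \<rho>, out) (p, reg_tapes (\<rho>(r := 0)), out)"
proof -
  let ?xs = "bits (\<rho> r)"
  let ?\<tau> = "\<lambda>k j. (reg_tapes \<rho>)(r := (cells (take k ?xs), j))"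
  have len: "Suc (length ?xs) \<le> B" using length_bits_less[OF assms(2)] by simp
  have heads: "\<forall>q. snd (reg_tapes \<rho> q) \<le> B" using B_pos by (simp add: heads_at_def)
  have right: "exec w B (While (\<lambda>_ x. x r \<noteq> 0) (on_tapes {r} (\<lambda>x. (x, Move_Right))))
      (p, heads_at \<rho> {r} (Suc (length ?xs - j)), out) (p, heads_at \<rho> {r} (Suc (length ?xs)), out)"
    if "j \<le> length ?xs" for j
    using that
  proof (induction j)
    case 0
    show ?case unfolding diff_zero by (rule exec_While_stop) (simp add: heads_at_def scan_def)
  next
    case (Suc j)
    have "?xs ! (length ?xs - Suc j) = 1 \<or> ?xs ! (length ?xs - Suc j) = 2"
      using nth_bits[of "length ?xs - Suc j" "\<rho> r"] Suc.prems by simp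
    then have "holds w (\<lambda>_ x. x r \<noteq> 0) (p, heads_at \<rho> {r} (Suc (length ?xs - Suc j)), out)"
      using Suc.prems by (auto simp: heads_at_def scan_def cells_def)
    moreover have "exec w B (on_tapes {r} (\<lambda>x. (x, Move_Right)))
        (p, heads_at \<rho> {r} (Suc (length ?xs - Suc j)), out) (p, heads_at \<rho> {r} (Suc (length ?xs - j)), out)"
      using Suc.prems len B_pos assms(1) by (intro exec_on_tapes) (auto simp: heads_at_def fun_eq_iff)
    ultimately show ?case using Suc by (auto intro: exec_While_step)
  qed
  \<comment> \<open>With the head at \<open>k\<close>, everything to its right is blank and the tape
    holds the first \<open>k\<close> digits. The descent starts on the blank cell behind the last
    digit, where \<open>take\<close> still gives the full list.\<close>
  have left: "exec w B (While (\<lambda>_ x. x r \<noteq> 3) (on_tapes {r} (\<lambda>_. (0, Move_Left))))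
      (p, ?\<tau> k k, out) (p, ?\<tau> 0 0, out)"
    if "k \<le> Suc (length ?xs)" for k
    using that
  proof (induction k)
    case 0
    show ?case by (rule exec_While_stop) (simp add: scan_def)
  next
    case (Suc k)
    have "cells (take (Suc k) ?xs) (Suc k) \<noteq> 3"
      using cells_bits_less[of "Suc k" "\<rho> r"] by (auto simp: cells_def split: if_splits)
    then have test: "holds w (\<lambda>_ x. x r \<noteq> 3) (p, ?\<tau> (Suc k) (Suc k), out)" by (simp add: scan_def)
    have body: "exec w B (on_tapes {r} (\<lambda>_. (0, Move_Left))) (p, ?\<tau> (Suc k) (Suc k), out) (p, ?\<tau> k k, out)"
      using Suc.prems len heads assms(1)
      by (intro exec_on_tape[OF _ _ _ cells_truncate, where d = Move_Left]) simp_all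
    have "k \<le> Suc (length ?xs)" using Suc.prems by simp
    then show ?case by (rule exec_While_step[OF test body Suc.IH])
  qed
  have final: "exec w B (on_tapes {r} (\<lambda>x. (x, Move_Right))) (p, ?\<tau> 0 0, out)
      (p, reg_tapes (\<rho>(r := 0)), out)"
    using B_pos assms(1) by (intro exec_on_tapes) (auto simp: heads_at_def fun_eq_iff)
  have start: "heads_at \<rho> {r} (Suc (length ?xs - length ?xs)) = reg_tapes \<rho>"
    and mid: "heads_at \<rho> {r} (Suc (length ?xs)) = ?\<tau> (Suc (length ?xs)) (Suc (length ?xs))"
    by (auto simp: heads_at_def fun_eq_iff)
  show ?thesis unfolding reset_def
    using right[OF order.refl, unfolded start mid] left[OF order.refl] final
    by (blast intro: exec_Seq)
qed

text \<open>As long as the walk goes on, the prefixes read agree. It stops at different symbols, one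
  of which may be a blank, or at blanks on both tapes, where both digit lists are exhausted and
  hence equal. The symbols scanned at the end thus decide equality of the registers.\<close>

lemma exec_walk:
  assumes "p \<le> length w + 1" "\<rho> r \<le> V"
  shows "\<exists>k \<le> B. exec w B (walk r s) (p, reg_tapes \<rho>, out) (p, heads_at \<rho> {r, s} k, out)
    \<and> (cells (bits (\<rho> r)) k = cells (bits (\<rho> s)) k \<longleftrightarrow> \<rho> r = \<rho> s)"
proof -
  let ?xs = "bits (\<rho> r)" and ?ys = "bits (\<rho> s)"
  have len: "Suc (length ?xs) \<le> B" using length_bits_less[OF assms(2)] by simp
  have "\<exists>k \<le> B. exec w B (walk r s) (p, heads_at \<rho> {r, s} (Suc j), out) (p, heads_at \<rho> {r, s} k, out)
    \<and> (cells ?xs k = cells ?ys k \<longleftrightarrow> \<rho> r = \<rho> s)"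
    if "j \<le> length ?xs" "j \<le> length ?ys" "take j ?xs = take j ?ys" for j
    using that
  proof (induction "length ?xs - j" arbitrary: j rule: less_induct)
    case less
    show ?case
    proof (cases "cells ?xs (Suc j) = cells ?ys (Suc j) \<and> cells ?xs (Suc j) \<noteq> 0")
      case True
      then have j: "j < length ?xs" "j < length ?ys"
        using cells_beyond[of ?xs j] cells_beyond[of ?ys j] by (metis linorder_not_le)+
      have "?xs ! j = ?ys ! j" using True j by (simp add: cells_nth)
      then have "take (Suc j) ?xs = take (Suc j) ?ys"
        using j less.prems(3) by (metis take_Suc_conv_app_nth)
      moreover have "length ?xs - Suc j < length ?xs - j" "Suc j \<le> length ?xs" "Suc j \<le> length ?ys"
        using j by simp_all
      ultimately obtain k where k: "k \<le> B"
        "exec w B (walk r s) (p, heads_at \<rho> {r, s} (Suc (Suc j)), out) (p, heads_at \<rho> {r, s} k, out)"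
        "cells ?xs k = cells ?ys k \<longleftrightarrow> \<rho> r = \<rho> s" using less.hyps[of "Suc j"] by blast
      have body: "exec w B (on_tapes {r, s} (\<lambda>x. (x, Move_Right)))
          (p, heads_at \<rho> {r, s} (Suc j), out) (p, heads_at \<rho> {r, s} (Suc (Suc j)), out)"
        using len j B_pos assms(1) by (intro exec_on_tapes) (auto simp: heads_at_def fun_eq_iff)
      have "holds w (\<lambda>_ x. x r = x s \<and> x r \<noteq> 0) (p, heads_at \<rho> {r, s} (Suc j), out)"
        using True by (simp add: heads_at_def scan_def)
      from exec_While_step[OF this body k(2)[unfolded walk_def]]
      show ?thesis unfolding walk_def using k(1,3) by blast
    next
      case False
      have "cells ?xs (Suc j) = cells ?ys (Suc j) \<longleftrightarrow> \<rho> r = \<rho> s"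
      proof
        assume "cells ?xs (Suc j) = cells ?ys (Suc j)"
        with False have z: "cells ?xs (Suc j) = 0" "cells ?ys (Suc j) = 0" by auto
        \<comment> \<open>No digit is represented by the symbol 0, so a blank in cell
          \<open>Suc j\<close> means that the digits have ended.\<close>
        have "\<not> j < length (bits n)" if "cells (bits n) (Suc j) = 0" for n
          using that nth_bits[of j n] cells_nth[of j "bits n"] by fastforce
        with z have "\<not> j < length ?xs" "\<not> j < length ?ys" by blast+
        with less.prems have "?xs = ?ys" by simp
        then show "\<rho> r = \<rho> s" by (simp add: bits_inject)
      qed simp
      moreover have "exec w B (walk r s) (p, heads_at \<rho> {r, s} (Suc j), out) (p, heads_at \<rho> {r, s} (Suc j), out)"
        unfolding walk_def by (rule exec_While_stop) (use False in \<open>simp add: heads_at_def scan_def\<close>)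
      moreover have "Suc j \<le> B" using less.prems(1) len by simp
      ultimately show ?thesis by blast
    qed
  qed
  from this[of 0] show ?thesis using heads_at_1[of \<rho> "{r, s}"] by simp
qed

text \<open>Register-level execution; the premise keeps the range conditions out of the later rules.\<close>

fun run :: "'r com \<Rightarrow> nat \<times> ('r \<Rightarrow> nat) \<times> bool list \<Rightarrow> nat \<times> ('r \<Rightarrow> nat) \<times> bool list \<Rightarrow> bool" where
  "run c (p, \<rho>, out) (p', \<rho>', out') \<longleftrightarrow>
     (p \<le> length w + 1 \<and> (\<forall>r. \<rho> r \<le> V) \<longrightarrow>
      p' \<le> length w + 1 \<and> (\<forall>r. \<rho>' r \<le> V) \<and>
      exec w B c (p, reg_tapes \<rho>, out) (p', reg_tapes \<rho>', out'))"

lemma runI: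
  assumes "\<lbrakk>p \<le> length w + 1; \<forall>r. \<rho> r \<le> V\<rbrakk> \<Longrightarrow> p' \<le> length w + 1 \<and> (\<forall>r. \<rho>' r \<le> V) \<and>
      exec w B c (p, reg_tapes \<rho>, out) (p', reg_tapes \<rho>', out')"
  shows "run c (p, \<rho>, out) (p', \<rho>', out')"
  using assms unfolding run.simps by blast

lemma runD:
  assumes "run c (p, \<rho>, out) (p', \<rho>', out')" "p \<le> length w + 1" "\<forall>r. \<rho> r \<le> V"
  shows "p' \<le> length w + 1" "\<forall>r. \<rho>' r \<le> V" "exec w B c (p, reg_tapes \<rho>, out) (p', reg_tapes \<rho>', out')"
  using assms unfolding run.simps by blast+

lemma run_Skip: "run Skip s s"
  by (cases s) (simp add: exec_Skip)

declare run.simps [simp del]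

lemma run_Seq:
  assumes "run c s s'" "run d s' s''"
  shows "run (c ;; d) s s''"
proof -
  obtain p \<rho> out where s: "s = (p, \<rho>, out)" by (metis prod_cases3)
  obtain p' \<rho>' out' where s': "s' = (p', \<rho>', out')" by (metis prod_cases3)
  obtain p'' \<rho>'' out'' where s'': "s'' = (p'', \<rho>'', out'')" by (metis prod_cases3)
  show ?thesis unfolding s s''
  proof (rule runI)
    assume ok: "p \<le> length w + 1" "\<forall>r. \<rho> r \<le> V"
    note r = runD[OF assms(1)[unfolded s s'] ok]
    note r' = runD[OF assms(2)[unfolded s' s''] r(1,2)]
    from exec_Seq[OF r(3) r'(3)] r'(1,2)
    show "p'' \<le> length w + 1 \<and> (\<forall>r. \<rho>'' r \<le> V) \<and>
        exec w B (c ;; d) (p, reg_tapes \<rho>, out) (p'', reg_tapes \<rho>'', out'')" by blast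
  qed
qed

lemma run_increment:
  "\<rho> r < V \<Longrightarrow> run (increment r) (p, \<rho>, out) (p, \<rho>(r := Suc (\<rho> r)), out)"
  by (intro runI conjI exec_increment) simp_all

lemma run_reset: "run (reset r) (p, \<rho>, out) (p, \<rho>(r := 0), out)"
  by (intro runI conjI exec_reset) simp_all

lemma exec_neutral:
  assumes "snd (snd (f (scan (reg_tapes \<rho>)))) = z"
    and "fst (snd (f (scan (reg_tapes \<rho>)))) = (\<lambda>r. (scan (reg_tapes \<rho>) r, Stay))"
    and "p' = min (length w + 1) (move_head (fst (f (scan (reg_tapes \<rho>)))) p)"
    and "out' = out @ (case z of None \<Rightarrow> [] | Some b \<Rightarrow> [b])"
  shows "exec w B (Act f) (p, reg_tapes \<rho>, out) (p', reg_tapes \<rho>, out')"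
proof (rule exec_Act)
  obtain d \<alpha> y where f: "f (scan (reg_tapes \<rho>)) = (d, \<alpha>, y)" by (metis prod_cases3)
  show "(p', reg_tapes \<rho>, out') =
      act_result w (f (scan (fst (snd (p, reg_tapes \<rho>, out))))) (p, reg_tapes \<rho>, out)"
    using assms f by (auto simp: scan_def update_tape_Stay)
  show "heads_le B (p', reg_tapes \<rho>, out')" using B_pos by (auto simp: heads_at_def)
qed

lemma run_move_input:
  "run (move_input d) (p, \<rho>, out) (min (length w + 1) (move_head d p), \<rho>, out)"
  unfolding move_input_def by (intro runI conjI exec_neutral[where z = None]) simp_all

lemma run_emit_bit: "run (emit_bit b) (p, \<rho>, out) (p, \<rho>, out @ [b])"
  unfolding emit_bit_def by (intro runI conjI exec_neutral[where z = "Some b"]) simp_all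

lemma run_if_eq:
  assumes "run (if \<rho> r = \<rho> s then c else d) (p, \<rho>, out) s'"
  shows "run (if_eq r s c d) (p, \<rho>, out) s'"
proof -
  obtain p' \<rho>' out' where s': "s' = (p', \<rho>', out')" by (metis prod_cases3)
  show ?thesis unfolding s'
  proof (rule runI)
    assume ok: "p \<le> length w + 1" "\<forall>r. \<rho> r \<le> V"
    note r = runD[OF assms[unfolded s'] ok]
    obtain k where k: "k \<le> B"
      "exec w B (walk r s) (p, reg_tapes \<rho>, out) (p, heads_at \<rho> {r, s} k, out)"
      "cells (bits (\<rho> r)) k = cells (bits (\<rho> s)) k \<longleftrightarrow> \<rho> r = \<rho> s"
      using exec_walk[OF ok(1), of \<rho> r s out] ok(2) by blast
    have h: "holds w (\<lambda>_ x. x r = x s) (p, heads_at \<rho> {r, s} k, out) \<longleftrightarrow> \<rho> r = \<rho> s"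
      using k(3) by (simp add: heads_at_def scan_def)
    have "exec w B (return_heads {r, s} r) (p, heads_at \<rho> {r, s} k, out) (p, reg_tapes \<rho>, out)"
      by (rule exec_return_heads) (use ok k in simp_all)
    from exec_Seq[OF this r(3)]
    have "exec w B (if holds w (\<lambda>_ x. x r = x s) (p, heads_at \<rho> {r, s} k, out)
          then return_heads {r, s} r ;; c else return_heads {r, s} r ;; d)
        (p, heads_at \<rho> {r, s} k, out) (p', reg_tapes \<rho>', out')"
      unfolding h by (cases "\<rho> r = \<rho> s") simp_all
    from exec_Seq[OF k(2) exec_Cond[OF this]] r(1,2)
    show "p' \<le> length w + 1 \<and> (\<forall>r. \<rho>' r \<le> V) \<and>
        exec w B (if_eq r s c d) (p, reg_tapes \<rho>, out) (p', reg_tapes \<rho>', out')"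
      unfolding if_eq_def by blast
  qed
qed

lemma run_while_neq_stop:
  assumes "\<rho> r = \<rho> s"
  shows "run (while_neq r s c) (p, \<rho>, out) (p, \<rho>, out)"
proof (rule runI)
  assume ok: "p \<le> length w + 1" "\<forall>r. \<rho> r \<le> V"
  obtain k where k: "k \<le> B"
    "exec w B (walk r s) (p, reg_tapes \<rho>, out) (p, heads_at \<rho> {r, s} k, out)"
    using exec_walk[OF ok(1), of \<rho> r s out] ok(2) by blast
  have "exec w B (return_heads {r, s} r) (p, heads_at \<rho> {r, s} k, out) (p, reg_tapes \<rho>, out)"
    by (rule exec_return_heads) (use ok k in simp_all)
  note return = this
  have "\<not> holds w (\<lambda>_ x. x r \<noteq> x s) (p, heads_at \<rho> {r, s} k, out)"
    by (simp add: heads_at_def scan_def assms)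
  from exec_Seq[OF k(2) exec_Seq[OF exec_While_stop[OF this] return]] ok
  show "p \<le> length w + 1 \<and> (\<forall>r. \<rho> r \<le> V) \<and>
      exec w B (while_neq r s c) (p, reg_tapes \<rho>, out) (p, reg_tapes \<rho>, out)"
    unfolding while_neq_def by blast
qed

lemma run_while_neq_step:
  assumes "\<rho> r \<noteq> \<rho> s" "run c (p, \<rho>, out) s'" "run (while_neq r s c) s' s''"
  shows "run (while_neq r s c) (p, \<rho>, out) s''"
proof -
  obtain p' \<rho>' out' where s': "s' = (p', \<rho>', out')" by (metis prod_cases3)
  obtain p'' \<rho>'' out'' where s'': "s'' = (p'', \<rho>'', out'')" by (metis prod_cases3)
  let ?W = "While (\<lambda>_ x. x r \<noteq> x s) ((return_heads {r, s} r ;; c) ;; walk r s)"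
  show ?thesis unfolding s''
  proof (rule runI)
    assume ok: "p \<le> length w + 1" "\<forall>r. \<rho> r \<le> V"
    note r = runD[OF assms(2)[unfolded s'] ok]
    note r'' = runD[OF assms(3)[unfolded s' s''] r(1,2)]
    \<comment> \<open>The remaining loop begins with its own walk. This walk is split off here and
      becomes the walk that closes the body of the present round.\<close>
    obtain t t' where t: "exec w B (walk r s) (p', reg_tapes \<rho>', out') t"
        "exec w B ?W t t'" "exec w B (return_heads {r, s} r) t' (p'', reg_tapes \<rho>'', out'')"
      using r''(3) unfolding while_neq_def by (elim exec_SeqE) (rule that)
    obtain k where k: "k \<le> B"
      "exec w B (walk r s) (p, reg_tapes \<rho>, out) (p, heads_at \<rho> {r, s} k, out)"
      "cells (bits (\<rho> r)) k = cells (bits (\<rho> s)) k \<longleftrightarrow> \<rho> r = \<rho> s"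
      using exec_walk[OF ok(1), of \<rho> r s out] ok(2) by blast
    have "exec w B (return_heads {r, s} r) (p, heads_at \<rho> {r, s} k, out) (p, reg_tapes \<rho>, out)"
      by (rule exec_return_heads) (use ok k in simp_all)
    note body = exec_Seq[OF exec_Seq[OF this r(3)] t(1)]
    have "holds w (\<lambda>_ x. x r \<noteq> x s) (p, heads_at \<rho> {r, s} k, out)"
      using k(3) assms(1) by (simp add: heads_at_def scan_def)
    from exec_Seq[OF k(2) exec_Seq[OF exec_While_step[OF this body t(2)] t(3)]] r''(1,2)
    show "p'' \<le> length w + 1 \<and> (\<forall>r. \<rho>'' r \<le> V) \<and>
        exec w B (while_neq r s c) (p, reg_tapes \<rho>, out) (p'', reg_tapes \<rho>'', out'')"
      unfolding while_neq_def by blast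
  qed
qed

lemma run_while_input_stop:
  assumes "\<not> f (read_input w p)"
  shows "run (while_input f c) (p, \<rho>, out) (p, \<rho>, out)"
  unfolding while_input_def
  by (intro runI conjI exec_While_stop) (use assms in simp_all)

lemma run_while_input_step:
  assumes "f (read_input w p)" "run c (p, \<rho>, out) s'" "run (while_input f c) s' s''"
  shows "run (while_input f c) (p, \<rho>, out) s''"
proof -
  obtain p' \<rho>' out' where s': "s' = (p', \<rho>', out')" by (metis prod_cases3)
  obtain p'' \<rho>'' out'' where s'': "s'' = (p'', \<rho>'', out'')" by (metis prod_cases3)
  show ?thesis unfolding s''
  proof (rule runI)
    assume ok: "p \<le> length w + 1" "\<forall>r. \<rho> r \<le> V"
    note r = runD[OF assms(2)[unfolded s'] ok]
    note r'' = runD[OF assms(3)[unfolded s' s''] r(1,2)]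
    have "holds w (\<lambda>s _. f s) (p, reg_tapes \<rho>, out)" using assms(1) by simp
    from exec_While_step[OF this r(3) r''(3)[unfolded while_input_def]] r''(1,2)
    show "p'' \<le> length w + 1 \<and> (\<forall>r. \<rho>'' r \<le> V) \<and>
        exec w B (while_input f c) (p, reg_tapes \<rho>, out) (p'', reg_tapes \<rho>'', out'')"
      unfolding while_input_def by blast
  qed
qed

lemma exec_init_tapes:
  "exec w B init_tapes (0, \<lambda>_. (\<lambda>_. 0, 0), []) (0, reg_tapes (\<lambda>_. 0), [])"
  unfolding init_tapes_def
proof (rule exec_Act)
  show "(0, reg_tapes (\<lambda>_. 0), []) = act_result w (Stay, \<lambda>r. (3, Move_Right), None)
      (0, \<lambda>_. (\<lambda>_. 0, 0), [])"
    by (simp add: heads_at_def cells_def fun_eq_iff)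
  show "heads_le B (0, reg_tapes (\<lambda>_. 0), [])" using B_pos by (simp add: heads_at_def)
qed

end

section \<open>The reduction\<close>

text \<open>The end of the word also counts as a terminator, which makes decoding total: the
  reduction has to be defined on words that encode nothing.\<close>

fun read_num :: "bool list \<Rightarrow> nat \<times> bool list" where
  "read_num [] = (0, [])"
| "read_num (False # xs) = (0, xs)"
| "read_num (True # xs) = (case read_num xs of (n, ys) \<Rightarrow> (Suc n, ys))"

definition read_gate :: "bool list \<Rightarrow> (nat \<times> nat \<times> nat) \<times> bool list" where
  "read_gate xs =
     (case read_num xs of (t, xs1) \<Rightarrow> case read_num xs1 of (x, xs2) \<Rightarrow>
        if t < 2 then ((t, x, 0), xs2)
        else case read_num xs2 of (y, xs3) \<Rightarrow> ((t, x, y), xs3))"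

text \<open>Beyond the end of the input this reads an endless supply of gates \<open>Var 0\<close>.\<close>

definition fetch_gate :: "bool list \<Rightarrow> nat \<Rightarrow> nat \<times> nat \<times> nat" where
  "fetch_gate w j = fst (read_gate (((snd \<circ> read_gate) ^^ j) (snd (read_num w))))"

text \<open>
  The straight-line program consists of blocks of nine rules; block \<open>j\<close> describes the powers
  \<open>g\<^sup>e\<close>, \<open>g\<^sup>-\<^sup>e\<close> with \<open>e = 2\<^sup>j\<close> (rules 0, 1), the letters \<open>h\<close>, \<open>h\<^sup>-\<^sup>1\<close>
  and the trivial word (rules 2, 3, 4), and the translation of gate \<open>j\<close> and its inverse
  (rules 6, 8).  The variable \<open>x\<^sub>i\<close> is replaced by \<open>a\<^sup>e\<close> with exponent \<open>e = 2 ^ ((i + 1) * length w)\<close>.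
\<close>

definition sandwich :: "nat \<Rightarrow> nat \<times> nat \<times> nat \<times> nat \<times> nat \<times> nat \<Rightarrow> slp_rhs list" where
  "sandwich j = (\<lambda>(l, p, r, l', p', r').
     [Concat l p, Concat (9 * j + 5) r, Concat l' p', Concat (9 * j + 7) r'])"

text \<open>
  Multiplication by the input gate with tag \<open>t\<close> and argument \<open>x\<close>; the other factor has the name
  \<open>p\<close> and its inverse the name \<open>q\<close>.
\<close>

definition input_times ::
    "nat \<Rightarrow> nat \<Rightarrow> nat \<Rightarrow> nat \<Rightarrow> nat \<Rightarrow> nat \<times> nat \<times> nat \<times> nat \<times> nat \<times> nat" where
  "input_times N t x p q =
     (if t = 0 then let k = 9 * ((x + 1) * N) in (k, p, k + 1, k, q, k + 1)
      else if x = 0 then (4, q, 4, 4, p, 4)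
      else if x = 1 then (4, 4, 4, 4, 4, 4)
      else (4, p, 4, 4, q, 4))"

text \<open>An input gate is treated as its product with the gate \<open>1\<close>, which has the names 2 and 3.\<close>

definition gate_args :: "bool list \<Rightarrow> nat \<Rightarrow> nat \<times> nat \<times> nat \<times> nat \<times> nat \<times> nat" where
  "gate_args w j =
     (case fetch_gate w j of (t, x, y) \<Rightarrow>
      case fetch_gate w x of (t1, x1, y1) \<Rightarrow>
      case fetch_gate w y of (t2, x2, y2) \<Rightarrow>
        if t < 2 then input_times (length w) t x 2 3
        else if t = 2 then (4, 9 * x + 6, 9 * y + 6, 4, 9 * x + 8, 9 * y + 8)
        else if t1 < 2 then input_times (length w) t1 x1 (9 * y + 6) (9 * y + 8)
        else input_times (length w) t2 x2 (9 * x + 6) (9 * x + 8))"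

definition block :: "bool list \<Rightarrow> nat \<Rightarrow> slp_rhs list" where
  "block w j =
     (if j = 0 then [Letter G, Letter G_inv]
      else [Concat (9 * (j - 1)) (9 * (j - 1)), Concat (9 * (j - 1) + 1) (9 * (j - 1) + 1)]) @
     [Letter H, Letter H_inv, Concat 2 3] @ sandwich j (gate_args w j)"

text \<open>In the encoding of a circuit all variable indices \<open>i\<close> and all gate names
  are below \<open>N = length w\<close>. The largest power needed has index
  \<open>(i + 1) * N\<close>, which is at most \<open>N * N\<close>, so powers and gates both find
  their blocks.\<close>

definition num_blocks :: "bool list \<Rightarrow> nat" where
  "num_blocks w = (length w + 1) * length w"

definition reduction :: "bool list \<Rightarrow> slp" where
  "reduction w = SLP (concat (map (block w) [0..<num_blocks w])) (9 * fst (read_num w) + 6)"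

lemma read_num_length:
  "read_num xs = (n, ys) \<Longrightarrow> n \<le> length xs \<and> length ys \<le> length xs"
  by (induction xs arbitrary: n rule: read_num.induct) (auto split: prod.splits)

section \<open>Weakest preconditions for register programs\<close>

context register_machine
begin

definition ok :: "nat \<Rightarrow> ('r \<Rightarrow> nat) \<Rightarrow> bool" where
  "ok p \<rho> \<longleftrightarrow> p \<le> length w + 1 \<and> (\<forall>r. \<rho> r \<le> V)"

text \<open>The precondition asks for some run that ends in \<open>Q\<close>. The guard
  \<open>ok\<close> lets a proof use the bounds on head and registers at any intermediate state,
  through \<open>wp_okI\<close>, without stating them in the postconditions.\<close>

definition wp ::
    "'r com \<Rightarrow> (nat \<times> ('r \<Rightarrow> nat) \<times> bool list \<Rightarrow> bool) \<Rightarrow> nat \<times> ('r \<Rightarrow> nat) \<times> bool list \<Rightarrow> bool" where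
  "wp c Q s \<longleftrightarrow> (ok (fst s) (fst (snd s)) \<longrightarrow> (\<exists>s'. run c s s' \<and> Q s'))"

lemma run_ok: "run c s s' \<Longrightarrow> ok (fst s) (fst (snd s)) \<Longrightarrow> ok (fst s') (fst (snd s'))"
  by (cases s; cases s') (simp add: ok_def run.simps)

lemma wp_run: "run c s s' \<Longrightarrow> Q s' \<Longrightarrow> wp c Q s"
  unfolding wp_def by blast

lemma wp_okI: "(ok p \<rho> \<Longrightarrow> wp c Q (p, \<rho>, out)) \<Longrightarrow> wp c Q (p, \<rho>, out)"
  unfolding wp_def by simp

lemma wp_mono: "wp c Q s \<Longrightarrow> (\<And>s'. Q s' \<Longrightarrow> Q' s') \<Longrightarrow> wp c Q' s"
  unfolding wp_def by blast

text \<open>Sequencing and the unfolding of one round of a loop are both of this shape: a run of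
  \<open>e\<close> is put together from a run of \<open>c\<close> and a run of
  \<open>d\<close>.\<close>

lemma wp_step:
  assumes "wp c (wp d Q) s" "\<And>s' s''. run c s s' \<Longrightarrow> run d s' s'' \<Longrightarrow> run e s s''"
  shows "wp e Q s"
  unfolding wp_def
proof
  assume s: "ok (fst s) (fst (snd s))"
  with assms(1) obtain s' where s': "run c s s'" "wp d Q s'" unfolding wp_def by blast
  with run_ok[OF s'(1) s] obtain s'' where "run d s' s''" "Q s''" unfolding wp_def by blast
  with assms(2)[OF s'(1)] show "\<exists>s'. run e s s' \<and> Q s'" by blast
qed

lemma wp_Skip: "Q s \<Longrightarrow> wp Skip Q s"
  by (rule wp_run[OF run_Skip])

lemma wp_Seq: "wp c (wp d Q) s \<Longrightarrow> wp (c ;; d) Q s"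
  by (erule wp_step) (rule run_Seq)

lemma wp_increment: "\<rho> r < V \<Longrightarrow> Q (p, \<rho>(r := Suc (\<rho> r)), out) \<Longrightarrow> wp (increment r) Q (p, \<rho>, out)"
  by (rule wp_run[OF run_increment])

lemma wp_reset: "Q (p, \<rho>(r := 0), out) \<Longrightarrow> wp (reset r) Q (p, \<rho>, out)"
  by (rule wp_run[OF run_reset])

lemma wp_move_input:
  "Q (min (length w + 1) (move_head d p), \<rho>, out) \<Longrightarrow> wp (move_input d) Q (p, \<rho>, out)"
  by (rule wp_run[OF run_move_input])

lemma wp_emit_bit: "Q (p, \<rho>, out @ [b]) \<Longrightarrow> wp (emit_bit b) Q (p, \<rho>, out)"
  by (rule wp_run[OF run_emit_bit])

lemma wp_if_eq:
  assumes "\<rho> r = \<rho> s \<Longrightarrow> wp c Q (p, \<rho>, out)" "\<rho> r \<noteq> \<rho> s \<Longrightarrow> wp d Q (p, \<rho>, out)"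
  shows "wp (if_eq r s c d) Q (p, \<rho>, out)"
proof -
  have "wp (if \<rho> r = \<rho> s then c else d) Q (p, \<rho>, out)" using assms by simp
  then show ?thesis unfolding wp_def using run_if_eq[of \<rho> r s c d p out] by blast
qed

lemma wp_while_neq_stop: "\<rho> r = \<rho> s \<Longrightarrow> Q (p, \<rho>, out) \<Longrightarrow> wp (while_neq r s c) Q (p, \<rho>, out)"
  by (rule wp_run[OF run_while_neq_stop])

lemma wp_while_neq_step:
  assumes "\<rho> r \<noteq> \<rho> s" "wp c (wp (while_neq r s c) Q) (p, \<rho>, out)"
  shows "wp (while_neq r s c) Q (p, \<rho>, out)"
  using assms(2) by (rule wp_step) (rule run_while_neq_step[where \<rho> = \<rho> and r = r and s = s, OF assms(1)])

lemma wp_while_input_stop: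
  "\<not> f (read_input w p) \<Longrightarrow> Q (p, \<rho>, out) \<Longrightarrow> wp (while_input f c) Q (p, \<rho>, out)"
  by (rule wp_run[OF run_while_input_stop])

lemma wp_while_input_step:
  assumes "f (read_input w p)" "wp c (wp (while_input f c) Q) (p, \<rho>, out)"
  shows "wp (while_input f c) Q (p, \<rho>, out)"
  using assms(2) by (rule wp_step) (rule run_while_input_step[where f = f and p = p, OF assms(1)])

end

section \<open>Counting loops and reading the input\<close>

definition for_upto :: "'r \<Rightarrow> 'r \<Rightarrow> 'r com \<Rightarrow> 'r com" where
  "for_upto u r c = reset u ;; while_neq u r (c ;; increment u)"

fun emit_bits :: "bool list \<Rightarrow> 'r com" where
  "emit_bits [] = Skip"
| "emit_bits (b # bs) = emit_bit b ;; emit_bits bs"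

definition rewind :: "'r com" where
  "rewind = while_input (\<lambda>s. s \<noteq> Left_End) (move_input Move_Left) ;; move_input Move_Right"

definition read_num_com :: "'r \<Rightarrow> 'r com" where
  "read_num_com r =
     reset r ;; (while_input (\<lambda>s. s = Bit True) (increment r ;; move_input Move_Right) ;;
     move_input Move_Right)"

definition count_input :: "'r \<Rightarrow> 'r com" where
  "count_input r =
     rewind ;; while_input (\<lambda>s. s \<noteq> Right_End) (increment r ;; move_input Move_Right)"

lemma wf_com_macros [simp]:
  "wf_com 4 (for_upto u r c) \<longleftrightarrow> wf_com 4 c" "wf_com 4 (emit_bits bs)" "wf_com 4 rewind"
  "wf_com 4 (read_num_com r)" "wf_com 4 (count_input r)"
proof -
  show "wf_com 4 (emit_bits bs)" by (induction bs) simp_all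
qed (simp_all add: for_upto_def rewind_def read_num_com_def count_input_def)

context register_machine
begin

text \<open>The invariant has to fix both counter and limit, because the loop tests for inequality
  and would run past a limit that moves. The body keeps the counter, and the invariant of the next
  round is stated for the incremented one. The induction is on the number of rounds left.\<close>

lemma wp_for_upto:
  assumes init: "I 0 (p, \<rho>(u := 0), out)"
    and inv: "\<And>i p \<rho> out. I i (p, \<rho>, out) \<Longrightarrow> \<rho> u = i \<and> \<rho> r = n"
    and body: "\<And>i p \<rho> out. i < n \<Longrightarrow> I i (p, \<rho>, out) \<Longrightarrow>
      wp c (\<lambda>(p, \<rho>, out). \<rho> u = i \<and> I (Suc i) (p, \<rho>(u := Suc i), out)) (p, \<rho>, out)"
    and final: "\<And>s. I n s \<Longrightarrow> Q s"
  shows "wp (for_upto u r c) Q (p, \<rho>, out)"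
proof -
  have "wp (while_neq u r (c ;; increment u)) Q s" if "I (n - k) s" "k \<le> n" for k s
    using that
  proof (induction k arbitrary: s)
    case 0
    obtain p \<rho> out where s: "s = (p, \<rho>, out)" by (metis prod_cases3)
    have I: "I n (p, \<rho>, out)" using 0 s by simp
    show ?case unfolding s
      by (rule wp_while_neq_stop) (use inv[OF I] final[OF I] in simp_all)
  next
    case (Suc k)
    obtain p \<rho> out where s: "s = (p, \<rho>, out)" by (metis prod_cases3)
    let ?i = "n - Suc k"
    have i: "?i < n" "Suc ?i = n - k" using Suc.prems(2) by auto
    have I: "I ?i (p, \<rho>, out)" using Suc.prems(1) s by simp
    show ?case unfolding s
    proof (rule wp_okI, rule wp_while_neq_step)
      assume "ok p \<rho>"
      \<comment> \<open>The limit is the content of a register and so at most \<open>V\<close>; the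
        counter, being smaller, can be incremented.\<close>
      then have n: "n \<le> V" using inv[OF I] unfolding ok_def by metis
      show "\<rho> u \<noteq> \<rho> r" using inv[OF I] i(1) by simp
      show "wp (c ;; increment u) (wp (while_neq u r (c ;; increment u)) Q) (p, \<rho>, out)"
      proof (rule wp_Seq, rule wp_mono[OF body[OF i(1) I]])
        fix s' assume "case s' of (p, \<rho>, out) \<Rightarrow> \<rho> u = ?i \<and> I (Suc ?i) (p, \<rho>(u := Suc ?i), out)"
        moreover obtain p' \<rho>' out' where s': "s' = (p', \<rho>', out')" by (metis prod_cases3)
        ultimately have u: "\<rho>' u = ?i" and I': "I (n - k) (p', \<rho>'(u := Suc (\<rho>' u)), out')"
          using i(2) by auto
        show "wp (increment u) (wp (while_neq u r (c ;; increment u)) Q) s'" unfolding s'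
          by (rule wp_increment) (use u i n Suc.IH[OF I'] Suc.prems(2) in simp_all)
      qed
    qed
  qed
  from this[of n] init show ?thesis unfolding for_upto_def by (intro wp_Seq wp_reset) simp
qed

lemma wp_emit_bits: "Q (p, \<rho>, out @ bs) \<Longrightarrow> wp (emit_bits bs) Q (p, \<rho>, out)"
proof (induction bs arbitrary: out)
  case Nil
  then show ?case by (simp add: wp_Skip)
next
  case (Cons b bs)
  have "wp (emit_bits bs) Q (p, \<rho>, out @ [b])" by (rule Cons.IH) (use Cons.prems in simp)
  then show ?case unfolding emit_bits.simps by (intro wp_Seq wp_emit_bit)
qed

definition at_suffix :: "nat \<Rightarrow> bool list \<Rightarrow> bool" where
  "at_suffix p xs \<longleftrightarrow> 1 \<le> p \<and> p \<le> length w + 1 \<and> drop (p - 1) w = xs"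

lemma at_suffix_length: "at_suffix p xs \<Longrightarrow> length xs \<le> length w"
  unfolding at_suffix_def by auto

lemma at_suffix_Nil: "at_suffix p [] \<Longrightarrow> read_input w p = Right_End \<and> at_suffix (min (length w + 1) (p + 1)) []"
  unfolding at_suffix_def read_input_def by auto

lemma at_suffix_Cons:
  assumes "at_suffix p (x # xs)"
  shows "read_input w p = Bit x" "at_suffix (min (length w + 1) (p + 1)) xs"
proof -
  have p: "1 \<le> p" "drop (p - 1) w = x # xs" using assms unfolding at_suffix_def by auto
  then have less: "p - 1 < length w" by (metis drop_all list.distinct(1) not_less)
  then have "w ! (p - 1) # drop (Suc (p - 1)) w = x # xs" using p(2) Cons_nth_drop_Suc by metis
  with p(1) have "w ! (p - 1) = x" "drop p w = xs" by auto
  with p(1) less show "read_input w p = Bit x" "at_suffix (min (length w + 1) (p + 1)) xs"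
    unfolding at_suffix_def read_input_def by auto
qed

lemma wp_rewind:
  assumes "\<And>p'. at_suffix p' w \<Longrightarrow> Q (p', \<rho>, out)"
  shows "wp rewind Q (p, \<rho>, out)"
proof -
  have move_back: "wp (while_input (\<lambda>s. s \<noteq> Left_End) (move_input Move_Left))
      (wp (move_input Move_Right) Q) (p, \<rho>, out)" if "p \<le> length w + 1"
    using that
  proof (induction p)
    case 0
    have "at_suffix 1 w" by (simp add: at_suffix_def)
    with assms show ?case
      by (intro wp_while_input_stop wp_move_input) (simp_all add: read_input_def)
  next
    case (Suc p)
    have "min (length w + 1) (move_head Move_Left (Suc p)) = p" using Suc.prems by simp
    then have "wp (move_input Move_Left)
        (wp (while_input (\<lambda>s. s \<noteq> Left_End) (move_input Move_Left)) (wp (move_input Move_Right) Q)) (Suc p, \<rho>, out)"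
      using Suc by (intro wp_move_input) simp
    then show ?case by (rule wp_while_input_step[rotated]) (simp add: read_input_def)
  qed
  show ?thesis unfolding rewind_def by (rule wp_okI, rule wp_Seq, rule move_back) (simp add: ok_def)
qed

text \<open>The generalisation over \<open>k\<close> records the letters already counted. The input
  head is clamped behind the last letter, so the unconditional final move agrees with
  \<open>read_num\<close> also when the terminator is missing.\<close>

lemma wp_read_num:
  assumes at: "at_suffix p xs" and V: "length w \<le> V" and num: "read_num xs = (n, ys)"
    and Q: "\<And>p'. at_suffix p' ys \<Longrightarrow> Q (p', \<rho>(r := n), out)"
  shows "wp (read_num_com r) Q (p, \<rho>, out)"
proof -
  have "wp (while_input (\<lambda>s. s = Bit True) (increment r ;; move_input Move_Right))
      (wp (move_input Move_Right) Q) (p, \<rho>(r := k), out)"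
    if "at_suffix p xs" "k + length xs \<le> length w" "read_num xs = (n - k, ys)" "k \<le> n" for k p xs
    using that
  proof (induction xs arbitrary: k p)
    case Nil
    then have k: "k = n" "ys = []" by auto
    have q: "Q (min (length w + 1) (move_head Move_Right p), \<rho>(r := k), out)"
      unfolding move_head.simps k(1) by (rule Q) (use at_suffix_Nil[OF Nil(1)] k in simp)
    show ?case
      by (rule wp_while_input_stop[rotated], rule wp_move_input, rule q)
        (use at_suffix_Nil[OF Nil(1)] in simp)
  next
    case (Cons x xs)
    note x = at_suffix_Cons[OF Cons.prems(1)]
    show ?case
    proof (cases x)
      case True
      then obtain m where m: "read_num xs = (m, ys)" "n - k = Suc m"
        using Cons.prems(3) by (auto split: prod.splits)
      have "wp (while_input (\<lambda>s. s = Bit True) (increment r ;; move_input Move_Right))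
          (wp (move_input Move_Right) Q) (min (length w + 1) (p + 1), \<rho>(r := Suc k), out)"
        by (rule Cons.IH) (use Cons.prems x(2) m in auto)
      then have "wp (increment r ;; move_input Move_Right)
          (wp (while_input (\<lambda>s. s = Bit True) (increment r ;; move_input Move_Right))
            (wp (move_input Move_Right) Q)) (p, \<rho>(r := k), out)"
        using Cons.prems(2) V by (intro wp_Seq wp_increment wp_move_input) simp_all
      then show ?thesis by (rule wp_while_input_step[rotated]) (use x(1) True in simp)
    next
      case False
      then have k: "k = n" "ys = xs" using Cons.prems(3,4) by auto
      have q: "Q (min (length w + 1) (move_head Move_Right p), \<rho>(r := k), out)"
        unfolding move_head.simps k(1) by (rule Q) (use x(2) k in simp)
      show ?thesis
        by (rule wp_while_input_stop[rotated], rule wp_move_input, rule q) (use x(1) False in simp)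
    qed
  qed
  from this[of p xs 0] at num at_suffix_length[OF at] show ?thesis
    unfolding read_num_com_def by (intro wp_Seq wp_reset) simp
qed

lemma wp_count_input:
  assumes V: "length w \<le> V" and Q: "\<And>p'. Q (p', \<rho>(r := length w), out)" and "\<rho> r = 0"
  shows "wp (count_input r) Q (p, \<rho>, out)"
proof -
  have "wp (while_input (\<lambda>s. s \<noteq> Right_End) (increment r ;; move_input Move_Right)) Q (p, \<rho>(r := k), out)"
    if "at_suffix p xs" "k + length xs = length w" for k p xs
    using that
  proof (induction xs arbitrary: k p)
    case Nil
    then have "k = length w" by simp
    then have q: "Q (p, \<rho>(r := k), out)" by (simp only: Q)
    show ?case
      by (rule wp_while_input_stop[rotated], rule q) (use at_suffix_Nil[OF Nil(1)] in simp)
  next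
    case (Cons x xs)
    note x = at_suffix_Cons[OF Cons.prems(1)]
    have "wp (while_input (\<lambda>s. s \<noteq> Right_End) (increment r ;; move_input Move_Right)) Q
        (min (length w + 1) (p + 1), \<rho>(r := Suc k), out)"
      by (rule Cons.IH[OF x(2)]) (use Cons.prems(2) in simp)
    then have "wp (increment r ;; move_input Move_Right)
        (wp (while_input (\<lambda>s. s \<noteq> Right_End) (increment r ;; move_input Move_Right)) Q) (p, \<rho>(r := k), out)"
      using Cons.prems(2) V by (intro wp_Seq wp_increment wp_move_input) simp_all
    then show ?case by (rule wp_while_input_step[rotated]) (use x(1) in simp)
  qed
  \<comment> \<open>No reset precedes this loop. The register is known to contain 0, so
    \<open>\<rho>\<close> coincides with its own update at \<open>r\<close>.\<close>
  from this[of _ w 0] have "wp (while_input (\<lambda>s. s \<noteq> Right_End) (increment r ;; move_input Move_Right)) Q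
      (p', \<rho>, out)" if "at_suffix p' w" for p'
    using that assms(3) fun_upd_idem_iff[of \<rho> r 0] by (metis add_0)
  then show ?thesis unfolding count_input_def by (intro wp_Seq wp_rewind)
qed

end

section \<open>Kronecker substitution\<close>

abbreviation "lookup \<equiv> Poly_Mapping.lookup"
abbreviation "keys \<equiv> Poly_Mapping.keys"

text \<open>The exponent of \<open>a\<close> that a monomial receives when the variable with index
  \<open>i\<close> is replaced by \<open>a ^ (b ^ (i + 1))\<close>. Up to the common factor
  \<open>b\<close>, the exponents of the monomial are the digits of its weight in base
  \<open>b\<close>.\<close>

definition weight :: "nat \<Rightarrow> (nat \<Rightarrow>\<^sub>0 nat) \<Rightarrow> nat" where
  "weight b m = (\<Sum>i\<in>keys m. lookup m i * b ^ (i + 1))"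

definition eval :: "real \<Rightarrow> nat \<Rightarrow> int_mpoly \<Rightarrow> real" where
  "eval a b p = (\<Sum>m\<in>keys p. of_int (lookup p m) * a ^ weight b m)"

text \<open>This norm is chosen because it is subadditive and submultiplicative, and because it
  bounds the total contribution of all coefficients outside the leading one.\<close>

definition coeff_norm :: "int_mpoly \<Rightarrow> int" where
  "coeff_norm p = (\<Sum>m\<in>keys p. \<bar>lookup p m\<bar>)"

text \<open>The bound is on each variable separately and not on the total degree: every exponent has
  to be a valid digit.\<close>

definition exponents_le :: "nat \<Rightarrow> int_mpoly \<Rightarrow> bool" where
  "exponents_le d p \<longleftrightarrow> (\<forall>m\<in>keys p. \<forall>i. lookup m i \<le> d)"

lemma weight_superset:
  "finite A \<Longrightarrow> keys m \<subseteq> A \<Longrightarrow> weight b m = (\<Sum>i\<in>A. lookup m i * b ^ (i + 1))"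
  unfolding weight_def by (rule sum.mono_neutral_left) (auto simp: in_keys_iff)

lemma weight_add: "weight b (m + m') = weight b m + weight b m'"
proof -
  have "keys (m + m') \<subseteq> keys m \<union> keys m'" by (rule keys_add)
  then show ?thesis
    by (subst (1 2 3) weight_superset[where A = "keys m \<union> keys m'"])
      (auto simp: lookup_add sum.distrib algebra_simps)
qed

lemma weight_single: "weight b (Poly_Mapping.single i k) = k * b ^ (i + 1)"
  by (cases "k = 0") (auto simp: weight_def)

lemma weight_zero [simp]: "weight b 0 = 0"
  by (simp add: weight_def)

lemma eval_superset:
  "finite A \<Longrightarrow> keys p \<subseteq> A \<Longrightarrow> eval a b p = (\<Sum>m\<in>A. of_int (lookup p m) * a ^ weight b m)"
  unfolding eval_def by (rule sum.mono_neutral_left) (auto simp: in_keys_iff)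

lemma eval_zero [simp]: "eval a b 0 = 0"
  by (simp add: eval_def)

lemma eval_add: "eval a b (p + q) = eval a b p + eval a b q"
proof -
  have "keys (p + q) \<subseteq> keys p \<union> keys q" by (rule keys_add)
  then show ?thesis
    by (subst (1 2 3) eval_superset[where A = "keys p \<union> keys q"])
      (auto simp: lookup_add sum.distrib algebra_simps)
qed

lemma eval_sum: "eval a b (sum f A) = (\<Sum>x\<in>A. eval a b (f x))"
  by (induction A rule: infinite_finite_induct) (auto simp: eval_add)

lemma eval_single: "eval a b (Poly_Mapping.single m c) = of_int c * a ^ weight b m"
  by (cases "c = 0") (auto simp: eval_def)

lemma coeff_norm_superset:
  "finite A \<Longrightarrow> keys p \<subseteq> A \<Longrightarrow> coeff_norm p = (\<Sum>m\<in>A. \<bar>lookup p m\<bar>)"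
  unfolding coeff_norm_def by (rule sum.mono_neutral_left) (auto simp: in_keys_iff)

lemma coeff_norm_zero [simp]: "coeff_norm 0 = 0"
  by (simp add: coeff_norm_def)

lemma coeff_norm_nonneg: "0 \<le> coeff_norm p"
  by (simp add: coeff_norm_def sum_nonneg)

lemma coeff_norm_add: "coeff_norm (p + q) \<le> coeff_norm p + coeff_norm q"
proof -
  have "keys (p + q) \<subseteq> keys p \<union> keys q" by (rule keys_add)
  then have "coeff_norm (p + q) = (\<Sum>m\<in>keys p \<union> keys q. \<bar>lookup p m + lookup q m\<bar>)"
    by (subst coeff_norm_superset[where A = "keys p \<union> keys q"]) (auto simp: lookup_add)
  also have "\<dots> \<le> (\<Sum>m\<in>keys p \<union> keys q. \<bar>lookup p m\<bar> + \<bar>lookup q m\<bar>)"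
    by (rule sum_mono) (rule abs_triangle_ineq)
  also have "\<dots> = coeff_norm p + coeff_norm q"
    by (subst (1 2) coeff_norm_superset[where A = "keys p \<union> keys q"]) (auto simp: sum.distrib)
  finally show ?thesis .
qed

lemma coeff_norm_sum: "coeff_norm (sum f A) \<le> (\<Sum>x\<in>A. coeff_norm (f x))"
proof (induction A rule: infinite_finite_induct)
  case (insert x A)
  then show ?case using coeff_norm_add[of "f x" "sum f A"] by simp
qed auto

lemma coeff_norm_single [simp]: "coeff_norm (Poly_Mapping.single m c) = \<bar>c\<bar>"
  by (cases "c = 0") (auto simp: coeff_norm_def)

lemma poly_mapping_sum_single:
  "p = (\<Sum>m\<in>keys p. Poly_Mapping.single m (lookup p m))" for p :: "'a \<Rightarrow>\<^sub>0 'b :: comm_monoid_add"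
  by (rule poly_mapping_eqI)
    (auto simp: lookup_sum lookup_single when_def sum.delta in_keys_iff)

text \<open>Reduces statements about products to single monomials, where weights add and
  coefficients multiply.\<close>

lemma mult_sum_single:
  fixes p q :: int_mpoly
  shows "p * q = (\<Sum>m\<in>keys p. \<Sum>m'\<in>keys q. Poly_Mapping.single (m + m') (lookup p m * lookup q m'))"
proof -
  have "p * q = (\<Sum>m\<in>keys p. Poly_Mapping.single m (lookup p m)) *
      (\<Sum>m'\<in>keys q. Poly_Mapping.single m' (lookup q m'))"
    using poly_mapping_sum_single[of p] poly_mapping_sum_single[of q] by metis
  then show ?thesis by (simp add: sum_product mult_single)
qed

lemma eval_mult: "eval a b (p * q) = eval a b p * eval a b q"
proof -
  have "eval a b (p * q) = (\<Sum>m\<in>keys p. \<Sum>m'\<in>keys q.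
      (of_int (lookup p m) * a ^ weight b m) * (of_int (lookup q m') * a ^ weight b m'))"
    by (subst mult_sum_single) (simp add: eval_sum eval_single weight_add power_add algebra_simps)
  then show ?thesis by (simp add: eval_def sum_product)
qed

lemma coeff_norm_mult: "coeff_norm (p * q) \<le> coeff_norm p * coeff_norm q"
proof -
  have "coeff_norm (p * q) \<le> (\<Sum>m\<in>keys p. coeff_norm
      (\<Sum>m'\<in>keys q. Poly_Mapping.single (m + m') (lookup p m * lookup q m')))"
    by (subst mult_sum_single) (rule coeff_norm_sum)
  also have "\<dots> \<le> (\<Sum>m\<in>keys p. \<Sum>m'\<in>keys q. \<bar>lookup p m * lookup q m'\<bar>)"
    by (intro sum_mono order.trans[OF coeff_norm_sum]) simp
  also have "\<dots> = coeff_norm p * coeff_norm q"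
    by (simp add: coeff_norm_def sum_product abs_mult)
  finally show ?thesis .
qed

lemma exponents_le_add: "exponents_le d p \<Longrightarrow> exponents_le d q \<Longrightarrow> exponents_le d (p + q)"
  using keys_add[of p q] unfolding exponents_le_def by blast

lemma exponents_le_mult:
  "exponents_le d p \<Longrightarrow> exponents_le e q \<Longrightarrow> exponents_le (d + e) (p * q)"
  using keys_mult[of p q] unfolding exponents_le_def by (fastforce simp: lookup_add intro: add_mono)

lemma exponents_le_mono: "exponents_le d p \<Longrightarrow> d \<le> e \<Longrightarrow> exponents_le e p"
  unfolding exponents_le_def by (meson order.trans)

lemma of_int_poly_mapping: "(of_int c :: int_mpoly) = Poly_Mapping.single 0 c"
proof -
  have "Poly_Mapping.single 0 (of_int c :: int) = (of_int c :: int_mpoly)" by (rule single_of_int)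
  then show ?thesis unfolding of_int_eq_id id_apply by (rule sym)
qed

lemma eval_of_int [simp]: "eval a b (of_int c) = of_int c"
  by (simp add: of_int_poly_mapping eval_single)

lemma eval_var [simp]: "eval a b (mpoly_var i) = a ^ (b ^ (i + 1))"
  by (simp add: mpoly_var_def eval_single weight_single)

section \<open>Injectivity of the substitution on monomials and the leading term\<close>

lemma digits_unique:
  fixes f g :: "nat \<Rightarrow> nat"
  assumes "\<And>i. f i < b" "\<And>i. g i < b"
    and "(\<Sum>i<n. f i * b ^ i) = (\<Sum>i<n. g i * b ^ i)" "i < n"
  shows "f i = g i"
  using assms
proof (induction n arbitrary: f g i)
  case (Suc n)
  have split: "(\<Sum>i<Suc n. h i * b ^ i) = h 0 + b * (\<Sum>i<n. h (Suc i) * b ^ i)" for h :: "nat \<Rightarrow> nat"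
    by (subst sum.lessThan_Suc_shift) (simp add: sum_distrib_left algebra_simps)
  have b: "0 < b" using Suc.prems(1)[of 0] by simp
  let ?F = "\<Sum>i<n. f (Suc i) * b ^ i" and ?G = "\<Sum>i<n. g (Suc i) * b ^ i"
  have eq: "f 0 + b * ?F = g 0 + b * ?G" using Suc.prems(3) unfolding split .
  \<comment> \<open>Reduction modulo \<open>b\<close> isolates the lowest digit; afterwards the
    factor \<open>b\<close> cancels and the higher digits remain.\<close>
  have 0: "f 0 = g 0"
    using arg_cong[OF eq, of "\<lambda>x. x mod b"] Suc.prems(1,2) by simp
  with eq b have "?F = ?G" by simp
  from Suc.IH[OF _ _ this] Suc.prems 0 show ?case by (cases i) auto
qed simp

lemma weight_inject:
  assumes "\<forall>i. lookup m i < b" "\<forall>i. lookup m' i < b" "weight b m = weight b m'"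
  shows "m = m'"
proof (rule poly_mapping_eqI)
  fix i
  \<comment> \<open>An index beyond all variables of both monomials and beyond \<open>i\<close>, so
    that both weights become digit sums of the same length, padded with zeros.\<close>
  let ?n = "Suc (Max (insert i (keys m \<union> keys m')))"
  have "keys m \<subseteq> {..<?n}" "keys m' \<subseteq> {..<?n}" by (auto simp: less_Suc_eq_le)
  then have w: "weight b x = b * (\<Sum>i<?n. lookup x i * b ^ i)" if "x = m \<or> x = m'" for x
    using that by (auto simp: weight_superset[where A = "{..<?n}"] sum_distrib_left algebra_simps)
  have "0 < b" using assms(1) by (metis gr0I not_less0)
  then have eq: "(\<Sum>i<?n. lookup m i * b ^ i) = (\<Sum>i<?n. lookup m' i * b ^ i)"
    using assms(3) w[of m] w[of m'] by simp
  have "i < ?n" by (simp add: less_Suc_eq_le)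
  from digits_unique[OF _ _ eq this] assms(1,2) show "lookup m i = lookup m' i" by blast
qed

lemma dvd_weight: "b dvd weight b m"
  unfolding weight_def by (intro dvd_sum) simp

text \<open>
  The weights of different monomials differ by at least \<open>b\<close>, so the monomial of largest weight
  dominates the sum of all the others.
\<close>

lemma eval_nonzero:
  fixes a :: real
  assumes a: "2 \<le> a" and p: "p \<noteq> 0" "exponents_le d p" "d < b" "coeff_norm p \<le> 2 ^ d"
  shows "eval a b p \<noteq> 0"
proof -
  let ?W = "weight b ` keys p"
  have "Max ?W \<in> ?W" using p(1) by (intro Max_in) auto
  then obtain m where m: "m \<in> keys p" "weight b m = Max ?W" by auto
  have inj: "inj_on (weight b) (keys p)"
    using p(2,3) unfolding exponents_le_def by (intro inj_onI weight_inject) (auto intro: le_less_trans)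
  have less: "weight b m' + b \<le> weight b m" if "m' \<in> keys p - {m}" for m'
  proof -
    have "weight b m' \<le> weight b m" using that m(2) by simp
    moreover have "weight b m' \<noteq> weight b m" using inj that m(1) by (auto dest: inj_onD)
    ultimately have "weight b m' < weight b m" by simp
    moreover obtain u v where "weight b m' = b * u" "weight b m = b * v"
      using dvd_weight by (metis dvdE)
    ultimately show ?thesis by (metis Suc_leI add.commute mult_Suc_right mult_le_mono2 mult_less_cancel1)
  qed
  define R where "R = (\<Sum>m'\<in>keys p - {m}. of_int (lookup p m') * a ^ weight b m')"
  have ev: "eval a b p = of_int (lookup p m) * a ^ weight b m + R"
    unfolding eval_def R_def using m(1) by (simp add: sum.remove)
  show ?thesis
  proof (cases "keys p = {m}")
    case True
    then have "R = 0" by (simp add: R_def)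
    with ev a m(1) show ?thesis by (simp add: in_keys_iff)
  next
    case False
    \<comment> \<open>A second monomial forces the largest weight to be at least \<open>b\<close>.
      Without one, the truncated difference \<open>weight b m - b\<close> used below could not be
      turned back into \<open>weight b m\<close>.\<close>
    then obtain m1 where "m1 \<in> keys p - {m}" using m(1) by auto
    from less[OF this] have bw: "b \<le> weight b m" by simp
    have "\<bar>R\<bar> \<le> (\<Sum>m'\<in>keys p - {m}. of_int \<bar>lookup p m'\<bar> * a ^ (weight b m - b))"
      unfolding R_def
    proof (rule order.trans[OF sum_abs sum_mono])
      fix m' assume "m' \<in> keys p - {m}"
      from less[OF this] have "a ^ weight b m' \<le> a ^ (weight b m - b)"
        using a by (intro power_increasing) auto
      then show "\<bar>of_int (lookup p m') * a ^ weight b m'\<bar> \<le> of_int \<bar>lookup p m'\<bar> * a ^ (weight b m - b)"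
        using a by (simp add: abs_mult mult_left_mono)
    qed
    also have "\<dots> = of_int (\<Sum>m'\<in>keys p - {m}. \<bar>lookup p m'\<bar>) * a ^ (weight b m - b)"
      by (simp add: sum_distrib_right)
    also have "\<dots> < 2 ^ d * a ^ (weight b m - b)"
    proof -
      \<comment> \<open>The leading coefficient uses up at least 1 of the norm, so the remaining
        coefficients stay strictly below \<open>2 ^ d\<close>. This strictness carries through to
        the conclusion.\<close>
      have "coeff_norm p = \<bar>lookup p m\<bar> + (\<Sum>m'\<in>keys p - {m}. \<bar>lookup p m'\<bar>)"
        unfolding coeff_norm_def using m(1) by (simp add: sum.remove)
      moreover have "\<bar>lookup p m\<bar> > 0" using m(1) by (simp add: in_keys_iff)
      ultimately have "(\<Sum>m'\<in>keys p - {m}. \<bar>lookup p m'\<bar>) < 2 ^ d" using p(4) by linarith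
      then have "real_of_int (\<Sum>m'\<in>keys p - {m}. \<bar>lookup p m'\<bar>) < of_int (2 ^ d)"
        by (rule of_int_less_iff[THEN iffD2])
      then show ?thesis using a by (intro mult_strict_right_mono) auto
    qed
    also have "\<dots> \<le> a ^ b * a ^ (weight b m - b)"
    proof -
      have "(2::real) ^ d \<le> 2 ^ b" using p(3) by simp
      also have "\<dots> \<le> a ^ b" using a by (intro power_mono) auto
      finally show ?thesis using a by (intro mult_right_mono) auto
    qed
    also have "\<dots> = a ^ weight b m" using bw by (simp flip: power_add)
    also have "\<dots> \<le> \<bar>of_int (lookup p m) * a ^ weight b m\<bar>"
    proof -
      have "1 \<le> \<bar>lookup p m\<bar>" using m(1) by (simp add: in_keys_iff)
      then have "(1::real) \<le> \<bar>of_int (lookup p m)\<bar>" by linarith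
      then show ?thesis using a by (simp add: abs_mult)
    qed
    finally show ?thesis unfolding ev by linarith
  qed
qed

text \<open>Let \<open>c A\<close> be the number of gates that \<open>A\<close> depends on, itself
  included. An addition at most doubles the larger of the two norms. In a skew product one factor is
  an input, of norm at most 1 and with exponents at most 1, so the norm does not grow and the
  exponents rise by at most 1. Hence the norm is at most \<open>2 ^ c A\<close> and the exponents
  are at most \<open>c A\<close>.\<close>

lemma skew_gate_bounds:
  assumes K: "arithmetic_circuit K" "skew K" and "gate_value K A p"
  shows "coeff_norm p \<le> 2 ^ length (gates K) \<and> exponents_le (length (gates K)) p"
proof -
  let ?n = "length (gates K)"
  let ?R = "{(B, A). A < ?n \<and> B \<in> gate_refs (gates K ! A)}"
  \<comment> \<open>Gates need not be listed in topological order, so the number of gates below a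
    gate takes the place of its position.\<close>
  let ?D = "\<lambda>A. {B. (B, A) \<in> ?R\<^sup>*}"
  have D_sub: "?D A \<subseteq> {..<?n}" if "A < ?n" for A
  proof
    fix B assume "B \<in> ?D A"
    then have "(B, A) \<in> ?R\<^sup>*" by simp
    then show "B \<in> {..<?n}"
    proof (cases rule: converse_rtranclE)
      case (step C)
      then have "C < ?n" "B \<in> gate_refs (gates K ! C)" by auto
      then show ?thesis using K(1) nth_mem[of C "gates K"] unfolding arithmetic_circuit_def by blast
    qed (use that in simp)
  qed
  have D_less: "card (?D B) < card (?D A)" if "A < ?n" "B \<in> gate_refs (gates K ! A)" for A B
  proof (rule psubset_card_mono)
    show "finite (?D A)" using D_sub[OF that(1)] finite_subset by blast
    have e: "(B, A) \<in> ?R" using that by simp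
    then have "?D B \<subseteq> ?D A" by (auto intro: rtrancl_into_rtrancl)
    moreover have "A \<notin> ?D B"
    proof
      assume "A \<in> ?D B"
      with e have "(A, A) \<in> ?R\<^sup>+" by (auto intro: rtrancl_into_trancl1)
      with K(1) show False unfolding arithmetic_circuit_def acyclic_def by blast
    qed
    ultimately show "?D B \<subset> ?D A" by blast
  qed
  have D_pos: "1 \<le> card (?D A)" if "A < ?n" for A
  proof -
    have "finite (?D A)" using D_sub[OF that] finite_subset by blast
    from card_mono[OF this, of "{A}"] show ?thesis by simp
  qed
  \<comment> \<open>Only three properties of this count are retained: it grows strictly along
    references, is positive, and is at most the number of gates.\<close>
  obtain c :: "nat \<Rightarrow> nat" where c_less: "A < ?n \<Longrightarrow> B \<in> gate_refs (gates K ! A) \<Longrightarrow> c B < c A"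
    and c_pos: "A < ?n \<Longrightarrow> 1 \<le> c A" and c_le: "A < ?n \<Longrightarrow> c A \<le> ?n" for A B
  proof (rule that[of "\<lambda>A. card (?D A)"])
    show "card (?D A) \<le> ?n" if "A < ?n" for A using card_mono[OF _ D_sub[OF that]] by simp
  qed (rule D_less D_pos; assumption)+
  have small: "coeff_norm q \<le> 1 \<and> exponents_le 1 q" if "gate_value K B q" "is_input_gate (gates K ! B)" for B q
    using that
  proof (cases rule: gate_value.cases)
    case (1 i)
    then show ?thesis by (simp add: mpoly_var_def exponents_le_def lookup_single when_def)
  next
    case (2 c)
    then have "c \<in> {-1, 0, 1}" using K(1) nth_mem unfolding arithmetic_circuit_def by metis
    then show ?thesis using 2 by (auto simp: of_int_poly_mapping exponents_le_def)
  qed auto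
  have "coeff_norm p \<le> 2 ^ c A \<and> exponents_le (c A) p \<and> A < ?n"
    using assms(3)
  proof (induction rule: gate_value.induct)
    case (1 A i)
    then have "gate_value K A (mpoly_var i)" by (rule gate_value.intros)
    from small[OF this] 1(2) have "coeff_norm (mpoly_var i) \<le> 1" "exponents_le 1 (mpoly_var i)" by auto
    moreover have "(1::int) \<le> 2 ^ c A" by (rule one_le_power) simp
    ultimately show ?case using exponents_le_mono[OF _ c_pos[OF 1(1)]] 1(1) by (meson order.trans)
  next
    case (2 A z)
    then have "gate_value K A (of_int z)" by (rule gate_value.intros)
    from small[OF this] 2(2) have "coeff_norm (of_int z) \<le> 1" "exponents_le 1 (of_int z)" by auto
    moreover have "(1::int) \<le> 2 ^ c A" by (rule one_le_power) simp
    ultimately show ?case using exponents_le_mono[OF _ c_pos[OF 2(1)]] 2(1) by (meson order.trans)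
  next
    case (3 A B C p q)
    let ?k = "c A - 1"
    have k: "c B \<le> ?k" "c C \<le> ?k" "c A = Suc ?k"
      using c_less[of A B] c_less[of A C] 3(1,2) by auto
    have IH: "coeff_norm p \<le> 2 ^ c B" "coeff_norm q \<le> 2 ^ c C"
      "exponents_le (c B) p" "exponents_le (c C) q"
      using "3.IH" by blast+
    have pq: "coeff_norm p \<le> 2 ^ ?k" "coeff_norm q \<le> 2 ^ ?k"
      by (rule order.trans[OF IH(1) power_increasing[OF k(1)]] order.trans[OF IH(2) power_increasing[OF k(2)]]; simp)+
    then have "coeff_norm (p + q) \<le> 2 ^ Suc ?k" using coeff_norm_add[of p q] by simp
    moreover have "exponents_le (Suc ?k) (p + q)"
      using exponents_le_mono[OF IH(3)] exponents_le_mono[OF IH(4)] k(1,2)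
      by (intro exponents_le_add) simp_all
    ultimately show ?case using 3(1) unfolding k(3)[symmetric] by blast
  next
    case (4 A B C p q)
    let ?k = "c A - 1"
    have k: "c B \<le> ?k" "c C \<le> ?k" "c A = Suc ?k"
      using c_less[of A B] c_less[of A C] 4(1,2) by auto
    have IH: "coeff_norm p \<le> 2 ^ c B" "coeff_norm q \<le> 2 ^ c C"
      "exponents_le (c B) p" "exponents_le (c C) q"
      using "4.IH" by blast+
    have pq: "coeff_norm p \<le> 2 ^ ?k" "coeff_norm q \<le> 2 ^ ?k"
      by (rule order.trans[OF IH(1) power_increasing[OF k(1)]] order.trans[OF IH(2) power_increasing[OF k(2)]]; simp)+
    have epq: "exponents_le ?k p" "exponents_le ?k q"
      using exponents_le_mono[OF IH(3) k(1)] exponents_le_mono[OF IH(4) k(2)] by simp_all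
    have "is_input_gate (gates K ! B) \<or> is_input_gate (gates K ! C)"
      using K(2) 4(1,2) nth_mem unfolding skew_def by metis
    then have "coeff_norm p * coeff_norm q \<le> 2 ^ ?k \<and> exponents_le (Suc ?k) (p * q)"
    proof
      assume "is_input_gate (gates K ! B)"
      from small[OF 4(3) this] have "coeff_norm p \<le> 1" "exponents_le 1 p" by auto
      then show ?thesis
        using mult_mono[of "coeff_norm p" 1 "coeff_norm q" "2 ^ ?k"] pq coeff_norm_nonneg[of q]
          exponents_le_mult[of 1 p ?k q] epq by simp
    next
      assume "is_input_gate (gates K ! C)"
      from small[OF 4(4) this] have "coeff_norm q \<le> 1" "exponents_le 1 q" by auto
      then show ?thesis
        using mult_mono[of "coeff_norm p" "2 ^ ?k" "coeff_norm q" 1] pq coeff_norm_nonneg[of q]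
          exponents_le_mult[of ?k p 1 q] epq by simp
    qed
    moreover have "(2::int) ^ ?k \<le> 2 ^ Suc ?k" by simp
    ultimately have "coeff_norm (p * q) \<le> 2 ^ Suc ?k" "exponents_le (Suc ?k) (p * q)"
      using coeff_norm_mult[of p q] by linarith+
    then show ?case using 4(1) unfolding k(3)[symmetric] by blast
  qed
  then have b: "coeff_norm p \<le> 2 ^ c A" "exponents_le (c A) p" "A < ?n" by blast+
  note le = c_le[OF b(3)]
  have "(2::int) ^ c A \<le> 2 ^ ?n" using le by (rule power_increasing) simp
  with b(1) exponents_le_mono[OF b(2) le] show ?thesis by linarith
qed

lemma eval_circuit_value_eq_0_iff:
  fixes a :: real
  assumes "2 \<le> a" "arithmetic_circuit K" "skew K" "length (gates K) < b"
  shows "eval a b (circuit_value K) = 0 \<longleftrightarrow> circuit_value K = 0"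
  using eval_nonzero[OF assms(1)] skew_gate_bounds[OF assms(2,3) gate_value_circuit_value[OF assms(2)]] assms(4)
  by auto

section \<open>Matrices\<close>

definition unipotent :: "real \<Rightarrow> real^2^2" where
  "unipotent x = vector [vector [1, x], vector [0, 1]]"

definition scaling :: "real \<Rightarrow> real^2^2" where
  "scaling x = vector [vector [x, 0], vector [0, 1]]"

lemma scaling_mult: "scaling x ** scaling y = scaling (x * y)"
  by (simp add: scaling_def matrix_matrix_mult_def vec_eq_iff forall_2 sum_2)

lemma unipotent_mult: "unipotent x ** unipotent y = unipotent (x + y)"
  by (simp add: unipotent_def matrix_matrix_mult_def vec_eq_iff forall_2 sum_2 add.commute)

lemma unipotent_conjugate: "x * y = 1 \<Longrightarrow> scaling x ** unipotent v ** scaling y = unipotent (x * v)"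
  by (simp add: unipotent_def scaling_def matrix_matrix_mult_def vec_eq_iff forall_2 sum_2)

lemma unipotent_0: "unipotent 0 = mat 1"
  by (simp add: unipotent_def mat_def vec_eq_iff forall_2)

lemma scaling_1: "scaling 1 = mat 1"
  by (simp add: scaling_def mat_def vec_eq_iff forall_2)

lemma unipotent_eq_1_iff: "unipotent x = mat 1 \<longleftrightarrow> x = 0"
  by (simp add: unipotent_def mat_def vec_eq_iff forall_2)

lemma group_GL2: "group GL2"
proof (rule groupI)
  fix A assume "A \<in> carrier GL2"
  then show "\<exists>B\<in>carrier GL2. B \<otimes>\<^bsub>GL2\<^esub> A = \<one>\<^bsub>GL2\<^esub>"
    unfolding GL2_def by (simp add: invertible_def) blast
next
  show "\<one>\<^bsub>GL2\<^esub> \<in> carrier GL2" unfolding GL2_def invertible_def by auto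
qed (auto simp: GL2_def invertible_mult matrix_mul_assoc)

lemma mult_G_group: "A \<otimes>\<^bsub>G_group a\<^esub> B = A ** B"
  by (simp add: G_group_def GL2_def)

lemma one_G_group: "\<one>\<^bsub>G_group a\<^esub> = mat 1"
  by (simp add: G_group_def GL2_def)

text \<open>The inverse in the generated subgroup is given only abstractly. Multiplying its equation
  \<open>A ** inv A = mat 1\<close> by \<open>B\<close> from the left identifies it with the matrix
  inverse.\<close>

lemma inv_G_group:
  assumes "A \<in> {g_mat a, h_mat}" "A ** B = mat 1" "B ** A = mat 1"
  shows "inv\<^bsub>G_group a\<^esub> A = B"
proof -
  interpret group GL2 by (rule group_GL2)
  \<comment> \<open>A generated subgroup intersects its generating set with the carrier, so
    invertibility comes before membership.\<close>
  have "A \<in> carrier GL2" using assms(2,3) unfolding GL2_def invertible_def by auto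
  with assms(1) have A: "A \<in> carrier (G_group a)"
    unfolding G_group_def carrier_subgroup_generated by (blast intro: generate.incl)
  have "group (G_group a)" unfolding G_group_def by simp
  then have "A \<otimes>\<^bsub>G_group a\<^esub> inv\<^bsub>G_group a\<^esub> A = \<one>\<^bsub>G_group a\<^esub>" using A by (rule group.r_inv)
  then have "A ** inv\<^bsub>G_group a\<^esub> A = mat 1" by (simp only: mult_G_group one_G_group)
  then have "B ** (A ** inv\<^bsub>G_group a\<^esub> A) = B" by simp
  then show ?thesis by (simp add: matrix_mul_assoc assms(3))
qed

lemma letter_values:
  assumes "a \<noteq> 0"
  shows "letter_value a G = scaling a" "letter_value a G_inv = scaling (1 / a)"
    "letter_value a H = unipotent 1" "letter_value a H_inv = unipotent (-1)"
proof -
  have gh: "g_mat a = scaling a" "h_mat = unipotent 1"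
    by (simp_all add: g_mat_def scaling_def h_mat_def unipotent_def)
  then show "letter_value a G = scaling a" "letter_value a H = unipotent 1" by simp_all
  show "letter_value a G_inv = scaling (1 / a)"
    using inv_G_group[of "scaling a" a "scaling (1 / a)"] assms gh by (simp add: scaling_mult scaling_1)
  show "letter_value a H_inv = unipotent (-1)"
    using inv_G_group[of h_mat a "unipotent (-1)"] by (simp add: gh unipotent_mult unipotent_0)
qed

lemma word_value_append: "word_value a (u @ v) = word_value a u ** word_value a v"
  by (induction u) (simp_all add: word_value_def mult_G_group one_G_group matrix_mul_assoc)

lemma word_value_single: "word_value a [l] = letter_value a l"
  by (simp add: word_value_def mult_G_group one_G_group)

section \<open>Correctness of the reduction\<close>

fun gate_code :: "gate \<Rightarrow> nat \<times> nat \<times> nat" where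
  "gate_code (Var i) = (0, i, 0)"
| "gate_code (Const c) = (1, nat (c + 1), 0)"
| "gate_code (Add B C) = (2, B, C)"
| "gate_code (Mul B C) = (3, B, C)"

lemma encode_nats_Cons: "encode_nats (n # ns) = replicate n True @ False # encode_nats ns"
  by (simp add: encode_nats_def)

lemma encode_nats_Nil [simp]: "encode_nats [] = []"
  by (simp add: encode_nats_def)

lemma read_num_encode_nats: "read_num (encode_nats (n # ns)) = (n, encode_nats ns)"
  unfolding encode_nats_Cons by (induction n) auto

lemma read_gate_encode_nats:
  "read_gate (encode_nats (encode_gate g @ ns)) = (gate_code g, encode_nats ns)"
  by (cases g) (simp_all add: read_gate_def read_num_encode_nats)

lemma fetch_gate_encode_circuit:
  "fetch_gate (encode_circuit K) j = (if j < length (gates K) then gate_code (gates K ! j) else (0, 0, 0))"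
proof -
  have empty: "read_gate [] = ((0, 0, 0), [])" by (simp add: read_gate_def)
  have iter_Nil: "((snd \<circ> read_gate) ^^ j) [] = []" for j
    by (induction j) (simp_all add: empty)
  note iter_Nil = this[unfolded o_def]
  have "fst (read_gate (((snd \<circ> read_gate) ^^ j) (encode_nats (concat (map encode_gate gs))))) =
      (if j < length gs then gate_code (gs ! j) else (0, 0, 0))" for gs
  proof (induction gs arbitrary: j)
    case Nil
    then show ?case using iter_Nil empty by (simp add: o_def)
  next
    case (Cons g gs)
    then show ?case
      by (cases j) (simp_all add: read_gate_encode_nats funpow_Suc_right del: funpow.simps(2))
  qed
  then show ?thesis
    by (simp add: fetch_gate_def encode_circuit_def read_num_encode_nats)
qed

lemma length_encode_nats: "length (encode_nats ns) = sum_list ns + length ns"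
  by (induction ns) (simp_all add: encode_nats_Cons)

text \<open>A number \<open>n\<close> takes \<open>n + 1\<close> letters. Each gate contributes at
  least one number, and the name of the output gate one more, whence strictness. A variable index
  occurs in unary and is therefore shorter than the word; together these facts justify the choice of
  \<open>N\<close>.\<close>

lemma length_encode_circuit:
  "length (gates K) < length (encode_circuit K)"
  "Var i \<in> set (gates K) \<Longrightarrow> i < length (encode_circuit K)"
proof -
  let ?ns = "concat (map encode_gate (gates K))"
  have "length (encode_gate g) \<ge> 1" for g by (cases g) auto
  then have "length (gates K) \<le> length ?ns"
  proof (induction "gates K" arbitrary: K)
    case (Cons g gs)
    \<comment> \<open>Only the list of gates matters in this induction, so the output gate of the
      auxiliary circuit is arbitrary.\<close>
    from Cons.hyps(1)[of "Circuit gs 0"] Cons.prems have "length gs \<le> length (concat (map encode_gate gs))"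
      by simp
    moreover have "1 \<le> length (encode_gate g)" by (rule Cons.prems)
    ultimately show ?case using Cons.hyps(2)[symmetric] by simp
  qed simp
  then show "length (gates K) < length (encode_circuit K)"
    by (simp add: encode_circuit_def length_encode_nats)
  assume "Var i \<in> set (gates K)"
  then have "i \<in> set ?ns" by force
  then have "i \<le> sum_list ?ns" by (simp add: member_le_sum_list)
  then show "i < length (encode_circuit K)"
    by (simp add: encode_circuit_def length_encode_nats)
qed

lemma nth_concat_blocks:
  assumes "\<And>j. length (f j) = m" "i < n" "k < m"
  shows "concat (map f [0..<n]) ! (m * i + k) = f i ! k"
  using assms(2)
proof (induction n)
  case (Suc n)
  have len: "length (concat (map f [0..<n])) = m * n"
    by (simp add: length_concat o_def assms(1) sum_list_triv)
  show ?case
  proof (cases "i = n")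
    case True
    then show ?thesis by (simp add: nth_append len)
  next
    case False
    then have "i < n" using Suc.prems by simp
    then have "m * i + k < m * n" using assms(3)
      by (metis add.commute add_less_cancel_left le_eq_less_or_eq less_le_trans mult_Suc_right mult_le_mono2 Suc_leI)
    with Suc.IH \<open>i < n\<close> show ?thesis by (simp add: nth_append len)
  qed
qed simp

lemma length_block: "length (block w j) = 9"
  by (simp add: block_def sandwich_def split: prod.splits)

lemma length_rules_reduction: "length (rules (reduction w)) = 9 * num_blocks w"
  by (simp add: reduction_def length_concat o_def length_block sum_list_triv)

lemma nth_rules_reduction:
  "j < num_blocks w \<Longrightarrow> k < 9 \<Longrightarrow> rules (reduction w) ! (9 * j + k) = block w j ! k"
  by (simp add: reduction_def nth_concat_blocks length_block)

text \<open>The existence of a derivation is part of the notion: the computation of the values then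
  also shows that the variables are derivable, which later yields acyclicity.\<close>

definition has_value :: "real \<Rightarrow> slp \<Rightarrow> nat \<Rightarrow> real^2^2 \<Rightarrow> bool" where
  "has_value a S A X \<longleftrightarrow> (\<exists>u. derives S A u \<and> word_value a u = X)"

lemma has_value_Letter:
  "A < length (rules S) \<Longrightarrow> rules S ! A = Letter l \<Longrightarrow> has_value a S A (letter_value a l)"
  unfolding has_value_def by (intro exI[of _ "[l]"] conjI derives.intros(1) word_value_single)

lemma has_value_Concat:
  assumes "A < length (rules S)" "rules S ! A = Concat B C" "has_value a S B X" "has_value a S C Y"
  shows "has_value a S A (X ** Y)"
proof -
  obtain u v where "derives S B u" "word_value a u = X" "derives S C v" "word_value a v = Y"
    using assms(3,4) unfolding has_value_def by blast
  then have "derives S A (u @ v)" "word_value a (u @ v) = X ** Y"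
    using derives.intros(2)[OF assms(1,2)] by (simp_all add: word_value_append)
  then show ?thesis unfolding has_value_def by (intro exI[of _ "u @ v"] conjI)
qed

section \<open>Acyclicity from derivability\<close>

lemma derives_less: "derives S A u \<Longrightarrow> A < length (rules S)"
  by (erule derives.cases) simp_all

lemma derives_refs: "derives S A u \<Longrightarrow> B \<in> slp_refs (rules S ! A) \<Longrightarrow> \<exists>v. derives S B v"
  by (erule derives.cases) auto

text \<open>A derivation is a finite tree whose subtrees are derivations of the referenced
  variables, so no infinite descent starts from a derivable variable.\<close>

lemma derives_acc:
  assumes R: "\<And>A B. (B, A) \<in> R \<Longrightarrow> B \<in> slp_refs (rules S ! A)" and "derives S A u"
  shows "A \<in> Wellfounded.acc R"
  using assms(2)
proof (induction rule: derives.induct)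
  case (1 A l)
  then have none: "(B, A) \<notin> R" for B using R[of B A] by auto
  show ?case by (rule accI) (simp add: none)
next
  case (2 A B C u v)
  show ?case
  proof (rule accI)
    fix D assume "(D, A) \<in> R"
    then have "D = B \<or> D = C" using 2(2) R[of D A] by simp
    then show "D \<in> Wellfounded.acc R" using "2.IH" by blast
  qed
qed

lemma slp_refs_less:
  assumes "\<exists>u. derives S A u" "B \<in> slp_refs (rules S ! A)"
  shows "B < length (rules S)"
  using assms derives_refs derives_less by blast

text \<open>A derivation cannot run through a cycle, so it is enough that every variable derives a
  word. This replaces a topological order of the rules, in which squarings, gates in arbitrary
  positions and blocks past the last gate would have to be interleaved.\<close>

lemma straight_line_programI:
  assumes total: "\<And>A. A < length (rules S) \<Longrightarrow> \<exists>u. derives S A u" and start: "start_var S < length (rules S)"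
  shows "straight_line_program S"
proof -
  define R where "R = {(B, A). A < length (rules S) \<and> B \<in> slp_refs (rules S ! A)}"
  have "A \<in> Wellfounded.acc R" for A
  proof (cases "A < length (rules S)")
    case True
    then obtain u where "derives S A u" using total by blast
    then show ?thesis by (rule derives_acc[rotated]) (simp add: R_def)
  next
    case False
    then have none: "(B, A) \<notin> R" for B by (simp add: R_def)
    show ?thesis by (rule accI) (simp add: none)
  qed
  then have "wf R" by (intro acc_wfI allI)
  then have "acyclic R" by (rule wf_acyclic)
  moreover have "\<forall>r \<in> set (rules S). slp_refs r \<subseteq> {..<length (rules S)}"
    using slp_refs_less[OF total] by (fastforce simp: in_set_conv_nth)
  ultimately show ?thesis using start unfolding straight_line_program_def R_def by (intro conjI)
qed

lemma has_value_derived_word: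
  assumes "straight_line_program S" "has_value a S (start_var S) X"
  shows "word_value a (derived_word S) = X"
  using assms derives_derived_word derives_unique unfolding has_value_def by blast

section \<open>Unique decoding of straight-line programs\<close>

lemma encode_nats_inject: "encode_nats ms = encode_nats ns \<longleftrightarrow> ms = ns"
proof
  show "encode_nats ms = encode_nats ns \<Longrightarrow> ms = ns"
  proof (induction ms arbitrary: ns)
    case Nil
    then show ?case by (cases ns) (simp_all add: encode_nats_Cons)
  next
    case (Cons m ms)
    then obtain n ns' where ns: "ns = n # ns'" by (cases ns) (auto simp: encode_nats_Cons)
    have "read_num (encode_nats (m # ms)) = read_num (encode_nats (n # ns'))" using Cons.prems ns by simp
    with Cons.IH ns show ?case by (simp add: read_num_encode_nats)
  qed
qed simp

lemma letter_code_inject: "letter_code l = letter_code l' \<longleftrightarrow> l = l'"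
  by (cases l; cases l') simp_all

lemma concat_encode_rhs_inject:
  "concat (map encode_rhs rs) = concat (map encode_rhs ss) \<longleftrightarrow> rs = ss"
proof
  show "concat (map encode_rhs rs) = concat (map encode_rhs ss) \<Longrightarrow> rs = ss"
  proof (induction rs arbitrary: ss)
    case Nil
    then show ?case by (cases ss) (auto elim: encode_rhs.elims)
  next
    case (Cons r rs)
    then obtain s ss' where ss: "ss = s # ss'" by (cases ss; cases r) auto
    with Cons show ?case by (cases r; cases s) (auto simp: letter_code_inject)
  qed
qed simp

text \<open>Membership in the yes instances only says that some program with this code has a trivial
  value. Injectivity identifies it with the constructed program.\<close>

lemma encode_slp_inject: "encode_slp S = encode_slp S' \<longleftrightarrow> S = S'"
  by (cases S; cases S') (auto simp: encode_slp_def encode_nats_inject concat_encode_rhs_inject)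

section \<open>The program built from a fixed skew circuit\<close>

context
  fixes a :: real and K :: circuit and w :: "bool list" and N b :: nat and S :: slp
  assumes a: "2 \<le> a" and K: "arithmetic_circuit K" "skew K" and w: "w = encode_circuit K"
  defines "N \<equiv> length w" and "b \<equiv> 2 ^ length w" and "S \<equiv> reduction w"
begin

abbreviation val :: "nat \<Rightarrow> real^2^2 \<Rightarrow> bool" where
  "val \<equiv> has_value a S"

lemma gates_less: "length (gates K) < N"
  unfolding N_def w by (rule length_encode_circuit)

lemma bound_blocks: "i < N \<Longrightarrow> (i + 1) * N < num_blocks w" "i < N \<Longrightarrow> i < num_blocks w"
proof -
  have "num_blocks w = (N + 1) * N" by (simp add: num_blocks_def N_def)
  moreover assume "i < N"
  moreover from this have "(i + 1) * N < (N + 1) * N" by (intro mult_strict_right_mono) auto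
  moreover have "N \<le> (N + 1) * N" by simp
  ultimately show "(i + 1) * N < num_blocks w" "i < num_blocks w" by linarith+
qed

lemma val_Letter:
  "j < num_blocks w \<Longrightarrow> k < 9 \<Longrightarrow> block w j ! k = Letter l \<Longrightarrow> val (9 * j + k) (letter_value a l)"
  unfolding S_def by (rule has_value_Letter) (simp_all add: length_rules_reduction nth_rules_reduction)

lemma val_Concat:
  "j < num_blocks w \<Longrightarrow> k < 9 \<Longrightarrow> block w j ! k = Concat B C \<Longrightarrow> val B X \<Longrightarrow> val C Y \<Longrightarrow>
    val (9 * j + k) (X ** Y)"
  unfolding S_def by (rule has_value_Concat) (simp_all add: length_rules_reduction nth_rules_reduction)

lemma block_nth:
  "block w 0 ! 0 = Letter G" "block w 0 ! 1 = Letter G_inv"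
  "block w (Suc j) ! 0 = Concat (9 * j + 0) (9 * j + 0)" "block w (Suc j) ! 1 = Concat (9 * j + 1) (9 * j + 1)"
  "block w j ! 2 = Letter H" "block w j ! 3 = Letter H_inv" "block w j ! 4 = Concat 2 3"
  "gate_args w j = (l, p, r, l', p', r') \<Longrightarrow> block w j ! 5 = Concat l p"
  "gate_args w j = (l, p, r, l', p', r') \<Longrightarrow> block w j ! 6 = Concat (9 * j + 5) r"
  "gate_args w j = (l, p, r, l', p', r') \<Longrightarrow> block w j ! 7 = Concat l' p'"
  "gate_args w j = (l, p, r, l', p', r') \<Longrightarrow> block w j ! 8 = Concat (9 * j + 7) r'"
  by (auto simp: block_def sandwich_def numeral_eq_Suc)

lemma a0: "a \<noteq> 0"
  using a by simp

lemma val_power: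
  "k < num_blocks w \<Longrightarrow> val (9 * k) (scaling (a ^ 2 ^ k)) \<and> val (9 * k + 1) (scaling (1 / a ^ 2 ^ k))"
proof (induction k)
  case 0
  then show ?case
    using val_Letter[OF 0 _ block_nth(1)] val_Letter[OF 0 _ block_nth(2)] letter_values[OF a0] by simp
next
  case (Suc k)
  then have IH: "val (9 * k + 0) (scaling (a ^ 2 ^ k))" "val (9 * k + 1) (scaling (1 / a ^ 2 ^ k))" by simp_all
  have "a ^ 2 ^ Suc k = a ^ 2 ^ k * a ^ 2 ^ k" by (simp add: mult_2 power_add)
  then show ?case
    using val_Concat[OF Suc.prems _ block_nth(3) IH(1) IH(1)] val_Concat[OF Suc.prems _ block_nth(4) IH(2) IH(2)]
    by (simp add: scaling_mult)
qed

lemma val_h: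
  assumes "j < num_blocks w"
  shows "val (9 * j + 2) (unipotent 1)" "val (9 * j + 3) (unipotent (-1))" "val (9 * j + 4) (unipotent 0)"
proof -
  have h: "val (9 * j + 2) (unipotent 1) \<and> val (9 * j + 3) (unipotent (-1))" if "j < num_blocks w" for j
    using val_Letter[OF that _ block_nth(5)] val_Letter[OF that _ block_nth(6)] letter_values[OF a0] by simp
  then show "val (9 * j + 2) (unipotent 1)" "val (9 * j + 3) (unipotent (-1))" using assms by blast+
  have "0 < num_blocks w" using assms by simp
  from h[OF this] have "val 2 (unipotent 1)" "val 3 (unipotent (-1))" by (simp_all add: numeral_2_eq_2)
  from val_Concat[OF assms _ block_nth(7) this] show "val (9 * j + 4) (unipotent 0)"
    by (simp add: unipotent_mult)
qed

lemma val_trivial: "val 2 (unipotent 1)" "val 3 (unipotent (-1))" "val 4 (unipotent 0)"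
proof -
  have "0 < num_blocks w" using bound_blocks(2)[of 0] gates_less by simp
  from val_h[OF this] show "val 2 (unipotent 1)" "val 3 (unipotent (-1))" "val 4 (unipotent 0)"
    by (simp_all add: numeral_2_eq_2)
qed

text \<open>For the intermediate rules 5 and 7 just the existence of a value is recorded; it serves
  to show that these rules derive a word.\<close>

definition gate_val :: "nat \<Rightarrow> real \<Rightarrow> bool" where
  "gate_val j v \<longleftrightarrow> (\<exists>X. val (9 * j + 5) X) \<and> val (9 * j + 6) (unipotent v) \<and>
     (\<exists>X. val (9 * j + 7) X) \<and> val (9 * j + 8) (unipotent (- v))"

lemma val_sandwich:
  assumes "j < num_blocks w" "gate_args w j = (l, p, r, l', p', r')"
    and "val l L" "val p P" "val r R" "val l' L'" "val p' P'" "val r' R'"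
    and "L ** P ** R = unipotent v" "L' ** P' ** R' = unipotent (- v)"
  shows "gate_val j v"
proof -
  have 1: "val (9 * j + 5) (L ** P)" using val_Concat[OF assms(1) _ block_nth(8)[OF assms(2)] assms(3,4)] by simp
  have 2: "val (9 * j + 6) (unipotent v)"
    using val_Concat[OF assms(1) _ block_nth(9)[OF assms(2)] 1 assms(5)] assms(9) by simp
  have 3: "val (9 * j + 7) (L' ** P')" using val_Concat[OF assms(1) _ block_nth(10)[OF assms(2)] assms(6,7)] by simp
  have 4: "val (9 * j + 8) (unipotent (- v))"
    using val_Concat[OF assms(1) _ block_nth(11)[OF assms(2)] 3 assms(8)] assms(10) by simp
  from 1 2 3 4 show ?thesis unfolding gate_val_def by blast
qed

lemma unipotent_mult_1 [simp]: "unipotent 0 ** X = X" "X ** unipotent 0 = X"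
  by (simp_all add: unipotent_0)

lemma gate_val_var:
  assumes "j < num_blocks w" "gate_args w j = input_times N 0 i p q" "i < N"
    and "val p (unipotent v)" "val q (unipotent (- v))"
  shows "gate_val j (eval a b (mpoly_var i) * v)"
proof -
  let ?k = "(i + 1) * N"
  have k: "val (9 * ?k) (scaling (a ^ 2 ^ ?k))" "val (9 * ?k + 1) (scaling (1 / a ^ 2 ^ ?k))"
    using val_power bound_blocks(1)[OF assms(3)] by blast+
  have args: "gate_args w j = (9 * ?k, p, 9 * ?k + 1, 9 * ?k, q, 9 * ?k + 1)"
    using assms(2) by (simp add: input_times_def Let_def)
  \<comment> \<open>Since \<open>b = 2 ^ N\<close>, the power of \<open>g\<close> that belongs to
    the variable with index \<open>i\<close> is found in block \<open>(i + 1) * N\<close> of the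
    iterated squarings.\<close>
  have "2 ^ ?k = b ^ (i + 1)" unfolding b_def N_def[symmetric] by (metis mult.commute power_mult)
  then have ev: "eval a b (mpoly_var i) = a ^ 2 ^ ?k" by (simp only: eval_var)
  have inv: "a ^ 2 ^ ?k * (1 / a ^ 2 ^ ?k) = 1" using a0 by simp
  show ?thesis unfolding ev
    by (rule val_sandwich[OF assms(1) args k(1) assms(4) k(2) k(1) assms(5) k(2)])
      (simp_all only: unipotent_conjugate[OF inv] mult_minus_right)
qed

lemma gate_val_const:
  assumes "j < num_blocks w" "gate_args w j = input_times N 1 (nat (c + 1)) p q" "c \<in> {-1, 0, 1}"
    and "val p (unipotent v)" "val q (unipotent (- v))"
  shows "gate_val j (of_int c * v)"
proof -
  note s = val_sandwich[OF assms(1)]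
  note z = val_trivial(3)
  from assms(3) consider "c = -1" | "c = 0" | "c = 1" by blast
  then show ?thesis
  proof cases
    case 1
    then have "gate_args w j = (4, q, 4, 4, p, 4)" using assms(2) by (simp add: input_times_def)
    from s[OF this z assms(5) z z assms(4) z] 1 show ?thesis by simp
  next
    case 2
    then have "gate_args w j = (4, 4, 4, 4, 4, 4)" using assms(2) by (simp add: input_times_def)
    from s[OF this z z z z z z] 2 show ?thesis by simp
  next
    case 3
    then have "gate_args w j = (4, p, 4, 4, q, 4)" using assms(2) by (simp add: input_times_def)
    from s[OF this z assms(4) z z assms(5) z] 3 show ?thesis by simp
  qed
qed

lemma fetch: "fetch_gate w j = (if j < length (gates K) then gate_code (gates K ! j) else (0, 0, 0))"
  unfolding w by (rule fetch_gate_encode_circuit)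

lemma const_gate: "j < length (gates K) \<Longrightarrow> gates K ! j = Const c \<Longrightarrow> c \<in> {-1, 0, 1}"
  using K(1) nth_mem unfolding arithmetic_circuit_def by metis

lemma var_gate: "j < length (gates K) \<Longrightarrow> gates K ! j = Var i \<Longrightarrow> i < N"
  using length_encode_circuit(2)[of i K] nth_mem unfolding N_def w by metis

lemma gate_val_input_times:
  assumes j: "j < num_blocks w" and args: "gate_args w j = input_times N (fst (gate_code (gates K ! A))) (fst (snd (gate_code (gates K ! A)))) p q"
    and A: "A < length (gates K)" "is_input_gate (gates K ! A)" "gate_value K A f"
    and v: "val p (unipotent v)" "val q (unipotent (- v))"
  shows "gate_val j (eval a b f * v)"
  using A(3)
proof (cases rule: gate_value.cases)
  case (1 i)
  with args have "gate_args w j = input_times N 0 i p q" by simp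
  with gate_val_var[OF j this var_gate[OF A(1)] v] 1 show ?thesis by simp
next
  case (2 c)
  with args have "gate_args w j = input_times N 1 (nat (c + 1)) p q" by simp
  with gate_val_const[OF j this const_gate[OF A(1)] v] 2 show ?thesis by simp
qed (use A(2) in auto)

text \<open>The induction follows the evaluation of the circuit, that is, the dependencies between
  gates and not their positions in the list.\<close>

lemma gate_val_gate_value: "gate_value K A f \<Longrightarrow> gate_val A (eval a b f)"
proof (induction rule: gate_value.induct)
  case (1 A i)
  have A: "A < num_blocks w" using bound_blocks(2) gates_less 1(1) by simp
  have "gate_args w A = input_times N (fst (gate_code (gates K ! A))) (fst (snd (gate_code (gates K ! A)))) 2 3"
    using 1 by (simp add: gate_args_def fetch N_def split: prod.splits)
  from gate_val_input_times[OF A this 1(1) _ gate_value.intros(1)[OF 1] val_trivial(1,2)] 1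
  show ?case by simp
next
  case (2 A c)
  have A: "A < num_blocks w" using bound_blocks(2) gates_less 2(1) by simp
  have "gate_args w A = input_times N (fst (gate_code (gates K ! A))) (fst (snd (gate_code (gates K ! A)))) 2 3"
    using 2 by (simp add: gate_args_def fetch N_def split: prod.splits)
  from gate_val_input_times[OF A this 2(1) _ gate_value.intros(2)[OF 2] val_trivial(1,2)] 2
  show ?case by simp
next
  case (3 A B C f g)
  have A: "A < num_blocks w" using bound_blocks(2) gates_less 3(1) by simp
  have args: "gate_args w A = (4, 9 * B + 6, 9 * C + 6, 4, 9 * B + 8, 9 * C + 8)"
    using 3(1,2) by (simp add: gate_args_def fetch split: prod.splits)
  have v: "val (9 * B + 6) (unipotent (eval a b f))" "val (9 * B + 8) (unipotent (- eval a b f))"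
    "val (9 * C + 6) (unipotent (eval a b g))" "val (9 * C + 8) (unipotent (- eval a b g))"
    using "3.IH" unfolding gate_val_def by blast+
  show ?case
    by (rule val_sandwich[OF A args val_trivial(3) v(1,3) val_trivial(3) v(2,4)])
      (simp_all add: unipotent_mult eval_add)
next
  case (4 A B C f g)
  have A: "A < num_blocks w" using bound_blocks(2) gates_less 4(1) by simp
  have len: "B < length (gates K)" "C < length (gates K)"
    using K(1) nth_mem[OF 4(1)] 4(2) unfolding arithmetic_circuit_def by force+
  have v: "val (9 * B + 6) (unipotent (eval a b f))" "val (9 * B + 8) (unipotent (- eval a b f))"
    "val (9 * C + 6) (unipotent (eval a b g))" "val (9 * C + 8) (unipotent (- eval a b g))"
    using "4.IH" unfolding gate_val_def by blast+
  have in_iff: "is_input_gate x \<longleftrightarrow> fst (gate_code x) < 2" for x by (cases x) auto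
  \<comment> \<open>The left factor is tested first. If both factors are inputs, the left one acts
    by multiplication; only if it is not an input does skewness supply the right one.\<close>
  have args: "gate_args w A =
      (if is_input_gate (gates K ! B)
       then input_times N (fst (gate_code (gates K ! B))) (fst (snd (gate_code (gates K ! B)))) (9 * C + 6) (9 * C + 8)
       else input_times N (fst (gate_code (gates K ! C))) (fst (snd (gate_code (gates K ! C)))) (9 * B + 6) (9 * B + 8))"
    using 4(1,2) len by (simp add: gate_args_def fetch N_def in_iff split: prod.splits)
  show ?case
  proof (cases "is_input_gate (gates K ! B)")
    case True
    with args gate_val_input_times[OF A _ len(1) True 4(3) v(3,4)] show ?thesis by (simp add: eval_mult)
  next
    case False
    then have C: "is_input_gate (gates K ! C)" using K(2) 4(1,2) nth_mem unfolding skew_def by metis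
    from False args gate_val_input_times[OF A _ len(2) C 4(4) v(1,2)] show ?thesis
      by (simp add: eval_mult mult.commute)
  qed
qed

text \<open>Blocks past the last gate decode to \<open>Var 0\<close>, and the power for this
  variable is present because \<open>0 < N\<close>. Such blocks must be derivable too, as every
  variable of the program has to be.\<close>

lemma gate_val_exists:
  assumes "j < num_blocks w"
  shows "\<exists>v. gate_val j v"
proof (cases "j < length (gates K)")
  case True
  then show ?thesis using gate_val_gate_value gate_value_exists[OF K(1)] by blast
next
  case False
  then have "gate_args w j = input_times N 0 0 2 3"
    by (simp add: gate_args_def fetch N_def split: prod.splits)
  from gate_val_var[OF assms this _ val_trivial(1,2)] gates_less show ?thesis by auto
qed

lemma slp_reduction: "straight_line_program S"
proof (rule straight_line_programI)
  have len: "length (rules S) = 9 * num_blocks w" unfolding S_def by (rule length_rules_reduction)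
  fix A assume "A < length (rules S)"
  then have j: "A div 9 < num_blocks w" unfolding len by (simp add: less_mult_imp_div_less mult.commute)
  have "\<exists>X. val (9 * (A div 9) + k) X" if "k < 9" for k
  proof -
    have "k = 0 \<or> k = 1 \<or> k = 2 \<or> k = 3 \<or> k = 4 \<or> k = 5 \<or> k = 6 \<or> k = 7 \<or> k = 8"
      using that by linarith
    then show ?thesis
      using val_power[OF j] val_h[OF j] gate_val_exists[OF j] unfolding gate_val_def by auto
  qed
  from this[of "A mod 9"] have "\<exists>X. val A X" by simp
  then show "\<exists>u. derives S A u" unfolding has_value_def S_def by blast
next
  have "start_var S = 9 * output_gate K + 6"
    unfolding S_def by (simp add: reduction_def w encode_circuit_def read_num_encode_nats)
  moreover have "output_gate K < num_blocks w"
    using K(1) gates_less bound_blocks(2)[of "output_gate K"] unfolding arithmetic_circuit_def by simp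
  moreover have "length (rules S) = 9 * num_blocks w" unfolding S_def by (rule length_rules_reduction)
  ultimately show "start_var S < length (rules S)" by simp
qed

lemma word_value_reduction:
  "word_value a (derived_word S) = \<one>\<^bsub>G_group a\<^esub> \<longleftrightarrow> circuit_value K = 0"
proof -
  have start: "start_var S = 9 * output_gate K + 6"
    unfolding S_def by (simp add: reduction_def w encode_circuit_def read_num_encode_nats)
  have "val (start_var S) (unipotent (eval a b (circuit_value K)))"
    using gate_val_gate_value[OF gate_value_circuit_value[OF K(1)]] unfolding start gate_val_def by blast
  from has_value_derived_word[OF slp_reduction[unfolded S_def] this[unfolded S_def]]
  have "word_value a (derived_word S) = unipotent (eval a b (circuit_value K))" unfolding S_def .
  moreover have "length (gates K) < b"
    unfolding b_def N_def[symmetric] using gates_less less_exp[of N] by linarith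
  ultimately show ?thesis
    using eval_circuit_value_eq_0_iff[OF a K] by (simp add: one_G_group unipotent_eq_1_iff)
qed

end

theorem reduction_correct:
  fixes a :: real
  assumes a: "2 \<le> a" and "w \<in> instances skew_PIT"
  shows "encode_slp (reduction w) \<in> instances (compressed_word_problem a)"
    and "w \<in> yes_instances skew_PIT \<longleftrightarrow>
      encode_slp (reduction w) \<in> yes_instances (compressed_word_problem a)"
proof -
  obtain K where K: "arithmetic_circuit K" "skew K" "w = encode_circuit K"
    using assms(2) by (auto simp: skew_PIT_def)
  note slp = slp_reduction[OF a K]
  then show "encode_slp (reduction w) \<in> instances (compressed_word_problem a)"
    by (auto simp: compressed_word_problem_def)
  show "w \<in> yes_instances skew_PIT \<longleftrightarrow>
      encode_slp (reduction w) \<in> yes_instances (compressed_word_problem a)"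
  proof
    assume "w \<in> yes_instances skew_PIT"
    \<comment> \<open>This circuit is not known to be \<open>K\<close>, but the reduction depends
      only on the word. The equivalence is therefore applied to the new circuit, and decoding of
      circuits need not be unique.\<close>
    then obtain K' where K': "arithmetic_circuit K'" "skew K'" "w = encode_circuit K'" "circuit_value K' = 0"
      by (auto simp: skew_PIT_def)
    then have "word_value a (derived_word (reduction w)) = \<one>\<^bsub>G_group a\<^esub>"
      using word_value_reduction[OF a K'(1-3)] by simp
    with slp show "encode_slp (reduction w) \<in> yes_instances (compressed_word_problem a)"
      by (auto simp: compressed_word_problem_def)
  next
    assume "encode_slp (reduction w) \<in> yes_instances (compressed_word_problem a)"
    then have "word_value a (derived_word (reduction w)) = \<one>\<^bsub>G_group a\<^esub>"
      by (auto simp: compressed_word_problem_def encode_slp_inject)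
    then have "circuit_value K = 0" using word_value_reduction[OF a K] by simp
    with K show "w \<in> yes_instances skew_PIT" by (auto simp: skew_PIT_def)
  qed
qed

section \<open>The transducer of the reduction\<close>

text \<open>\<open>RZero\<close>, \<open>ROne\<close> and \<open>RTwo\<close> hold constants because
  a register can be compared only with another register. \<open>RPrev\<close> follows one behind
  \<open>RCur\<close> because there is no command for decrementing.\<close>

datatype reg =
    RZero | ROne | RTwo | RLen | RBlocks | RCur | RPrev
  | RTag | RX | RY | RTag1 | RX1 | RY1 | RTag2 | RX2 | RY2 | RPow | RCnt | RCnt2

definition all_regs :: "reg list" where
  "all_regs = [RZero, ROne, RTwo, RLen, RBlocks, RCur, RPrev,
     RTag, RX, RY, RTag1, RX1, RY1, RTag2, RX2, RY2, RPow, RCnt, RCnt2]"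

lemma set_all_regs: "set all_regs = UNIV"
proof (rule UNIV_eq_I[symmetric])
  show "x \<in> set all_regs" for x by (cases x) (simp_all add: all_regs_def)
qed

text \<open>A pair \<open>(r, k)\<close> stands for rule \<open>k\<close> of the block whose number is in register \<open>r\<close>.\<close>

definition name :: "(reg \<Rightarrow> nat) \<Rightarrow> reg \<times> nat \<Rightarrow> nat" where
  "name \<rho> n = 9 * \<rho> (fst n) + snd n"

definition encode_rules :: "slp_rhs list \<Rightarrow> bool list" where
  "encode_rules rs = encode_nats (concat (map encode_rhs rs))"

definition emit_name :: "reg \<times> nat \<Rightarrow> reg com" where
  "emit_name n = for_upto RCnt (fst n) (emit_bits (replicate 9 True)) ;;
     emit_bits (replicate (snd n) True @ [False])"

definition emit_concat :: "reg \<times> nat \<Rightarrow> reg \<times> nat \<Rightarrow> reg com" where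
  "emit_concat m n = emit_bits [True, False] ;; emit_name m ;; emit_name n"

definition emit_sandwich ::
    "reg \<times> nat \<Rightarrow> reg \<times> nat \<Rightarrow> reg \<times> nat \<Rightarrow> reg \<times> nat \<Rightarrow> reg \<times> nat \<Rightarrow> reg \<times> nat \<Rightarrow> reg com" where
  "emit_sandwich l p r l' p' r' =
     emit_concat l p ;; emit_concat (RCur, 5) r ;; emit_concat l' p' ;; emit_concat (RCur, 7) r'"

definition add_len :: "reg \<Rightarrow> reg com" where
  "add_len d = for_upto RCnt RLen (increment d)"

text \<open>The copy of the length added ahead of the loop accounts for the \<open>+ 1\<close> in
  \<open>(i + 1) * N\<close>. The nested loops need the two counters \<open>RCnt\<close> and
  \<open>RCnt2\<close>.\<close>

definition mul_len :: "reg \<Rightarrow> reg \<Rightarrow> reg com" where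
  "mul_len d i = reset d ;; add_len d ;; for_upto RCnt2 i (add_len d)"

definition emit_input_times :: "reg \<Rightarrow> reg \<Rightarrow> reg \<times> nat \<Rightarrow> reg \<times> nat \<Rightarrow> reg com" where
  "emit_input_times t x m n =
     if_eq t RZero
       (mul_len RPow x ;; emit_sandwich (RPow, 0) m (RPow, 1) (RPow, 0) n (RPow, 1))
       (if_eq x RZero (emit_sandwich (RZero, 4) n (RZero, 4) (RZero, 4) m (RZero, 4))
         (if_eq x ROne (emit_sandwich (RZero, 4) (RZero, 4) (RZero, 4) (RZero, 4) (RZero, 4) (RZero, 4))
           (emit_sandwich (RZero, 4) m (RZero, 4) (RZero, 4) n (RZero, 4))))"

definition read_gate_com :: "reg \<Rightarrow> reg \<Rightarrow> reg \<Rightarrow> reg com" where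
  "read_gate_com t x y = read_num_com t ;; read_num_com x ;; reset y ;;
     if_eq t RZero Skip (if_eq t ROne Skip (read_num_com y))"

definition fetch_gate_com :: "reg \<Rightarrow> reg \<Rightarrow> reg \<Rightarrow> reg \<Rightarrow> reg com" where
  "fetch_gate_com j t x y =
     rewind ;; read_num_com t ;; for_upto RCnt j (read_gate_com t x y) ;; read_gate_com t x y"

definition emit_gate :: "reg com" where
  "emit_gate =
     (let input = emit_input_times RTag RX (RZero, 2) (RZero, 3);
          left_input = emit_input_times RTag1 RX1 (RY, 6) (RY, 8);
          right_input = emit_input_times RTag2 RX2 (RX, 6) (RX, 8)
      in if_eq RTag RZero input (if_eq RTag ROne input
        (if_eq RTag RTwo (emit_sandwich (RZero, 4) (RX, 6) (RY, 6) (RZero, 4) (RX, 8) (RY, 8))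
          (if_eq RTag1 RZero left_input (if_eq RTag1 ROne left_input right_input)))))"

text \<open>Both arguments are fetched as gates even when they are not gate names. Decoding is
  total, and \<open>gate_args\<close> makes the same lookups.\<close>

definition emit_block :: "reg com" where
  "emit_block =
     if_eq RCur RZero (emit_bits (encode_rules [Letter G, Letter G_inv]))
       (emit_concat (RPrev, 0) (RPrev, 0) ;; emit_concat (RPrev, 1) (RPrev, 1)) ;;
     emit_bits (encode_rules [Letter H, Letter H_inv, Concat 2 3]) ;;
     fetch_gate_com RCur RTag RX RY ;; fetch_gate_com RX RTag1 RX1 RY1 ;;
     fetch_gate_com RY RTag2 RX2 RY2 ;; emit_gate"

text \<open>\<open>RPrev\<close> is not incremented in round 0, so it always contains
  \<open>RCur - 1\<close> in the sense of truncated subtraction.\<close>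

definition reduction_com :: "reg com" where
  "reduction_com =
     increment ROne ;; increment RTwo ;; increment RTwo ;; count_input RLen ;;
     mul_len RBlocks RLen ;; rewind ;; read_num_com RTag ;; emit_name (RTag, 6) ;;
     for_upto RCur RBlocks (emit_block ;; if_eq RCur RZero Skip (increment RPrev))"

lemma wf_reduction_com: "wf_com 4 (init_tapes ;; reduction_com)"
proof -
  have 1 [simp]: "wf_com 4 (emit_name n)" for n by (simp add: emit_name_def)
  have 2 [simp]: "wf_com 4 (emit_concat m n)" for m n by (simp add: emit_concat_def)
  have 3 [simp]: "wf_com 4 (emit_sandwich l p r l' p' r')" for l p r l' p' r'
    by (simp add: emit_sandwich_def)
  have 4 [simp]: "wf_com 4 (mul_len d i)" for d i by (simp add: mul_len_def add_len_def)
  have 5 [simp]: "wf_com 4 (emit_input_times t x m n)" for t x m n by (simp add: emit_input_times_def)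
  have 6 [simp]: "wf_com 4 (read_gate_com t x y)" for t x y by (simp add: read_gate_com_def)
  have 7 [simp]: "wf_com 4 (fetch_gate_com j t x y)" for j t x y by (simp add: fetch_gate_com_def)
  have 8 [simp]: "wf_com 4 emit_gate" by (simp add: emit_gate_def Let_def)
  have 9 [simp]: "wf_com 4 emit_block" by (simp add: emit_block_def)
  show ?thesis by (simp add: reduction_com_def)
qed

section \<open>Decoded numbers are bounded by the input length\<close>

lemma read_gate_length:
  assumes "read_gate xs = ((t, x, y), ys)"
  shows "t \<le> length xs \<and> x \<le> length xs \<and> y \<le> length xs \<and> length ys \<le> length xs"
proof -
  obtain t' xs1 where 1: "read_num xs = (t', xs1)" by (metis prod.exhaust)
  obtain x' xs2 where 2: "read_num xs1 = (x', xs2)" by (metis prod.exhaust)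
  obtain y' xs3 where 3: "read_num xs2 = (y', xs3)" by (metis prod.exhaust)
  show ?thesis
    using assms 1 2 3 read_num_length[OF 1] read_num_length[OF 2] read_num_length[OF 3]
    by (auto simp: read_gate_def split: if_splits)
qed

lemma length_funpow_le:
  fixes f :: "'a list \<Rightarrow> 'a list"
  shows "(\<And>ys. length (f ys) \<le> length ys) \<Longrightarrow> length ((f ^^ j) xs) \<le> length xs"
  by (induction j) (auto intro: order.trans)

text \<open>Unary decoding never yields a number longer than the remaining word, and the remaining
  word never grows. This holds for arbitrary words and keeps all registers polynomially
  bounded.\<close>

lemma fetch_gate_length:
  assumes "fetch_gate w j = (t, x, y)"
  shows "t \<le> length w" "x \<le> length w" "y \<le> length w"
proof -
  have "length ((snd \<circ> read_gate) ys) \<le> length ys" for ys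
    using read_gate_length by (metis comp_apply prod.exhaust snd_conv)
  then have "length (((snd \<circ> read_gate) ^^ j) xs) \<le> length xs" for xs
    by (rule length_funpow_le)
  moreover obtain n xs where "read_num w = (n, xs)" by (metis prod.exhaust)
  moreover from read_num_length[OF this] have "length xs \<le> length w" by simp
  moreover obtain ys where "read_gate (((snd \<circ> read_gate) ^^ j) (snd (read_num w))) = ((t, x, y), ys)"
    using assms unfolding fetch_gate_def by (metis prod.collapse)
  moreover from read_gate_length[OF this] have
    "t \<le> length (((snd \<circ> read_gate) ^^ j) (snd (read_num w)))"
    "x \<le> length (((snd \<circ> read_gate) ^^ j) (snd (read_num w)))"
    "y \<le> length (((snd \<circ> read_gate) ^^ j) (snd (read_num w)))" by simp_all
  ultimately show "t \<le> length w" "x \<le> length w" "y \<le> length w"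
    by (metis order.trans snd_conv)+
qed

lemma encode_rules_append: "encode_rules (rs @ ss) = encode_rules rs @ encode_rules ss"
  by (simp add: encode_rules_def encode_nats_def)

lemma name_upd [simp]: "fst n \<noteq> r \<Longrightarrow> name (\<rho>(r := k)) n = name \<rho> n"
  by (simp add: name_def)

definition scratch :: "reg set" where
  "scratch = {RPow, RCnt, RCnt2}"

definition constants :: "nat \<Rightarrow> (reg \<Rightarrow> nat) \<Rightarrow> bool" where
  "constants N \<rho> \<longleftrightarrow> \<rho> RZero = 0 \<and> \<rho> ROne = 1 \<and> \<rho> RTwo = 2 \<and> \<rho> RLen = N"

section \<open>Correctness of the emitting commands\<close>

context register_machine
begin

text \<open>For loops whose effect has a closed form: the input head rests at \<open>p\<close>, and
  \<open>F i\<close> and \<open>D i\<close> are the registers and the output before round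
  \<open>i\<close>.\<close>

lemma wp_for_upto_const:
  assumes "F 0 = \<rho>(u := 0)" "D 0 = out" "\<And>i. F i u = i" "\<And>i. F i r = n"
    and "\<And>i. i < n \<Longrightarrow>
      wp c (\<lambda>s. \<exists>\<rho>'. s = (p, \<rho>', D (Suc i)) \<and> \<rho>' u = i \<and> \<rho>'(u := Suc i) = F (Suc i)) (p, F i, D i)"
    and "Q (p, F n, D n)"
  shows "wp (for_upto u r c) Q (p, \<rho>, out)"
proof (rule wp_for_upto[where I = "\<lambda>i s. s = (p, F i, D i)" and n = n])
  fix i p' \<rho>' out'
  assume i: "i < n" and s: "(p', \<rho>', out') = (p, F i, D i)"
  show "wp c (\<lambda>(q, \<rho>, out). \<rho> u = i \<and> (q, \<rho>(u := Suc i), out) = (p, F (Suc i), D (Suc i))) (p', \<rho>', out')"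
    unfolding s by (rule wp_mono[OF assms(5)[OF i]]) auto
qed (use assms in auto)

lemma wp_emit_name:
  assumes "fst n \<noteq> RCnt" "\<And>k. Q (p, \<rho>(RCnt := k), out @ replicate (name \<rho> n) True @ [False])"
  shows "wp (emit_name n) Q (p, \<rho>, out)"
  unfolding emit_name_def
proof (rule wp_Seq, rule wp_for_upto_const[where F = "\<lambda>i. \<rho>(RCnt := i)" and n = "\<rho> (fst n)"
      and D = "\<lambda>i. out @ replicate (9 * i) True"])
  fix i
  have "out @ replicate (9 * Suc i) True = (out @ replicate (9 * i) True) @ replicate 9 True"
    by (simp only: append_assoc replicate_add[symmetric] mult_Suc_right add.commute)
  then show "wp (emit_bits (replicate 9 True)) (\<lambda>s. \<exists>\<rho>'. s = (p, \<rho>', out @ replicate (9 * Suc i) True) \<and>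
      \<rho>' RCnt = i \<and> \<rho>'(RCnt := Suc i) = \<rho>(RCnt := Suc i)) (p, \<rho>(RCnt := i), out @ replicate (9 * i) True)"
    by (intro wp_emit_bits exI[of _ "\<rho>(RCnt := i)"]) simp
next
  have "(out @ replicate (9 * \<rho> (fst n)) True) @ replicate (snd n) True @ [False] =
      out @ replicate (name \<rho> n) True @ [False]"
    by (simp add: name_def replicate_add)
  then show "wp (emit_bits (replicate (snd n) True @ [False])) Q
      (p, \<rho>(RCnt := \<rho> (fst n)), out @ replicate (9 * \<rho> (fst n)) True)"
    using assms(2)[of "\<rho> (fst n)"] by (intro wp_emit_bits) (simp only:)
qed (use assms(1) in simp_all)

lemma wp_emit_concat:
  assumes "fst m \<noteq> RCnt" "fst n \<noteq> RCnt"
    and "\<And>k. Q (p, \<rho>(RCnt := k), out @ encode_rules [Concat (name \<rho> m) (name \<rho> n)])"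
  shows "wp (emit_concat m n) Q (p, \<rho>, out)"
  unfolding emit_concat_def
proof (intro wp_Seq wp_emit_bits wp_emit_name)
  fix k k'
  have "((out @ [True, False]) @ replicate (name \<rho> m) True @ [False]) @
      replicate (name (\<rho>(RCnt := k)) n) True @ [False] = out @ encode_rules [Concat (name \<rho> m) (name \<rho> n)]"
    using assms(2) by (simp add: encode_rules_def encode_nats_def)
  then show "Q (p, \<rho>(RCnt := k, RCnt := k'), ((out @ [True, False]) @ replicate (name \<rho> m) True @ [False]) @
      replicate (name (\<rho>(RCnt := k)) n) True @ [False])"
    using assms(3)[of k'] by (simp only: fun_upd_upd)
qed (use assms in simp_all)

lemma wp_emit_sandwich:
  assumes regs: "\<forall>n \<in> {l, p, r, l', p', r'}. fst n \<noteq> RCnt"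
    and "\<And>k. Q (pos, \<rho>(RCnt := k), out @ encode_rules (sandwich (\<rho> RCur)
      (name \<rho> l, name \<rho> p, name \<rho> r, name \<rho> l', name \<rho> p', name \<rho> r')))"
  shows "wp (emit_sandwich l p r l' p' r') Q (pos, \<rho>, out)"
  unfolding emit_sandwich_def
proof (intro wp_Seq wp_emit_concat)
  fix k k1 k2 k3
  have "(((out @ encode_rules [Concat (name \<rho> l) (name \<rho> p)]) @
      encode_rules [Concat (name (\<rho>(RCnt := k)) (RCur, 5)) (name (\<rho>(RCnt := k)) r)]) @
      encode_rules [Concat (name (\<rho>(RCnt := k, RCnt := k1)) l') (name (\<rho>(RCnt := k, RCnt := k1)) p')]) @
      encode_rules [Concat (name (\<rho>(RCnt := k, RCnt := k1, RCnt := k2)) (RCur, 7))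
        (name (\<rho>(RCnt := k, RCnt := k1, RCnt := k2)) r')] =
    out @ encode_rules (sandwich (\<rho> RCur)
      (name \<rho> l, name \<rho> p, name \<rho> r, name \<rho> l', name \<rho> p', name \<rho> r'))"
    using regs by (simp add: sandwich_def encode_rules_append[symmetric]) (simp add: name_def)
  then show "Q (pos, \<rho>(RCnt := k, RCnt := k1, RCnt := k2, RCnt := k3),
      (((out @ encode_rules [Concat (name \<rho> l) (name \<rho> p)]) @
      encode_rules [Concat (name (\<rho>(RCnt := k)) (RCur, 5)) (name (\<rho>(RCnt := k)) r)]) @
      encode_rules [Concat (name (\<rho>(RCnt := k, RCnt := k1)) l') (name (\<rho>(RCnt := k, RCnt := k1)) p')]) @
      encode_rules [Concat (name (\<rho>(RCnt := k, RCnt := k1, RCnt := k2)) (RCur, 7))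
        (name (\<rho>(RCnt := k, RCnt := k1, RCnt := k2)) r')])"
    using assms(2)[of k3] by (simp only: fun_upd_upd)
qed (use regs in auto)

lemma wp_add_len:
  assumes d: "d \<noteq> RCnt" "d \<noteq> RLen" and le: "\<rho> d + \<rho> RLen \<le> V"
    and Q: "\<And>k. Q (p, \<rho>(d := \<rho> d + \<rho> RLen, RCnt := k), out)"
  shows "wp (add_len d) Q (p, \<rho>, out)"
  unfolding add_len_def
proof (rule wp_for_upto_const[where F = "\<lambda>i. \<rho>(d := \<rho> d + i, RCnt := i)" and n = "\<rho> RLen" and D = "\<lambda>_. out"])
  fix i assume i: "i < \<rho> RLen"
  let ?F = "\<rho>(d := \<rho> d + i, RCnt := i)"
  have "?F(d := Suc (?F d), RCnt := Suc i) = \<rho>(d := \<rho> d + Suc i, RCnt := Suc i)"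
    using d by (intro ext) simp
  then show "wp (increment d) (\<lambda>s. \<exists>\<rho>'. s = (p, \<rho>', out) \<and> \<rho>' RCnt = i \<and>
      \<rho>'(RCnt := Suc i) = \<rho>(d := \<rho> d + Suc i, RCnt := Suc i)) (p, ?F, out)"
    using d le i by (intro wp_increment exI[of _ "?F(d := Suc (?F d))"] conjI) simp_all
next
  show "\<rho>(d := \<rho> d + 0, RCnt := 0) = \<rho>(RCnt := 0)" by (intro ext) simp
qed (use d Q in simp_all)

lemma wp_mul_len:
  assumes d: "d \<noteq> RCnt" "d \<noteq> RCnt2" "d \<noteq> RLen" and i: "i \<noteq> RCnt" "i \<noteq> RCnt2" "i \<noteq> d"
    and le: "(\<rho> i + 1) * \<rho> RLen \<le> V"
    and Q: "\<And>k k'. Q (p, \<rho>(d := (\<rho> i + 1) * \<rho> RLen, RCnt := k, RCnt2 := k'), out)"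
  shows "wp (mul_len d i) Q (p, \<rho>, out)"
  unfolding mul_len_def
proof (rule wp_Seq, rule wp_reset, rule wp_Seq, rule wp_add_len)
  fix k
  let ?L = "\<rho> RLen"
  let ?\<rho> = "\<rho>(d := 0)"
  let ?I = "\<lambda>j s. \<exists>k. s = (p, \<rho>(d := (j + 1) * ?L, RCnt := k, RCnt2 := j), out)"
  show "wp (for_upto RCnt2 i (add_len d)) Q (p, ?\<rho>(d := ?\<rho> d + ?\<rho> RLen, RCnt := k), out)"
  proof (rule wp_for_upto[where I = ?I and n = "\<rho> i"])
    have "?\<rho>(d := ?\<rho> d + ?\<rho> RLen, RCnt := k, RCnt2 := 0) = \<rho>(d := (0 + 1) * ?L, RCnt := k, RCnt2 := 0)"
      using d by (intro ext) simp
    then show "?I 0 (p, ?\<rho>(d := ?\<rho> d + ?\<rho> RLen, RCnt := k, RCnt2 := 0), out)" by metis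
  next
    fix j p' \<rho>' out' assume "?I j (p', \<rho>', out')"
    then show "\<rho>' RCnt2 = j \<and> \<rho>' i = \<rho> i" using i by auto
  next
    fix j p' \<rho>' out' assume j: "j < \<rho> i" and "?I j (p', \<rho>', out')"
    then obtain k where s: "p' = p" "out' = out" and \<rho>': "\<rho>' = \<rho>(d := (j + 1) * ?L, RCnt := k, RCnt2 := j)" by blast
    have vals: "\<rho>' d = (j + 1) * ?L" "\<rho>' RLen = ?L" "\<rho>' RCnt2 = j" using d unfolding \<rho>' by simp_all
    have "(Suc j + 1) * ?L \<le> (\<rho> i + 1) * ?L" using j by (intro mult_right_mono) auto
    with le have le': "\<rho>' d + \<rho>' RLen \<le> V" unfolding vals by simp
    have upd: "\<rho>'(d := \<rho>' d + \<rho>' RLen, RCnt := k', RCnt2 := Suc j) =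
        \<rho>(d := (Suc j + 1) * ?L, RCnt := k', RCnt2 := Suc j)" for k'
      unfolding vals using d unfolding \<rho>' by (intro ext) simp
    show "wp (add_len d) (\<lambda>(p, \<rho>, out). \<rho> RCnt2 = j \<and> ?I (Suc j) (p, \<rho>(RCnt2 := Suc j), out)) (p', \<rho>', out')"
    proof (rule wp_add_len[OF d(1,3) le'])
      fix k'
      have "(\<rho>'(d := \<rho>' d + \<rho>' RLen, RCnt := k')) RCnt2 = j" using d vals by simp
      then show "case (p', \<rho>'(d := \<rho>' d + \<rho>' RLen, RCnt := k'), out') of
          (p, \<rho>, out) \<Rightarrow> \<rho> RCnt2 = j \<and> ?I (Suc j) (p, \<rho>(RCnt2 := Suc j), out)"
        unfolding prod.case upd s by blast
    qed
  next
    show "?I (\<rho> i) s \<Longrightarrow> Q s" for s using Q by blast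
  qed
next
  have "1 * \<rho> RLen \<le> (\<rho> i + 1) * \<rho> RLen" by (intro mult_right_mono) auto
  with le show "(\<rho>(d := 0)) d + (\<rho>(d := 0)) RLen \<le> V" using d by simp
qed (use d in simp_all)

text \<open>The final registers are described only outside \<open>scratch\<close>. In this form all
  kinds of input gates share one postcondition, although they leave different values in the
  counters.\<close>

lemma wp_emit_input_times:
  assumes N: "N = length w" "(N + 1) * N \<le> V" and const: "constants N \<rho>" and x: "\<rho> x \<le> N"
    and fresh: "t \<notin> scratch" "x \<notin> scratch" "fst m \<notin> scratch" "fst n \<notin> scratch"
    and Q: "\<And>\<rho>'. \<forall>q. q \<notin> scratch \<longrightarrow> \<rho>' q = \<rho> q \<Longrightarrow>
      Q (p, \<rho>', out @ encode_rules (sandwich (\<rho> RCur) (input_times N (\<rho> t) (\<rho> x) (name \<rho> m) (name \<rho> n))))"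
  shows "wp (emit_input_times t x m n) Q (p, \<rho>, out)"
proof -
  have c: "\<rho> RZero = 0" "\<rho> ROne = 1" "\<rho> RLen = N" using const by (simp_all add: constants_def)
  have fresh': "x \<noteq> RCnt" "x \<noteq> RCnt2" "x \<noteq> RPow" "fst m \<noteq> RCnt" "fst m \<noteq> RCnt2" "fst m \<noteq> RPow"
    "fst n \<noteq> RCnt" "fst n \<noteq> RCnt2" "fst n \<noteq> RPow"
    using fresh by (auto simp: scratch_def)
  have frame: "\<forall>q. q \<notin> scratch \<longrightarrow> (\<rho>(RCnt := k)) q = \<rho> q" for k by (auto simp: scratch_def)
  have four: "name \<rho> (RZero, 4) = 4" using c by (simp add: name_def)
  show ?thesis unfolding emit_input_times_def
  proof (intro wp_if_eq)
    assume t: "\<rho> t = \<rho> RZero"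
    show "wp (mul_len RPow x ;; emit_sandwich (RPow, 0) m (RPow, 1) (RPow, 0) n (RPow, 1)) Q (p, \<rho>, out)"
    proof (rule wp_Seq, rule wp_mul_len)
      \<comment> \<open>The bound uses only that \<open>x\<close> holds a number of at most
        \<open>N\<close>, as every decoded number is; it does not presuppose a valid
        circuit.\<close>
      have "(\<rho> x + 1) * N \<le> (N + 1) * N" using x by (intro mult_right_mono) auto
      with N(2) show "(\<rho> x + 1) * \<rho> RLen \<le> V" unfolding c(3) by linarith
      fix k k'
      let ?\<rho> = "\<rho>(RPow := (\<rho> x + 1) * \<rho> RLen, RCnt := k, RCnt2 := k')"
      show "wp (emit_sandwich (RPow, 0) m (RPow, 1) (RPow, 0) n (RPow, 1)) Q (p, ?\<rho>, out)"
      proof (rule wp_emit_sandwich)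
        fix j
        have eq: "(name ?\<rho> (RPow, 0), name ?\<rho> m, name ?\<rho> (RPow, 1), name ?\<rho> (RPow, 0), name ?\<rho> n, name ?\<rho> (RPow, 1)) =
            input_times N (\<rho> t) (\<rho> x) (name \<rho> m) (name \<rho> n)"
          using t c fresh' by (simp add: input_times_def Let_def) (simp add: name_def)
        have cur: "?\<rho> RCur = \<rho> RCur" by simp
        have fr: "\<forall>q. q \<notin> scratch \<longrightarrow> (?\<rho>(RCnt := j)) q = \<rho> q" by (auto simp: scratch_def)
        show "Q (p, ?\<rho>(RCnt := j), out @ encode_rules (sandwich (?\<rho> RCur)
          (name ?\<rho> (RPow, 0), name ?\<rho> m, name ?\<rho> (RPow, 1), name ?\<rho> (RPow, 0), name ?\<rho> n, name ?\<rho> (RPow, 1))))"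
          unfolding eq cur by (rule Q[OF fr])
      qed (use fresh' in auto)
    qed (use fresh' in auto)
  next
    assume t: "\<rho> t \<noteq> \<rho> RZero" and x: "\<rho> x = \<rho> RZero"
    have eq: "(4, name \<rho> n, 4, 4, name \<rho> m, 4) = input_times N (\<rho> t) (\<rho> x) (name \<rho> m) (name \<rho> n)"
      using t x c by (simp add: input_times_def)
    show "wp (emit_sandwich (RZero, 4) n (RZero, 4) (RZero, 4) m (RZero, 4)) Q (p, \<rho>, out)"
      by (rule wp_emit_sandwich, use fresh' in force, unfold four eq, rule Q[OF frame])
  next
    assume t: "\<rho> t \<noteq> \<rho> RZero" and x: "\<rho> x \<noteq> \<rho> RZero" "\<rho> x = \<rho> ROne"
    have eq: "(4, 4, 4, 4, 4, 4) = input_times N (\<rho> t) (\<rho> x) (name \<rho> m) (name \<rho> n)"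
      using t x c by (simp add: input_times_def)
    show "wp (emit_sandwich (RZero, 4) (RZero, 4) (RZero, 4) (RZero, 4) (RZero, 4) (RZero, 4)) Q (p, \<rho>, out)"
      by (rule wp_emit_sandwich, force, unfold four eq, rule Q[OF frame])
  next
    assume t: "\<rho> t \<noteq> \<rho> RZero" and x: "\<rho> x \<noteq> \<rho> RZero" "\<rho> x \<noteq> \<rho> ROne"
    have eq: "(4, name \<rho> m, 4, 4, name \<rho> n, 4) = input_times N (\<rho> t) (\<rho> x) (name \<rho> m) (name \<rho> n)"
      using t x c by (simp add: input_times_def)
    show "wp (emit_sandwich (RZero, 4) m (RZero, 4) (RZero, 4) n (RZero, 4)) Q (p, \<rho>, out)"
      by (rule wp_emit_sandwich, use fresh' in force, unfold four eq, rule Q[OF frame])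
  qed
qed

lemma wp_read_gate:
  assumes V: "length w \<le> V" and at: "at_suffix p xs" and gate: "read_gate xs = ((tv, xv, yv), ys)"
    and const: "\<rho> RZero = 0" "\<rho> ROne = 1" and regs: "distinct [t, x, y, RZero, ROne]"
    and Q: "\<And>p'. at_suffix p' ys \<Longrightarrow> Q (p', \<rho>(t := tv, x := xv, y := yv), out)"
  shows "wp (read_gate_com t x y) Q (p, \<rho>, out)"
proof -
  obtain t' xs1 where 1: "read_num xs = (t', xs1)" by (metis prod.exhaust)
  obtain x' xs2 where 2: "read_num xs1 = (x', xs2)" by (metis prod.exhaust)
  obtain y' xs3 where 3: "read_num xs2 = (y', xs3)" by (metis prod.exhaust)
  have vals: "tv = t'" "xv = x'" "if t' < 2 then yv = 0 \<and> ys = xs2 else yv = y' \<and> ys = xs3"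
    using gate 1 2 3 by (auto simp: read_gate_def split: if_splits)
  show ?thesis unfolding read_gate_com_def
  proof (rule wp_Seq, rule wp_read_num[OF at V 1], rule wp_Seq, rule wp_read_num[OF _ V 2], assumption,
      rule wp_Seq, rule wp_reset)
    fix p1 p2 assume p2: "at_suffix p2 xs2"
    let ?\<rho> = "\<rho>(t := t', x := x', y := 0)"
    have r: "?\<rho> t = t'" "?\<rho> RZero = 0" "?\<rho> ROne = 1" using regs const by auto
    show "wp (if_eq t RZero Skip (if_eq t ROne Skip (read_num_com y))) Q (p2, ?\<rho>, out)"
    proof (intro wp_if_eq)
      assume "?\<rho> t = ?\<rho> RZero"
      then have "t' < 2" unfolding r by simp
      with vals have v: "tv = t'" "xv = x'" "yv = 0" "ys = xs2" by auto
      show "wp Skip Q (p2, ?\<rho>, out)" using Q[unfolded v, OF p2] by (rule wp_Skip)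
    next
      assume "?\<rho> t = ?\<rho> ROne"
      then have "t' < 2" unfolding r by simp
      with vals have v: "tv = t'" "xv = x'" "yv = 0" "ys = xs2" by auto
      show "wp Skip Q (p2, ?\<rho>, out)" using Q[unfolded v, OF p2] by (rule wp_Skip)
    next
      assume "?\<rho> t \<noteq> ?\<rho> RZero" "?\<rho> t \<noteq> ?\<rho> ROne"
      then have "\<not> t' < 2" unfolding r by simp
      with vals have v: "tv = t'" "xv = x'" "yv = y'" "ys = xs3" by auto
      show "wp (read_num_com y) Q (p2, ?\<rho>, out)"
        by (rule wp_read_num[OF p2 V 3], unfold fun_upd_upd, rule Q[unfolded v])
    qed
  qed
qed

text \<open>After \<open>i\<close> rounds the input head is at the code of gate \<open>i\<close>,
  while \<open>t\<close>, \<open>x\<close> and \<open>y\<close> hold leftovers. The initial reading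
  into \<open>t\<close> just skips the name of the output gate in front of the gates; its result is
  overwritten.\<close>

lemma wp_fetch_gate:
  assumes V: "length w \<le> V" and gate: "fetch_gate w (\<rho> j) = (tv, xv, yv)"
    and const: "\<rho> RZero = 0" "\<rho> ROne = 1" and regs: "distinct [t, x, y, RZero, ROne, RCnt]"
    and j: "j \<notin> {t, x, y, RCnt}"
    and Q: "\<And>p' \<rho>'. \<rho>' t = tv \<Longrightarrow> \<rho>' x = xv \<Longrightarrow> \<rho>' y = yv \<Longrightarrow>
      \<forall>q. q \<notin> {t, x, y, RCnt} \<longrightarrow> \<rho>' q = \<rho> q \<Longrightarrow> Q (p', \<rho>', out)"
  shows "wp (fetch_gate_com j t x y) Q (p, \<rho>, out)"
proof -
  obtain n xs where n: "read_num w = (n, xs)" by (metis prod.exhaust)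
  let ?s = "\<lambda>i. ((snd \<circ> read_gate) ^^ i) xs"
  let ?I = "\<lambda>i s. \<exists>p' a b c. s = (p', \<rho>(RCnt := i, t := a, x := b, y := c), out) \<and> at_suffix p' (?s i)"
  have neq: "t \<noteq> RCnt" "x \<noteq> RCnt" "y \<noteq> RCnt" "t \<noteq> x" "t \<noteq> y" "x \<noteq> y"
    "j \<noteq> t" "j \<noteq> x" "j \<noteq> y" "j \<noteq> RCnt"
    using regs j by auto
  have upd: "\<rho>(RCnt := i, t := a, x := b, y := c, t := a', x := b', y := c') = \<rho>(RCnt := i, t := a', x := b', y := c')"
    for i a b c a' b' c' using neq by (intro ext) simp
  have upd_cnt: "\<rho>(RCnt := i, t := a, x := b, y := c, RCnt := i') = \<rho>(RCnt := i', t := a, x := b, y := c)"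
    for i a b c i' using neq by (intro ext) simp
  have cst: "(\<rho>(RCnt := i, t := a, x := b, y := c)) RZero = 0" "(\<rho>(RCnt := i, t := a, x := b, y := c)) ROne = 1"
    for i a b c using const regs by auto
  have regs': "distinct [t, x, y, RZero, ROne]" using regs by simp
  show ?thesis unfolding fetch_gate_com_def
  proof (rule wp_Seq, rule wp_rewind, rule wp_Seq, rule wp_read_num[OF _ V n], assumption, rule wp_Seq)
    fix p1 p2 assume p2: "at_suffix p2 xs"
    show "wp (for_upto RCnt j (read_gate_com t x y)) (wp (read_gate_com t x y) Q) (p2, \<rho>(t := n), out)"
    proof (rule wp_for_upto[where I = ?I and n = "\<rho> j"])
      have "\<rho>(t := n, RCnt := 0) = \<rho>(RCnt := 0, t := n, x := \<rho> x, y := \<rho> y)"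
        using neq by (intro ext) simp
      moreover have "at_suffix p2 (?s 0)" using p2 by simp
      ultimately show "?I 0 (p2, \<rho>(t := n, RCnt := 0), out)" by blast
    next
      fix i p' \<rho>' out' assume "?I i (p', \<rho>', out')"
      then show "\<rho>' RCnt = i \<and> \<rho>' j = \<rho> j" using neq by auto
    next
      fix i p' \<rho>' out' assume "?I i (p', \<rho>', out')"
      then obtain a b c where s: "\<rho>' = \<rho>(RCnt := i, t := a, x := b, y := c)" "out' = out"
        and at: "at_suffix p' (?s i)" by blast
      obtain a' b' c' ys where g: "read_gate (?s i) = ((a', b', c'), ys)" by (metis prod.exhaust)
      have ys: "ys = ?s (Suc i)" using g by (simp only: funpow.simps comp_apply snd_conv)
      show "wp (read_gate_com t x y) (\<lambda>(p, \<rho>, out). \<rho> RCnt = i \<and> ?I (Suc i) (p, \<rho>(RCnt := Suc i), out)) (p', \<rho>', out')"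
        unfolding s
      proof (rule wp_read_gate[OF V at g cst regs'], unfold upd prod.case upd_cnt, intro conjI)
        fix p'' assume "at_suffix p'' ys"
        then show "?I (Suc i) (p'', \<rho>(RCnt := Suc i, t := a', x := b', y := c'), out)" unfolding ys by blast
        show "(\<rho>(RCnt := i, t := a', x := b', y := c')) RCnt = i" using neq by simp
      qed
    next
      fix s assume "?I (\<rho> j) s"
      then obtain p' a b c where s: "s = (p', \<rho>(RCnt := \<rho> j, t := a, x := b, y := c), out)"
        and at: "at_suffix p' (?s (\<rho> j))" by blast
      obtain ys where g: "read_gate (?s (\<rho> j)) = ((tv, xv, yv), ys)"
        using gate n unfolding fetch_gate_def by (metis prod.collapse snd_conv)
      show "wp (read_gate_com t x y) Q s" unfolding s
        by (rule wp_read_gate[OF V at g cst regs'], unfold upd, rule Q) (use neq in auto)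
    qed
  qed
qed

lemma wp_emit_gate:
  assumes V: "(length w + 1) * length w \<le> V" and const: "constants (length w) \<rho>"
    and gate: "fetch_gate w (\<rho> RCur) = (\<rho> RTag, \<rho> RX, \<rho> RY)"
    and left: "fetch_gate w (\<rho> RX) = (\<rho> RTag1, \<rho> RX1, \<rho> RY1)"
    and right: "fetch_gate w (\<rho> RY) = (\<rho> RTag2, \<rho> RX2, \<rho> RY2)"
    and Q: "\<And>\<rho>'. \<forall>q. q \<notin> scratch \<longrightarrow> \<rho>' q = \<rho> q \<Longrightarrow>
      Q (p, \<rho>', out @ encode_rules (sandwich (\<rho> RCur) (gate_args w (\<rho> RCur))))"
  shows "wp emit_gate Q (p, \<rho>, out)"
proof -
  have c: "\<rho> RZero = 0" "\<rho> ROne = 1" "\<rho> RTwo = 2" using const by (simp_all add: constants_def)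
  have x: "\<rho> RX \<le> length w" "\<rho> RX1 \<le> length w" "\<rho> RX2 \<le> length w"
    using fetch_gate_length(2)[OF gate] fetch_gate_length(2)[OF left] fetch_gate_length(2)[OF right] .
  have names: "name \<rho> (RZero, k) = k" "name \<rho> (RX, k) = 9 * \<rho> RX + k" "name \<rho> (RY, k) = 9 * \<rho> RY + k" for k
    using c by (simp_all add: name_def)
  have args: "gate_args w (\<rho> RCur) =
      (if \<rho> RTag < 2 then input_times (length w) (\<rho> RTag) (\<rho> RX) 2 3
       else if \<rho> RTag = 2 then (4, 9 * \<rho> RX + 6, 9 * \<rho> RY + 6, 4, 9 * \<rho> RX + 8, 9 * \<rho> RY + 8)
       else if \<rho> RTag1 < 2 then input_times (length w) (\<rho> RTag1) (\<rho> RX1) (9 * \<rho> RY + 6) (9 * \<rho> RY + 8)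
       else input_times (length w) (\<rho> RTag2) (\<rho> RX2) (9 * \<rho> RX + 6) (9 * \<rho> RX + 8))"
    by (simp add: gate_args_def gate left right)
  have input: "wp (emit_input_times RTag RX (RZero, 2) (RZero, 3)) Q (p, \<rho>, out)" if "\<rho> RTag < 2"
  proof (rule wp_emit_input_times[OF refl V const x(1)], unfold names)
    fix \<rho>' :: "reg \<Rightarrow> nat" assume fr: "\<forall>q. q \<notin> scratch \<longrightarrow> \<rho>' q = \<rho> q"
    have "input_times (length w) (\<rho> RTag) (\<rho> RX) 2 3 = gate_args w (\<rho> RCur)" using that args by simp
    from Q[OF fr, folded this]
    show "Q (p, \<rho>', out @ encode_rules (sandwich (\<rho> RCur) (input_times (length w) (\<rho> RTag) (\<rho> RX) 2 3)))" .
  qed (simp_all add: scratch_def)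
  have left_input: "wp (emit_input_times RTag1 RX1 (RY, 6) (RY, 8)) Q (p, \<rho>, out)"
    if "\<not> \<rho> RTag < 2" "\<rho> RTag \<noteq> 2" "\<rho> RTag1 < 2"
  proof (rule wp_emit_input_times[OF refl V const x(2)], unfold names)
    fix \<rho>' :: "reg \<Rightarrow> nat" assume fr: "\<forall>q. q \<notin> scratch \<longrightarrow> \<rho>' q = \<rho> q"
    have "input_times (length w) (\<rho> RTag1) (\<rho> RX1) (9 * \<rho> RY + 6) (9 * \<rho> RY + 8) = gate_args w (\<rho> RCur)"
      using that args by simp
    from Q[OF fr, folded this] show "Q (p, \<rho>', out @ encode_rules (sandwich (\<rho> RCur)
      (input_times (length w) (\<rho> RTag1) (\<rho> RX1) (9 * \<rho> RY + 6) (9 * \<rho> RY + 8))))" .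
  qed (simp_all add: scratch_def)
  have right_input: "wp (emit_input_times RTag2 RX2 (RX, 6) (RX, 8)) Q (p, \<rho>, out)"
    if "\<not> \<rho> RTag < 2" "\<rho> RTag \<noteq> 2" "\<not> \<rho> RTag1 < 2"
  proof (rule wp_emit_input_times[OF refl V const x(3)], unfold names)
    fix \<rho>' :: "reg \<Rightarrow> nat" assume fr: "\<forall>q. q \<notin> scratch \<longrightarrow> \<rho>' q = \<rho> q"
    have "input_times (length w) (\<rho> RTag2) (\<rho> RX2) (9 * \<rho> RX + 6) (9 * \<rho> RX + 8) = gate_args w (\<rho> RCur)"
      using that args by simp
    from Q[OF fr, folded this] show "Q (p, \<rho>', out @ encode_rules (sandwich (\<rho> RCur)
      (input_times (length w) (\<rho> RTag2) (\<rho> RX2) (9 * \<rho> RX + 6) (9 * \<rho> RX + 8))))" .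
  qed (simp_all add: scratch_def)
  have add: "wp (emit_sandwich (RZero, 4) (RX, 6) (RY, 6) (RZero, 4) (RX, 8) (RY, 8)) Q (p, \<rho>, out)"
    if "\<rho> RTag = 2"
  proof (rule wp_emit_sandwich, force, unfold names)
    fix k
    have fr: "\<forall>q. q \<notin> scratch \<longrightarrow> (\<rho>(RCnt := k)) q = \<rho> q" by (auto simp: scratch_def)
    have "(4, 9 * \<rho> RX + 6, 9 * \<rho> RY + 6, 4, 9 * \<rho> RX + 8, 9 * \<rho> RY + 8) = gate_args w (\<rho> RCur)"
      using that args by simp
    from Q[OF fr, folded this] show "Q (p, \<rho>(RCnt := k), out @ encode_rules (sandwich (\<rho> RCur)
      (4, 9 * \<rho> RX + 6, 9 * \<rho> RY + 6, 4, 9 * \<rho> RX + 8, 9 * \<rho> RY + 8)))" .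
  qed
  show ?thesis unfolding emit_gate_def Let_def
    by (intro wp_if_eq; (rule input | rule add | rule left_input | rule right_input); (use c in linarith))
qed

definition kept :: "reg set" where
  "kept = {RZero, ROne, RTwo, RLen, RBlocks, RCur, RPrev}"

lemma wp_emit_block:
  assumes V: "(length w + 1) * length w \<le> V" "length w \<le> V" and const: "constants (length w) \<rho>"
    and prev: "\<rho> RPrev = \<rho> RCur - 1"
    and Q: "\<And>p' \<rho>'. \<forall>q \<in> kept. \<rho>' q = \<rho> q \<Longrightarrow> Q (p', \<rho>', out @ encode_rules (block w (\<rho> RCur)))"
  shows "wp emit_block Q (p, \<rho>, out)"
proof -
  let ?j = "\<rho> RCur"
  have c: "\<rho> RZero = 0" "\<rho> ROne = 1" using const by (simp_all add: constants_def)
  let ?powers = "if ?j = 0 then [Letter G, Letter G_inv]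
    else [Concat (9 * (?j - 1)) (9 * (?j - 1)), Concat (9 * (?j - 1) + 1) (9 * (?j - 1) + 1)]"
  have powers: "wp (if_eq RCur RZero (emit_bits (encode_rules [Letter G, Letter G_inv]))
       (emit_concat (RPrev, 0) (RPrev, 0) ;; emit_concat (RPrev, 1) (RPrev, 1))) R (p, \<rho>, out)"
    if R: "\<And>k. R (p, \<rho>(RCnt := k), out @ encode_rules ?powers)" for R
  proof (rule wp_if_eq)
    assume "\<rho> RCur = \<rho> RZero"
    then have j: "?j = 0" using c by simp
    from R[of "\<rho> RCnt"] have "R (p, \<rho>, out @ encode_rules [Letter G, Letter G_inv])"
      unfolding fun_upd_triv if_P[OF j] .
    then show "wp (emit_bits (encode_rules [Letter G, Letter G_inv])) R (p, \<rho>, out)" by (rule wp_emit_bits)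
  next
    assume "\<rho> RCur \<noteq> \<rho> RZero"
    then have j: "?j \<noteq> 0" using c by simp
    show "wp (emit_concat (RPrev, 0) (RPrev, 0) ;; emit_concat (RPrev, 1) (RPrev, 1)) R (p, \<rho>, out)"
    proof (rule wp_Seq, rule wp_emit_concat, simp, simp, rule wp_emit_concat, simp, simp)
      fix k k'
      have eq: "(out @ encode_rules [Concat (name \<rho> (RPrev, 0)) (name \<rho> (RPrev, 0))]) @
          encode_rules [Concat (name (\<rho>(RCnt := k)) (RPrev, 1)) (name (\<rho>(RCnt := k)) (RPrev, 1))] =
          out @ encode_rules ?powers"
        using j prev by (simp add: encode_rules_append[symmetric] name_def)
      show "R (p, \<rho>(RCnt := k, RCnt := k'), (out @ encode_rules [Concat (name \<rho> (RPrev, 0)) (name \<rho> (RPrev, 0))]) @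
          encode_rules [Concat (name (\<rho>(RCnt := k)) (RPrev, 1)) (name (\<rho>(RCnt := k)) (RPrev, 1))])"
        unfolding eq fun_upd_upd by (rule R)
    qed
  qed
  obtain t x y where g: "fetch_gate w ?j = (t, x, y)" by (metis prod_cases3)
  obtain t1 x1 y1 where g1: "fetch_gate w x = (t1, x1, y1)" by (metis prod_cases3)
  obtain t2 x2 y2 where g2: "fetch_gate w y = (t2, x2, y2)" by (metis prod_cases3)
  show ?thesis unfolding emit_block_def
  proof (rule wp_Seq, rule powers, rule wp_Seq, rule wp_emit_bits, rule wp_Seq)
    fix k
    let ?o = "(out @ encode_rules ?powers) @ encode_rules [Letter H, Letter H_inv, Concat 2 3]"
    let ?\<rho>0 = "\<rho>(RCnt := k)"
    show "wp (fetch_gate_com RCur RTag RX RY) (wp (fetch_gate_com RX RTag1 RX1 RY1 ;;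
        fetch_gate_com RY RTag2 RX2 RY2 ;; emit_gate) Q) (p, ?\<rho>0, ?o)"
    proof (rule wp_fetch_gate[OF V(2)])
      show "fetch_gate w (?\<rho>0 RCur) = (t, x, y)" using g by simp
      fix p1 \<rho>1
      assume 1: "\<rho>1 RTag = t" "\<rho>1 RX = x" "\<rho>1 RY = y"
        and f1: "\<forall>q. q \<notin> {RTag, RX, RY, RCnt} \<longrightarrow> \<rho>1 q = ?\<rho>0 q"
      have c1: "\<rho>1 RZero = 0" "\<rho>1 ROne = 1" using f1 c by simp_all
      show "wp (fetch_gate_com RX RTag1 RX1 RY1 ;; fetch_gate_com RY RTag2 RX2 RY2 ;; emit_gate) Q (p1, \<rho>1, ?o)"
      proof (rule wp_Seq, rule wp_fetch_gate[OF V(2)])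
        show "fetch_gate w (\<rho>1 RX) = (t1, x1, y1)" unfolding 1 by (rule g1)
        fix p2 \<rho>2
        assume 2: "\<rho>2 RTag1 = t1" "\<rho>2 RX1 = x1" "\<rho>2 RY1 = y1"
          and f2: "\<forall>q. q \<notin> {RTag1, RX1, RY1, RCnt} \<longrightarrow> \<rho>2 q = \<rho>1 q"
        have c2: "\<rho>2 RZero = 0" "\<rho>2 ROne = 1" "\<rho>2 RY = y" using f2 c1 1 by simp_all
        show "wp (fetch_gate_com RY RTag2 RX2 RY2 ;; emit_gate) Q (p2, \<rho>2, ?o)"
        proof (rule wp_Seq, rule wp_fetch_gate[OF V(2)])
          show "fetch_gate w (\<rho>2 RY) = (t2, x2, y2)" unfolding c2 by (rule g2)
          fix p3 \<rho>3
          assume 3: "\<rho>3 RTag2 = t2" "\<rho>3 RX2 = x2" "\<rho>3 RY2 = y2"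
            and f3: "\<forall>q. q \<notin> {RTag2, RX2, RY2, RCnt} \<longrightarrow> \<rho>3 q = \<rho>2 q"
          have keep: "\<rho>3 q = \<rho> q" if "q \<in> kept" for q
          proof -
            have "q \<notin> {RTag2, RX2, RY2, RCnt}" "q \<notin> {RTag1, RX1, RY1, RCnt}" "q \<notin> {RTag, RX, RY, RCnt}"
              using that by (auto simp: kept_def)
            with f1 f2 f3 show ?thesis by simp
          qed
          have vals: "\<rho>3 RCur = ?j" "\<rho>3 RTag = t" "\<rho>3 RX = x" "\<rho>3 RY = y"
            "\<rho>3 RTag1 = t1" "\<rho>3 RX1 = x1" "\<rho>3 RY1 = y1"
            using keep[of RCur] f2 f3 1 2 by (simp_all add: kept_def)
          show "wp emit_gate Q (p3, \<rho>3, ?o)"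
          proof (rule wp_emit_gate[OF V(1)], unfold vals 3)
            show "constants (length w) \<rho>3"
              using const keep by (simp add: constants_def kept_def)
            fix \<rho>' :: "reg \<Rightarrow> nat" assume fr: "\<forall>q. q \<notin> scratch \<longrightarrow> \<rho>' q = \<rho>3 q"
            have "\<forall>q \<in> kept. \<rho>' q = \<rho> q"
            proof
              fix q assume q: "q \<in> kept"
              then have "q \<notin> scratch" by (auto simp: kept_def scratch_def)
              with fr keep[OF q] show "\<rho>' q = \<rho> q" by simp
            qed
            moreover have "?o @ encode_rules (sandwich ?j (gate_args w ?j)) = out @ encode_rules (block w ?j)"
              by (simp only: block_def append_assoc encode_rules_append)
            ultimately show "Q (p3, \<rho>', ?o @ encode_rules (sandwich ?j (gate_args w ?j)))"
              by (simp only: Q)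
          qed (rule g g1 g2)+
        qed (use c2 in simp_all)
      qed (use c1 in simp_all)
    qed (use c in simp_all)
  qed
qed

text \<open>With \<open>N\<close> the input length, \<open>(N + 2) ^ 2\<close> exceeds the number of
  blocks, the largest number that is counted. It is at least 4, so the constants fit even on the
  empty word.\<close>

lemma wp_reduction_com:
  assumes V: "(length w + 2) ^ 2 \<le> V"
  shows "wp reduction_com (\<lambda>(p, \<rho>, out). out = encode_slp (reduction w)) (0, \<lambda>_. 0, [])"
proof -
  let ?N = "length w"
  have le: "(?N + 1) * ?N \<le> V" "?N \<le> V" "2 < V"
  proof -
    have "(?N + 2) ^ 2 = (?N + 1) * ?N + 3 * ?N + 4" by (simp add: power2_eq_square)
    with V show "(?N + 1) * ?N \<le> V" "2 < V" by linarith+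
    have "?N \<le> (?N + 1) * ?N" by simp
    with \<open>(?N + 1) * ?N \<le> V\<close> show "?N \<le> V" by linarith
  qed
  obtain n xs where n: "read_num w = (n, xs)" by (metis prod.exhaust)
  let ?\<rho>0 = "(\<lambda>_. 0 :: nat)(ROne := 1, RTwo := 2, RLen := ?N)"
  let ?start = "9 * n + 6"
  let ?out = "\<lambda>i. encode_nats [?start] @ encode_rules (concat (map (block w) [0..<i]))"
  let ?I = "\<lambda>i (p :: nat, \<rho>, out). constants ?N \<rho> \<and> \<rho> RBlocks = num_blocks w \<and> \<rho> RCur = i \<and>
    \<rho> RPrev = i - 1 \<and> out = ?out i"
  have start: "((\<lambda>_. 0 :: nat)(ROne := Suc ((\<lambda>_. 0) ROne))) = (\<lambda>_. 0)(ROne := 1)" by simp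
  have two: "((\<lambda>_. 0 :: nat)(ROne := 1))(RTwo := Suc (((\<lambda>_. 0)(ROne := 1)) RTwo),
      RTwo := Suc ((((\<lambda>_. 0)(ROne := 1))(RTwo := Suc (((\<lambda>_. 0)(ROne := 1)) RTwo))) RTwo)) =
      (\<lambda>_. 0)(ROne := 1, RTwo := 2)"
    by (intro ext) simp
  have blocks: "wp (for_upto RCur RBlocks (emit_block ;; if_eq RCur RZero Skip (increment RPrev)))
      (\<lambda>(p, \<rho>, out). out = encode_slp (reduction w)) (p, \<rho>, encode_nats [?start])"
    if "constants ?N \<rho>" "\<rho> RBlocks = num_blocks w" "\<rho> RPrev = 0" for p \<rho>
  proof (rule wp_for_upto[where I = ?I and n = "num_blocks w"])
    show "?I 0 (p, \<rho>(RCur := 0), encode_nats [?start])"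
      using that by (simp add: constants_def encode_rules_def encode_nats_def)
  next
    fix i p :: nat and \<rho> out assume "?I i (p, \<rho>, out)"
    then show "\<rho> RCur = i \<and> \<rho> RBlocks = num_blocks w" by simp
  next
    fix i p :: nat and \<rho> out assume i: "i < num_blocks w" and I: "?I i (p, \<rho>, out)"
    then have \<rho>: "constants ?N \<rho>" "\<rho> RBlocks = num_blocks w" "\<rho> RCur = i" "\<rho> RPrev = i - 1" "out = ?out i"
      by simp_all
    let ?Q = "\<lambda>(p :: nat, \<rho>, out). \<rho> RCur = i \<and> ?I (Suc i) (p, \<rho>(RCur := Suc i), out)"
    show "wp (emit_block ;; if_eq RCur RZero Skip (increment RPrev)) ?Q (p, \<rho>, out)"
    proof (rule wp_Seq, rule wp_emit_block[OF le(1,2) \<rho>(1)], unfold \<rho>(3))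
      show "\<rho> RPrev = i - 1" by (rule \<rho>(4))
      fix p' :: nat and \<rho>' :: "reg \<Rightarrow> nat" assume fr: "\<forall>q \<in> kept. \<rho>' q = \<rho> q"
      have \<rho>': "constants ?N \<rho>'" "\<rho>' RBlocks = num_blocks w" "\<rho>' RCur = i" "\<rho>' RPrev = i - 1" "\<rho>' RZero = 0"
        using fr \<rho> by (simp_all add: kept_def constants_def)
      have out: "out @ encode_rules (block w i) = ?out (Suc i)"
        unfolding \<rho>(5) by (simp add: encode_rules_append)
      show "wp (if_eq RCur RZero Skip (increment RPrev)) ?Q (p', \<rho>', out @ encode_rules (block w i))"
        unfolding out
      proof (rule wp_if_eq)
        assume "\<rho>' RCur = \<rho>' RZero"
        then have "i = 0" using \<rho>' by simp
        with \<rho>' have "?Q (p', \<rho>', ?out (Suc i))" by (simp add: constants_def)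
        then show "wp Skip ?Q (p', \<rho>', ?out (Suc i))" by (rule wp_Skip)
      next
        assume "\<rho>' RCur \<noteq> \<rho>' RZero"
        then have "0 < i" using \<rho>' by simp
        with \<rho>' have "?Q (p', \<rho>'(RPrev := Suc (\<rho>' RPrev)), ?out (Suc i))" by (simp add: constants_def)
        moreover have "\<rho>' RPrev < V" using \<rho>'(4) i le(1) by (simp add: num_blocks_def)
        ultimately show "wp (increment RPrev) ?Q (p', \<rho>', ?out (Suc i))" by (intro wp_increment)
      qed
    qed
  next
    fix s assume "?I (num_blocks w) s"
    moreover have "?out (num_blocks w) = encode_slp (reduction w)"
      by (simp add: encode_slp_def reduction_def encode_rules_def encode_nats_def n)
    ultimately show "(\<lambda>(p, \<rho>, out). out = encode_slp (reduction w)) s"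
      by (cases s) simp
  qed
  show ?thesis unfolding reduction_com_def
  proof (rule wp_Seq, rule wp_increment, use le(3) in simp, unfold start, rule wp_Seq, rule wp_increment,
      use le(3) in simp, rule wp_Seq, rule wp_increment, use le(3) in simp, unfold two, rule wp_Seq,
      rule wp_count_input[OF le(2)])
    fix p
    show "wp (mul_len RBlocks RLen ;; rewind ;; read_num_com RTag ;; emit_name (RTag, 6) ;;
        for_upto RCur RBlocks (emit_block ;; if_eq RCur RZero Skip (increment RPrev)))
        (\<lambda>(p, \<rho>, out). out = encode_slp (reduction w)) (p, ?\<rho>0, [])"
    proof (rule wp_Seq, rule wp_mul_len)
      show "(?\<rho>0 RLen + 1) * ?\<rho>0 RLen \<le> V" using le(1) by simp
      fix k k'
      let ?\<rho>1 = "?\<rho>0(RBlocks := (?\<rho>0 RLen + 1) * ?\<rho>0 RLen, RCnt := k, RCnt2 := k')"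
      show "wp (rewind ;; read_num_com RTag ;; emit_name (RTag, 6) ;;
        for_upto RCur RBlocks (emit_block ;; if_eq RCur RZero Skip (increment RPrev)))
        (\<lambda>(p, \<rho>, out). out = encode_slp (reduction w)) (p, ?\<rho>1, [])"
      proof (rule wp_Seq, rule wp_rewind, rule wp_Seq, rule wp_read_num[OF _ le(2) n], assumption,
          rule wp_Seq, rule wp_emit_name, simp)
        fix p2 j
        let ?\<rho>2 = "?\<rho>1(RTag := n)"
        have out: "[] @ replicate (name ?\<rho>2 (RTag, 6)) True @ [False] = encode_nats [?start]"
          by (simp add: name_def encode_nats_def)
        show "wp (for_upto RCur RBlocks (emit_block ;; if_eq RCur RZero Skip (increment RPrev)))
          (\<lambda>(p, \<rho>, out). out = encode_slp (reduction w))
          (p2, ?\<rho>2(RCnt := j), [] @ replicate (name ?\<rho>2 (RTag, 6)) True @ [False])"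
          unfolding out by (rule blocks) (simp_all add: constants_def num_blocks_def)
      qed
    qed simp_all
  qed simp
qed

end

lemma logspace_computable_reduction: "logspace_computable (\<lambda>w. encode_slp (reduction w))"
proof (rule logspace_computable_com[OF set_all_regs wf_reduction_com])
  let ?V = "\<lambda>w :: bool list. (length w + 2) ^ 2"
  \<comment> \<open>The longest representation of a number up to the bound, and one cell more for
    the strict inequality that \<open>register_machine\<close> demands.\<close>
  let ?B = "\<lambda>w. Max ((\<lambda>v. length (bits v)) ` {..?V w}) + 1"
  show "\<exists>p \<tau>. exec w (?B w) (init_tapes ;; reduction_com) (0, \<lambda>_. (\<lambda>_. 0, 0), [])
      (p, \<tau>, encode_slp (reduction w))" for w
  proof -
    interpret register_machine w "?B w" "?V w"
    proof
      fix v assume "v \<le> ?V w"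
      then have "length (bits v) \<le> Max ((\<lambda>v. length (bits v)) ` {..?V w})" by (intro Max_ge) auto
      then show "length (bits v) < ?B w" by simp
    qed
    have "ok 0 (\<lambda>_ :: reg. 0)" unfolding ok_def by simp
    with wp_reduction_com[OF order.refl] obtain p \<rho> where
      "run reduction_com (0, \<lambda>_. 0, []) (p, \<rho>, encode_slp (reduction w))"
      unfolding wp_def by auto
    from runD(3)[OF this] have "exec w (?B w) reduction_com (0, reg_tapes (\<lambda>_. 0), [])
        (p, reg_tapes \<rho>, encode_slp (reduction w))" by simp
    from exec_Seq[OF exec_init_tapes this] show ?thesis by blast
  qed
  show "real (?B w) \<le> 4 * log 2 (real (length w + 2))" for w
  proof -
    let ?n = "length w + 2"
    have "Max ((\<lambda>v. length (bits v)) ` {..?V w}) \<in> (\<lambda>v. length (bits v)) ` {..?V w}"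
      by (intro Max_in) auto
    then obtain v where "Max ((\<lambda>v. length (bits v)) ` {..?V w}) = length (bits v)" "v \<in> {..?V w}"
      by (rule imageE)
    then have v: "v \<le> ?V w" "?B w = length (bits v) + 1" by (simp_all only: atMost_iff)
    \<comment> \<open>With \<open>n = length w + 2\<close>, a number up to \<open>n ^ 2\<close> has
      a representation of length \<open>k\<close> with \<open>2 ^ k <= 2 * n ^ 2\<close>. The
      additional cell gives another factor 2, and the resulting 4 is absorbed by
      \<open>n ^ 2\<close> because \<open>2 <= n\<close>. The exponent 4 becomes the constant of the
      space bound.\<close>
    have "(2::nat) ^ ?B w \<le> ?n ^ 4"
    proof -
      have "2 ^ length (bits v) \<le> 2 * ?n ^ 2"
      proof (cases "v = 0")
        case False
        then show ?thesis using length_bits[of v] v(1) by simp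
      qed (simp add: power2_eq_square)
      then have "2 ^ ?B w \<le> 2 ^ 2 * ?n ^ 2" unfolding v(2) by simp
      also have "\<dots> \<le> ?n ^ 2 * ?n ^ 2" by (intro mult_right_mono power_mono) auto
      also have "\<dots> = ?n ^ 4" by (simp flip: power_add)
      finally show ?thesis .
    qed
    then have "real (2 ^ ?B w) \<le> real (?n ^ 4)" by (rule of_nat_mono)
    then have "(2::real) ^ ?B w \<le> real ?n ^ 4" by simp
    then have "log 2 (2 ^ ?B w) \<le> log 2 (real ?n ^ 4)" by (intro log_mono) auto
    moreover have "log 2 ((2::real) ^ k) = real k" for k by (simp add: log_nat_power)
    moreover have "log 2 (real ?n ^ 4) = 4 * log 2 (real ?n)" by (subst log_nat_power) simp_all
    ultimately show ?thesis by (simp only:)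
  qed
qed simp

theorem theorem11:
  fixes a :: real
  assumes "a \<ge> 2"
  shows "logspace_reducible skew_PIT (compressed_word_problem a)"
  unfolding logspace_reducible_def
  using logspace_computable_reduction reduction_correct[OF assms]
  by (intro exI[of _ "\<lambda>w. encode_slp (reduction w)"]) blast

end
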